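(* Let $\alpha\in(0,1]$, $\lambda>0$, $K\ge 1$ an integer, and $p_1,\dots,p_K>0$ with $p_1+\dots+p_K=1$. Let $N^{\alpha,\lambda}$ be a fractional Poisson process of index $\alpha$ and scale $\lambda$, and let each of its events be assigned to one of the classes $1,\dots,K$, independently of each other and of $N^{\alpha,\lambda}$, with probability $p_i$ of being assigned to class $i$. Let $N^{(i)}(t)$ be the number of events in $[0,t]$ assigned to class $i$, and ${\bf N}(t)=(N^{(1)}(t),\dots,N^{(K)}(t))$. Then we have the distributional equality of processes $$\{{\bf N}(t)\}_{t\ge 0}\stackrel{d}{=}\big\{\big(N_1(p_1Y_\alpha(t)),\dots,N_K(p_KY_\alpha(t))\big)\big\}_{t\ge 0},$$ where $N_1,\dots,N_K$ are Poisson processes of rate $\lambda^\alpha$, $Y_\alpha$ is the inverse of a standard $\alpha$-stable subordinator, and these $K+1$ processes are mutually independent.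
   Context: Mittag-Leffler function: $E_\theta(z)=\sum_{\ell\ge 0} z^\ell/\Gamma(1+\theta\ell)$. Fractional Poisson process: for $\theta\in(0,1]$ and $\lambda>0$, ${\rm FPP}(\theta,\lambda)$ denotes the law of the counting process $N^{\theta,\lambda}(t)=\max\{n\ge 0: X_1+\dots+X_n\le t\}$, $t\ge 0$, where $X_1,X_2,\dots$ are i.i.d. nonnegative random variables with distribution function $F(x)=1-E_\theta(-\lambda^\theta x^\theta)$, $x\ge 0$. For $\theta=1$ this is a Poisson process of rate $\lambda$. Inverse stable subordinator: a standard $\theta$-stable subordinator $L_\theta$, $\theta\in(0,1]$, is a nondecreasing Lévy process with $\mathbb{E}(e^{-tL_\theta(s)})=e^{-st^\theta}$ for $s,t\ge 0$ (so $L_1(s)=s$). Its inverse is $Y_\theta(t)=\inf\{s>0:L_\theta(s)>t\}$, $t\ge 0$ (so $Y_1(t)=t$). *)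

theory Defs
  imports "HOL-Probability.Probability"
begin

section \<open>Stochastic processes\<close>

text \<open>
  A process with index set \<open>I\<close> and state space \<open>S\<close> is a family \<open>X t\<close> of random variables.
  Its law is the distribution of the whole path, as a random element of the product space
  \<open>\<Pi>\<^sub>M t\<in>I. S\<close>, so two processes have the same law iff they have the same finite-dimensional
  distributions.
\<close>

definition stochastic_process ::
    "'i set \<Rightarrow> 'b measure \<Rightarrow> 'a measure \<Rightarrow> ('i \<Rightarrow> 'a \<Rightarrow> 'b) \<Rightarrow> bool" where
  "stochastic_process I S M X \<longleftrightarrow> (\<forall>t\<in>I. X t \<in> measurable M S)"

definition process_law ::
    "'i set \<Rightarrow> 'b measure \<Rightarrow> 'a measure \<Rightarrow> ('i \<Rightarrow> 'a \<Rightarrow> 'b) \<Rightarrow> ('i \<Rightarrow> 'b) measure" where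
  "process_law I S M X = distr M (\<Pi>\<^sub>M t\<in>I. S) (\<lambda>\<omega>. \<lambda>t\<in>I. X t \<omega>)"

definition variable_sigma :: "'b measure \<Rightarrow> 'a measure \<Rightarrow> ('a \<Rightarrow> 'b) \<Rightarrow> 'a set set" where
  "variable_sigma S M X = sets (vimage_algebra (space M) X S)"

definition process_sigma ::
    "'i set \<Rightarrow> 'b measure \<Rightarrow> 'a measure \<Rightarrow> ('i \<Rightarrow> 'a \<Rightarrow> 'b) \<Rightarrow> 'a set set" where
  "process_sigma I S M X = variable_sigma (\<Pi>\<^sub>M t\<in>I. S) M (\<lambda>\<omega>. \<lambda>t\<in>I. X t \<omega>)"


section \<open>The fractional Poisson process\<close>

definition mittag_leffler :: "real \<Rightarrow> real \<Rightarrow> real" where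
  "mittag_leffler \<theta> z = (\<Sum>l. z ^ l / Gamma (1 + \<theta> * real l))"

definition fpp_waiting_cdf :: "real \<Rightarrow> real \<Rightarrow> real \<Rightarrow> real" where
  "fpp_waiting_cdf \<theta> r x =
     (if x < 0 then 0 else 1 - mittag_leffler \<theta> (- (r powr \<theta> * x powr \<theta>)))"

text \<open>
  The waiting times are \<open>x 1, x 2, \<dots>\<close>.  Under the law used in \<open>FPP\<close> below the set is almost
  surely finite; on the exceptional null set \<^const>\<open>Max\<close> returns a fixed arbitrary number.
\<close>

definition renewal_count :: "(nat \<Rightarrow> real) \<Rightarrow> real \<Rightarrow> nat" where
  "renewal_count x t = Max {n. (\<Sum>k=1..n. x k) \<le> t}"

text \<open>
  The law \<open>FPP \<theta> r\<close>: the i.i.d. waiting times are the coordinates of an infinite product of copies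
  of the measure with the prescribed distribution function.
\<close>

definition FPP :: "real \<Rightarrow> real \<Rightarrow> (real \<Rightarrow> nat) measure" where
  "FPP \<theta> r =
     process_law {0..} (count_space UNIV)
       (\<Pi>\<^sub>M k\<in>{1::nat..}. interval_measure (fpp_waiting_cdf \<theta> r))
       (\<lambda>t x. renewal_count x t)"

definition fractional_poisson_process ::
    "real \<Rightarrow> real \<Rightarrow> 'a measure \<Rightarrow> (real \<Rightarrow> 'a \<Rightarrow> nat) \<Rightarrow> bool" where
  "fractional_poisson_process \<theta> r M N \<longleftrightarrow>
     stochastic_process {0..} (count_space UNIV) M N \<and>
     process_law {0..} (count_space UNIV) M N = FPP \<theta> r"

text \<open>
  \<open>C k \<omega>\<close> is the class of the \<open>k\<close>-th event, in order of occurrence; the events in \<open>[0,t]\<close> are those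
  numbered \<open>1, \<dots>, N t \<omega>\<close>.
\<close>

definition class_count ::
    "(real \<Rightarrow> 'a \<Rightarrow> nat) \<Rightarrow> (nat \<Rightarrow> 'a \<Rightarrow> nat) \<Rightarrow> nat \<Rightarrow> real \<Rightarrow> 'a \<Rightarrow> nat" where
  "class_count N C i t \<omega> = card {k \<in> {1..N t \<omega>}. C k \<omega> = i}"


section \<open>Poisson processes and inverse stable subordinators\<close>

text \<open>All paths (rather than almost all) of a Levy process are required to be cadlag.\<close>

definition levy_process :: "'a measure \<Rightarrow> (real \<Rightarrow> 'a \<Rightarrow> real) \<Rightarrow> bool" where
  "levy_process M X \<longleftrightarrow>
     stochastic_process {0..} borel M X \<and>
     (AE \<omega> in M. X 0 \<omega> = 0) \<and>
     (\<forall>(t :: nat \<Rightarrow> real) n. 0 \<le> t 0 \<and> mono t \<longrightarrow>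
        prob_space.indep_vars M (\<lambda>_. borel) (\<lambda>j \<omega>. X (t (Suc j)) \<omega> - X (t j) \<omega>) {..<n}) \<and>
     (\<forall>s\<ge>0. \<forall>t\<ge>0. distr M borel (\<lambda>\<omega>. X (s + t) \<omega> - X s \<omega>) = distr M borel (X t)) \<and>
     (\<forall>\<omega>\<in>space M.
        (\<forall>t\<ge>0. ((\<lambda>s. X s \<omega>) \<longlongrightarrow> X t \<omega>) (at_right t)) \<and>
        (\<forall>t>0. \<exists>l. ((\<lambda>s. X s \<omega>) \<longlongrightarrow> l) (at_left t)))"

definition poisson_process :: "real \<Rightarrow> 'a measure \<Rightarrow> (real \<Rightarrow> 'a \<Rightarrow> nat) \<Rightarrow> bool" where
  "poisson_process r M N \<longleftrightarrow>
     levy_process M (\<lambda>t \<omega>. real (N t \<omega>)) \<and>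
     (\<forall>t\<ge>0. distr M (count_space UNIV) (N t) = measure_pmf (poisson_pmf (r * t)))"

definition stable_subordinator :: "real \<Rightarrow> 'a measure \<Rightarrow> (real \<Rightarrow> 'a \<Rightarrow> real) \<Rightarrow> bool" where
  "stable_subordinator \<theta> M L \<longleftrightarrow>
     levy_process M L \<and>
     (\<forall>\<omega>\<in>space M. mono_on {0..} (\<lambda>s. L s \<omega>)) \<and>
     (\<forall>s\<ge>0. \<forall>t\<ge>0. prob_space.expectation M (\<lambda>\<omega>. exp (- t * L s \<omega>)) = exp (- s * t powr \<theta>))"

text \<open>
  The infimum is over a nonempty set almost surely, since a stable subordinator is almost surely
  unbounded.  The value \<open>0\<close> on the exceptional null event replaces the unspecified \<open>Inf {}\<close>, so that
  the inverse is a nonnegative time everywhere.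
\<close>

definition inverse_process :: "(real \<Rightarrow> 'a \<Rightarrow> real) \<Rightarrow> real \<Rightarrow> 'a \<Rightarrow> real" where
  "inverse_process L t \<omega> =
     (if \<exists>s>0. L s \<omega> > t then Inf {s. s > 0 \<and> L s \<omega> > t} else 0)"

end

theory Submission
  imports Defs
begin

text \<open>
  Let \<open>\<mu> = r powr \<alpha>\<close>, and run the stable subordinator \<open>L\<close> at the arrival times \<open>S\<^sub>1 < S\<^sub>2 < \<dots>\<close> of an
  independent renewal process with exponential gaps of rate \<open>\<mu>\<close>.  Because \<open>L\<close> has independent
  stationary increments, the differences \<open>L S\<^sub>k - L S\<^sub>k\<^sub>-\<^sub>1\<close> are independent with Laplace transform
  \<open>\<mu> / (\<mu> + u powr \<alpha>)\<close>, which by Lerch's theorem is that of the Mittag-Leffler distribution.  Up to a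
  null event \<open>L S\<^sub>n \<le> t\<close> holds iff \<open>S\<^sub>n \<le> Y t\<close>, so the fractional Poisson process is the exponential
  renewal process evaluated at the inverse subordinator \<open>Y\<close>.  For a deterministic increasing clock,
  the memoryless property of the exponential distribution shows that the class counts of the marked
  renewal process have independent Poisson increments with rates \<open>\<mu> p\<^sub>i\<close>, exactly like
  \<open>N\<^sub>i (p\<^sub>i t)\<close>.  Integrating over the law of \<open>Y\<close> identifies the finite-dimensional distributions.
\<close>

section \<open>Process laws and independence\<close>

text \<open>The process \<open>N\<close> is given only through its law. That law is therefore
  realised elsewhere: on the product of the space carrying \<open>L\<close> with a fresh i.i.d.
  sequence of exponential gaps. Independence serves one purpose on each side, namely to freeze one
  ingredient and integrate it last: the marks on the counting side, the values of \<open>Y\<close>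
  on the Poisson side. After an exchange of integrals both sides are integrals over the same paths
  of \<open>Y\<close>, and only the integrands for a fixed monotone clock remain to be compared. The
  rate \<open>r powr \<alpha>\<close> is forced: the transform of the Mittag-Leffler waiting time
  contains \<open>r\<close> only as \<open>r powr \<alpha>\<close>, and \<open>L\<close> turns the
  argument \<open>u\<close> of the exponential transform into \<open>u powr \<alpha>\<close>. The
  delicate points are degenerate cases: the clock may stand still between two times, the infimum
  defining \<open>Y\<close> may be over an empty set, and a jump of \<open>L\<close> breaks the
  equivalence of \<open>L u \<le> t\<close> and \<open>u \<le> Y t\<close> at
  \<open>u = Y t\<close>.\<close>

lemma process_law_eqI:
  assumes M: "prob_space M" "prob_space M'"
    and X: "stochastic_process I S M X" "stochastic_process I S M' X'"
    and eq: "\<And>J A. finite J \<Longrightarrow> J \<subseteq> I \<Longrightarrow> (\<And>j. j \<in> J \<Longrightarrow> A j \<in> sets S) \<Longrightarrow>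
      emeasure M {\<omega> \<in> space M. \<forall>j\<in>J. X j \<omega> \<in> A j} = emeasure M' {\<omega> \<in> space M'. \<forall>j\<in>J. X' j \<omega> \<in> A j}"
  shows "process_law I S M X = process_law I S M' X'"
  unfolding process_law_def
proof (rule measure_eqI_PiM_infinite)
  interpret M: prob_space M by fact
  interpret M': prob_space M' by fact
  have [measurable]: "(\<lambda>\<omega>. \<lambda>t\<in>I. X t \<omega>) \<in> measurable M (\<Pi>\<^sub>M t\<in>I. S)"
    using X by (intro measurable_restrict) (auto simp: stochastic_process_def)
  have [measurable]: "(\<lambda>\<omega>. \<lambda>t\<in>I. X' t \<omega>) \<in> measurable M' (\<Pi>\<^sub>M t\<in>I. S)"
    using X by (intro measurable_restrict) (auto simp: stochastic_process_def)
  show "finite_measure (distr M (\<Pi>\<^sub>M t\<in>I. S) (\<lambda>\<omega>. \<lambda>t\<in>I. X t \<omega>))"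
    by (intro M.finite_measure_distr) measurable
  fix A J assume J: "finite J" "J \<subseteq> I" "\<And>i. i \<in> J \<Longrightarrow> A i \<in> sets S"
  have "prod_emb I (\<lambda>_. S) J (Pi\<^sub>E J A) \<in> sets (\<Pi>\<^sub>M t\<in>I. S)"
    using J by (intro sets_PiM_I) auto
  moreover have "(\<lambda>\<omega>. \<lambda>t\<in>I. X t \<omega>) -` prod_emb I (\<lambda>_. S) J (Pi\<^sub>E J A) \<inter> space M = {\<omega> \<in> space M. \<forall>j\<in>J. X j \<omega> \<in> A j}"
    using J X[unfolded stochastic_process_def, THEN bspec, THEN measurable_space]
    by (subst prod_emb_PiE) (auto simp: PiE_iff sets.sets_into_space subset_eq Ball_def split: if_splits dest: sets.sets_into_space)
  moreover have "(\<lambda>\<omega>. \<lambda>t\<in>I. X' t \<omega>) -` prod_emb I (\<lambda>_. S) J (Pi\<^sub>E J A) \<inter> space M' = {\<omega> \<in> space M'. \<forall>j\<in>J. X' j \<omega> \<in> A j}"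
    using J X[unfolded stochastic_process_def, THEN bspec, THEN measurable_space]
    by (subst prod_emb_PiE) (auto simp: PiE_iff sets.sets_into_space subset_eq Ball_def split: if_splits dest: sets.sets_into_space)
  ultimately show "emeasure (distr M (\<Pi>\<^sub>M t\<in>I. S) (\<lambda>\<omega>. \<lambda>t\<in>I. X t \<omega>)) (prod_emb I (\<lambda>_. S) J (Pi\<^sub>E J A))
    = emeasure (distr M' (\<Pi>\<^sub>M t\<in>I. S) (\<lambda>\<omega>. \<lambda>t\<in>I. X' t \<omega>)) (prod_emb I (\<lambda>_. S) J (Pi\<^sub>E J A))"
    using eq[OF J] by (simp add: emeasure_distr)
qed simp_all

text \<open>Over finitely many times a cylinder event is a countable disjoint union of events that
  prescribe every value, so point probabilities determine the law.\<close>

lemma process_law_eqI_countable: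
  assumes M: "prob_space M" "prob_space M'"
    and X: "stochastic_process I S M X" "stochastic_process I S M' X'"
    and S: "countable (space S)" "\<And>x. x \<in> space S \<Longrightarrow> {x} \<in> sets S"
    and eq: "\<And>J \<nu>. finite J \<Longrightarrow> J \<subseteq> I \<Longrightarrow> \<nu> \<in> J \<rightarrow> space S \<Longrightarrow>
      emeasure M {\<omega> \<in> space M. \<forall>j\<in>J. X j \<omega> = \<nu> j} = emeasure M' {\<omega> \<in> space M'. \<forall>j\<in>J. X' j \<omega> = \<nu> j}"
  shows "process_law I S M X = process_law I S M' X'"
proof (rule process_law_eqI[OF M X])
  fix J A assume J: "finite J" "J \<subseteq> I" "\<And>i. i \<in> J \<Longrightarrow> A i \<in> sets S"
  have sub: "A j \<subseteq> space S" if "j \<in> J" for j using J(3)[OF that] by (rule sets.sets_into_space)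
  have cnt: "countable (Pi\<^sub>E J A)"
    using J(1) sub S(1) by (intro countable_PiE) (auto intro: countable_subset)
  have *: "emeasure N {\<omega> \<in> space N. \<forall>j\<in>J. Z j \<omega> \<in> A j}
      = (\<integral>\<^sup>+\<nu>. emeasure N {\<omega> \<in> space N. \<forall>j\<in>J. Z j \<omega> = \<nu> j} \<partial>count_space (Pi\<^sub>E J A))"
    if Z: "stochastic_process I S N Z" for N Z
  proof -
    have "{\<omega> \<in> space N. \<forall>j\<in>J. Z j \<omega> \<in> A j}
        = (\<Union>\<nu>\<in>Pi\<^sub>E J A. {\<omega> \<in> space N. \<forall>j\<in>J. Z j \<omega> = \<nu> j})"
    proof (intro set_eqI iffI)
      fix \<omega> assume "\<omega> \<in> {\<omega> \<in> space N. \<forall>j\<in>J. Z j \<omega> \<in> A j}"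
      then show "\<omega> \<in> (\<Union>\<nu>\<in>Pi\<^sub>E J A. {\<omega> \<in> space N. \<forall>j\<in>J. Z j \<omega> = \<nu> j})"
        by (auto intro!: bexI[of _ "\<lambda>j\<in>J. Z j \<omega>"])
    qed (auto simp: PiE_iff)
    also have "emeasure N \<dots> = (\<integral>\<^sup>+\<nu>. emeasure N {\<omega> \<in> space N. \<forall>j\<in>J. Z j \<omega> = \<nu> j} \<partial>count_space (Pi\<^sub>E J A))"
    proof (rule emeasure_UN_countable[OF _ cnt])
      fix \<nu> assume \<nu>: "\<nu> \<in> Pi\<^sub>E J A"
      have "Z j -` {\<nu> j} \<inter> space N \<in> sets N" if "j \<in> J" for j
        using that J \<nu> sub[OF that] Z by (intro measurable_sets[OF _ S(2)]) (auto simp: stochastic_process_def PiE_iff)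
      then have "{\<omega>\<in>space N. Z j \<omega> = \<nu> j} \<in> sets N" if "j \<in> J" for j
        using that by (simp add: vimage_def Int_def conj_commute)
      then show "{\<omega> \<in> space N. \<forall>j\<in>J. Z j \<omega> = \<nu> j} \<in> sets N"
        using J(1) by (intro sets.sets_Collect_finite_All) auto
    next
      show "disjoint_family_on (\<lambda>\<nu>. {\<omega> \<in> space N. \<forall>j\<in>J. Z j \<omega> = \<nu> j}) (Pi\<^sub>E J A)"
        by (auto simp: disjoint_family_on_def intro: PiE_ext)
    qed
    finally show ?thesis .
  qed
  show "emeasure M {\<omega> \<in> space M. \<forall>j\<in>J. X j \<omega> \<in> A j} = emeasure M' {\<omega> \<in> space M'. \<forall>j\<in>J. X' j \<omega> \<in> A j}"
    unfolding *[OF X(1)] *[OF X(2)] using J sub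
    by (intro nn_integral_cong eq) (force simp: PiE_iff)+
qed

text \<open>Evaluation at a random time involves uncountably many variables; right continuity
  reduces it to a countable grid of times approached from the right.\<close>

lemma right_continuous_eval_measurable:
  fixes X :: "real \<Rightarrow> 'a \<Rightarrow> real"
  assumes X: "\<And>t. 0 \<le> t \<Longrightarrow> X t \<in> borel_measurable M"
    and cont: "\<And>\<omega> t. \<omega> \<in> space M \<Longrightarrow> 0 \<le> t \<Longrightarrow> ((\<lambda>s. X s \<omega>) \<longlongrightarrow> X t \<omega>) (at_right t)"
    and T[measurable]: "T \<in> borel_measurable M" and T0: "\<And>\<omega>. \<omega> \<in> space M \<Longrightarrow> 0 \<le> T \<omega>"
  shows "(\<lambda>\<omega>. X (T \<omega>) \<omega>) \<in> borel_measurable M"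
proof (rule borel_measurable_LIMSEQ_real)
  \<comment> \<open>The least multiple of \<open>1 / Suc n\<close> strictly above \<open>x\<close>.
    Strictness matters because \<open>at_right\<close> ignores the point itself.\<close>
  define D where "D n x = (real_of_int \<lfloor>real (Suc n) * x\<rfloor> + 1) / real (Suc n)" for n x
  have D: "x < D n x" "D n x \<le> x + inverse (real (Suc n))" for n x
  proof -
    have "real (Suc n) * x < real_of_int \<lfloor>real (Suc n) * x\<rfloor> + 1" by linarith
    then show "x < D n x" by (simp add: D_def field_simps)
    have "real_of_int \<lfloor>real (Suc n) * x\<rfloor> + 1 \<le> real (Suc n) * x + 1" by linarith
    then have "D n x \<le> (real (Suc n) * x + 1) / real (Suc n)"
      unfolding D_def by (rule divide_right_mono) simp
    then show "D n x \<le> x + inverse (real (Suc n))"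
      by (simp add: add_divide_distrib inverse_eq_divide)
  qed
  show "(\<lambda>n. X (D n (T \<omega>)) \<omega>) \<longlonglongrightarrow> X (T \<omega>) \<omega>" if "\<omega> \<in> space M" for \<omega>
  proof (rule filterlim_compose[OF cont[OF that T0[OF that]]])
    have "(\<lambda>n. D n (T \<omega>)) \<longlonglongrightarrow> T \<omega>"
    proof (rule real_tendsto_sandwich[where f="\<lambda>_. T \<omega>"])
      show "(\<lambda>n. T \<omega> + inverse (real (Suc n))) \<longlonglongrightarrow> T \<omega>"
        using LIMSEQ_inverse_real_of_nat_add by simp
    qed (use D in \<open>auto simp del: of_nat_Suc intro: always_eventually less_imp_le\<close>)
    then show "filterlim (\<lambda>n. D n (T \<omega>)) (at_right (T \<omega>)) sequentially"
      using D(1) by (auto simp: filterlim_at less_imp_neq[symmetric])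
  qed
  fix n
  \<comment> \<open>The rounded time takes countably many values, and \<open>T \<ge> 0\<close> lets
    a natural number index them.\<close>
  show "(\<lambda>\<omega>. X (D n (T \<omega>)) \<omega>) \<in> borel_measurable M"
  proof (rule measurable_compose_countable[where f="\<lambda>k \<omega>. X ((real k + 1) / real (Suc n)) \<omega>" and g="\<lambda>\<omega>. nat \<lfloor>real (Suc n) * T \<omega>\<rfloor>", THEN measurable_cong[THEN iffD1, rotated]])
    show "X ((real (nat \<lfloor>real (Suc n) * T \<omega>\<rfloor>) + 1) / real (Suc n)) \<omega> = X (D n (T \<omega>)) \<omega>" if "\<omega> \<in> space M" for \<omega>
      using T0[OF that] by (simp add: D_def)
  qed (auto intro!: X)
qed

text \<open>Separates one family from the sigma-algebra generated by all the others. This turns a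
  joint independence hypothesis into independence of two sigma-algebras, the form in which Fubini
  applies.\<close>

lemma (in prob_space) indep_sets_insert_split:
  assumes F: "indep_sets F J" and "j0 \<in> J" and s: "\<And>j. j \<in> J \<Longrightarrow> sigma_algebra (space M) (F j)"
  shows "indep_set (F j0) (sigma_sets (space M) (\<Union>j\<in>J - {j0}. F j))"
proof -
  have "indep_sets (\<lambda>b. sigma_sets (space M) (\<Union>i\<in>case_bool {j0} (J - {j0}) b. F i)) UNIV"
  proof (rule indep_sets_collect_sigma)
    show "indep_sets F (\<Union>b\<in>UNIV. case_bool {j0} (J - {j0}) b)"
      using F \<open>j0 \<in> J\<close> by (auto simp: UNIV_bool insert_absorb)
    show "Int_stable (F i)" if "i \<in> case_bool {j0} (J - {j0}) b" for b i
    proof -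
      have "i \<in> J" using that \<open>j0 \<in> J\<close> by (cases b) auto
      then interpret sigma_algebra "space M" "F i" by (rule s)
      show ?thesis by (auto simp: Int_stable_def)
    qed
    show "disjoint_family (case_bool {j0} (J - {j0}))"
      by (auto simp: disjoint_family_on_def split: bool.splits)
  qed
  moreover have "sigma_sets (space M) (F j0) = F j0"
    using s[OF \<open>j0 \<in> J\<close>] by (rule sigma_algebra.sigma_sets_eq)
  ultimately show ?thesis
    unfolding indep_set_def by (elim indep_sets_cong[THEN iffD1, rotated -1]) (auto split: bool.splits)
qed

text \<open>Independence says that the diagonal map carries \<open>M\<close> to the product of its
  restrictions to \<open>A\<close> and \<open>B\<close>, so an event about one outcome becomes an
  event about two independent ones. Both orders are stated because the second factor (the marks) is
  frozen on one side of the theorem and the first factor (the clock) on the other.\<close>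

lemma (in prob_space) indep_set_emeasure_diagonal:
  assumes ind: "indep_set (sets A) (sets B)" and sp: "space A = space M" "space B = space M"
    and D: "D \<in> sets (A \<Otimes>\<^sub>M B)"
  shows "emeasure M {\<omega>\<in>space M. (\<omega>, \<omega>) \<in> D} = (\<integral>\<^sup>+x. emeasure M {y\<in>space M. (x, y) \<in> D} \<partial>M)"
    and "emeasure M {\<omega>\<in>space M. (\<omega>, \<omega>) \<in> D} = (\<integral>\<^sup>+y. emeasure M {x\<in>space M. (x, y) \<in> D} \<partial>M)"
proof -
  have sa: "subalgebra M A" "subalgebra M B"
    using indep_setD_ev1[OF ind] indep_setD_ev2[OF ind] sp by (auto simp: subalgebra_def)
  define A' where "A' = restr_to_subalg M A"
  define B' where "B' = restr_to_subalg M B"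
  have [simp]: "sets A' = sets A" "sets B' = sets B" "space A' = space M" "space B' = space M"
    using sa by (auto simp: A'_def B'_def sets_restr_to_subalg space_restr_to_subalg)
  note [measurable_cong] = \<open>sets A' = sets A\<close> \<open>sets B' = sets B\<close>
  interpret A': prob_space A' unfolding A'_def using sa(1) prob_space_axioms by (intro prob_space_restr_to_subalg)
  interpret B': prob_space B' unfolding B'_def using sa(2) prob_space_axioms by (intro prob_space_restr_to_subalg)
  interpret AB: pair_prob_space A' B' ..
  have [measurable]: "(\<lambda>x. x) \<in> measurable M A'" "(\<lambda>x. x) \<in> measurable M B'"
    using sa by (auto simp: measurable_def subalgebra_def intro: sets.Int_space_eq2[THEN ssubst])
  have pair: "A' \<Otimes>\<^sub>M B' = distr M (A' \<Otimes>\<^sub>M B') (\<lambda>\<omega>. (\<omega>, \<omega>))"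
  proof (rule pair_measure_eqI)
    fix U V assume UV: "U \<in> sets A'" "V \<in> sets B'"
    then have "emeasure (distr M (A' \<Otimes>\<^sub>M B') (\<lambda>\<omega>. (\<omega>, \<omega>))) (U \<times> V) = emeasure M (U \<inter> V)"
      using UV[THEN sets.sets_into_space] by (subst emeasure_distr) (auto intro!: arg_cong[where f="emeasure M"])
    also have "\<dots> = emeasure M U * emeasure M V"
      using indep_setD[OF ind, of U V] UV by (simp add: emeasure_eq_measure ennreal_mult)
    finally show "emeasure A' U * emeasure B' V = emeasure (distr M (A' \<Otimes>\<^sub>M B') (\<lambda>\<omega>. (\<omega>, \<omega>))) (U \<times> V)"
      using UV[unfolded \<open>sets A' = sets A\<close> \<open>sets B' = sets B\<close>] sa by (simp add: A'_def B'_def emeasure_restr_to_subalg)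
  qed (auto intro: A'.sigma_finite_measure_axioms B'.sigma_finite_measure_axioms)
  have D': "D \<in> sets (A' \<Otimes>\<^sub>M B')" using D by (simp cong: sets_pair_measure_cong)
  have l: "emeasure M {\<omega>\<in>space M. (\<omega>, \<omega>) \<in> D} = emeasure (A' \<Otimes>\<^sub>M B') D"
    using D' by (subst pair, subst emeasure_distr) (auto simp: vimage_def Int_def conj_commute)
  have eA: "emeasure B' (Pair x -` D) = emeasure M {y\<in>space M. (x, y) \<in> D}" for x
  proof -
    have *: "Pair x -` D \<in> sets B" using D' by (subst \<open>sets B' = sets B\<close>[symmetric]) (rule sets_Pair1)
    then have "Pair x -` D = {y\<in>space M. (x, y) \<in> D}"
      using sets.sets_into_space[OF *] sp by auto
    then show ?thesis
      using emeasure_restr_to_subalg[OF sa(2) *] by (simp add: B'_def)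
  qed
  have eB: "emeasure A' ((\<lambda>x. (x, y)) -` D) = emeasure M {x\<in>space M. (x, y) \<in> D}" for y
  proof -
    have *: "(\<lambda>x. (x, y)) -` D \<in> sets A" using D' by (subst \<open>sets A' = sets A\<close>[symmetric]) (rule sets_Pair2)
    then have "(\<lambda>x. (x, y)) -` D = {x\<in>space M. (x, y) \<in> D}"
      using sets.sets_into_space[OF *] sp by auto
    then show ?thesis
      using emeasure_restr_to_subalg[OF sa(1) *] by (simp add: A'_def)
  qed
  have m1: "(\<lambda>x. emeasure B' (Pair x -` D)) \<in> borel_measurable A'"
    using D' by (rule B'.measurable_emeasure_Pair)
  have m2: "(\<lambda>y. emeasure A' ((\<lambda>x. (x, y)) -` D)) \<in> borel_measurable B'"
    using D' by (rule AB.measurable_emeasure_Pair2)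
  have "emeasure (A' \<Otimes>\<^sub>M B') D = (\<integral>\<^sup>+x. emeasure B' (Pair x -` D) \<partial>A')"
    using D' by (rule B'.emeasure_pair_measure_alt)
  also have "\<dots> = (\<integral>\<^sup>+x. emeasure B' (Pair x -` D) \<partial>M)"
    using m1 sa(1) unfolding A'_def by (intro nn_integral_subalgebra2) (auto simp: measurable_def subalgebra_def sets_restr_to_subalg space_restr_to_subalg)
  finally show "emeasure M {\<omega>\<in>space M. (\<omega>, \<omega>) \<in> D} = (\<integral>\<^sup>+x. emeasure M {y\<in>space M. (x, y) \<in> D} \<partial>M)"
    by (simp add: l eA)
  have "emeasure (A' \<Otimes>\<^sub>M B') D = (\<integral>\<^sup>+y. emeasure A' ((\<lambda>x. (x, y)) -` D) \<partial>B')"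
    using D' by (rule AB.emeasure_pair_measure_alt2)
  also have "\<dots> = (\<integral>\<^sup>+y. emeasure A' ((\<lambda>x. (x, y)) -` D) \<partial>M)"
    using m2 sa(2) unfolding B'_def by (intro nn_integral_subalgebra2) (auto simp: measurable_def subalgebra_def sets_restr_to_subalg space_restr_to_subalg)
  finally show "emeasure M {\<omega>\<in>space M. (\<omega>, \<omega>) \<in> D} = (\<integral>\<^sup>+y. emeasure M {x\<in>space M. (x, y) \<in> D} \<partial>M)"
    by (simp add: l eB)
qed

section \<open>Uniqueness of Laplace transforms\<close>

text \<open>On \<open>[0, 1]\<close> all moments are at most 1, so the Taylor polynomials of the
  characteristic function, whose coefficients come from the moments, converge to it everywhere with
  error at most \<open>2 |t|^n / n!\<close>.\<close>

lemma real_distribution_eqI_moments: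
  assumes M1: "real_distribution M1" and M2: "real_distribution M2"
    and b: "AE x in M1. 0 \<le> x \<and> x \<le> 1" "AE x in M2. 0 \<le> x \<and> x \<le> 1"
    and eq: "\<And>n. (\<integral>\<^sup>+x. ennreal (x ^ n) \<partial>M1) = (\<integral>\<^sup>+x. ennreal (x ^ n) \<partial>M2)"
  shows "M1 = M2"
proof (rule Levy_uniqueness[OF M1 M2], rule ext)
  fix t :: real
  have *: "(\<lambda>n. \<Sum>k\<le>n. ((\<i> * t) ^ k / fact k) * integral\<^sup>L M (\<lambda>x. x ^ k)) \<longlonglongrightarrow> char M t"
    if M: "real_distribution M" and b: "AE x in M. 0 \<le> x \<and> x \<le> 1" for M
  proof -
    interpret real_distribution M by fact
    have int: "integrable M (\<lambda>x. x ^ k)" for k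
      using b by (intro integrable_const_bound[where B=1]) (auto simp: power_le_one)
    have "(\<lambda>n. (2 * \<bar>t\<bar> ^ n / fact n) * 1) \<longlonglongrightarrow> 0"
      using tendsto_mult_left[OF summable_LIMSEQ_zero[OF summable_exp[of "\<bar>t\<bar>"]], of 2]
      by (simp add: field_simps)
    note lim = this
    have bound: "cmod (char M t - (\<Sum>k\<le>n. ((\<i> * t) ^ k / fact k) * expectation (\<lambda>x. x ^ k))) \<le> (2 * \<bar>t\<bar> ^ n / fact n) * 1" for n
    proof -
      have "AE x in M. \<bar>x\<bar> ^ n \<le> 1"
        using b by eventually_elim (simp add: power_le_one)
      then have "expectation (\<lambda>x. \<bar>x\<bar> ^ n) \<le> 1"
        by (intro integral_le_const integrable_const_bound[where B=1]) (auto simp: power_abs)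
      then show ?thesis
        using char_approx1[where n=n and t=t, OF int] by (elim order_trans) (intro mult_left_mono, auto)
    qed
    have "(\<lambda>n. char M t - (\<Sum>k\<le>n. ((\<i> * t) ^ k / fact k) * expectation (\<lambda>x. x ^ k))) \<longlonglongrightarrow> 0"
      by (rule Lim_null_comparison[OF always_eventually[OF allI[OF bound]] lim])
    from tendsto_diff[OF tendsto_const[of "char M t"] this] show ?thesis by simp
  qed
  have "integral\<^sup>L M1 (\<lambda>x. x ^ n) = integral\<^sup>L M2 (\<lambda>x. x ^ n)" for n
  proof -
    interpret M1: real_distribution M1 by fact
    interpret M2: real_distribution M2 by fact
    have "integral\<^sup>L M1 (\<lambda>x. x ^ n) = enn2real (\<integral>\<^sup>+x. ennreal (x ^ n) \<partial>M1)"
      using b by (intro integral_eq_nn_integral) auto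
    moreover have "integral\<^sup>L M2 (\<lambda>x. x ^ n) = enn2real (\<integral>\<^sup>+x. ennreal (x ^ n) \<partial>M2)"
      using b by (intro integral_eq_nn_integral) auto
    ultimately show ?thesis using eq by simp
  qed
  then show "char M1 t = char M2 t"
    using LIMSEQ_unique[OF *[OF M1 b(1)]] *[OF M2 b(2)] by simp
qed

text \<open>Lerch's theorem: the substitution \<open>x \<mapsto> exp (- x)\<close> turns equality of the Laplace transforms at
  \<open>v, v + 1, \<dots>\<close> into equality of the moments of two distributions on \<open>[0, 1]\<close>.\<close>

lemma nn_laplace_unique:
  fixes f g :: "real \<Rightarrow> ennreal"
  assumes [measurable]: "f \<in> borel_measurable borel" "g \<in> borel_measurable borel"
    and eq: "\<And>u. a < u \<Longrightarrow> (\<integral>\<^sup>+x. ennreal (exp (- u * x)) * f x * indicator {0<..} x \<partial>lborel)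
      = (\<integral>\<^sup>+x. ennreal (exp (- u * x)) * g x * indicator {0<..} x \<partial>lborel)"
    and fin: "\<And>u. a < u \<Longrightarrow> (\<integral>\<^sup>+x. ennreal (exp (- u * x)) * f x * indicator {0<..} x \<partial>lborel) < \<infinity>"
  shows "AE x in lborel. 0 < x \<longrightarrow> f x = g x"
proof -
  \<comment> \<open>Any point above \<open>a\<close> would do: the weight
    \<open>exp (- v * x)\<close> makes both functions integrable, with the same total mass
    \<open>c\<close>.\<close>
  define v where "v = a + 1"
  define w where "w h x = ennreal (exp (- v * x)) * h x * indicator {0<..} x" for h :: "real \<Rightarrow> ennreal" and x
  have [measurable]: "w h \<in> borel_measurable borel" if "h \<in> borel_measurable borel" for h
    using that unfolding w_def by measurable
  define c where "c = (\<integral>\<^sup>+x. w f x \<partial>lborel)"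
  have c: "c = (\<integral>\<^sup>+x. w g x \<partial>lborel)" "c < \<infinity>"
    using eq[of v] fin[of v] by (simp_all add: c_def w_def v_def)
  have cancel: "h x = k x" if "w h x = w k x" "0 < x" for h k x
    using that by (simp add: w_def ennreal_mult_cancel_left)
  show ?thesis
  proof (cases "c = 0")
    \<comment> \<open>A zero mass cannot be normalised to a probability, but then both weighted
      functions vanish almost everywhere.\<close>
    case True
    then have "AE x in lborel. w f x = 0" "AE x in lborel. w g x = 0"
      using c(1) nn_integral_0_iff_AE[of "w f" lborel] nn_integral_0_iff_AE[of "w g" lborel] by (simp_all add: c_def)
    then show ?thesis by eventually_elim (auto intro: cancel)
  next
    case False
    define N where "N h = density lborel (\<lambda>x. w h x / c)" for h
    define D where "D h = distr (N h) borel (\<lambda>x. exp (- x))" for h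
    have N: "prob_space (N h)" "real_distribution (D h)" "AE x in D h. 0 \<le> x \<and> x \<le> 1"
      "N h = distr (D h) borel (\<lambda>x. - ln x)"
      if [measurable]: "h \<in> borel_measurable borel" and h: "c = (\<integral>\<^sup>+x. w h x \<partial>lborel)" for h
    proof -
      show 1: "prob_space (N h)"
        using False c(2) by (intro prob_spaceI)
          (simp add: N_def emeasure_density nn_integral_divide h[symmetric] ennreal_divide_self)
      interpret prob_space "N h" by (rule 1)
      have s[measurable_cong]: "sets (N h) = sets borel" by (simp add: N_def)
      show "real_distribution (D h)"
        unfolding D_def by (intro real_distribution_distr) measurable
      have "AE x in N h. 0 < x"
        unfolding N_def by (subst AE_density) (auto simp: w_def indicator_def intro!: AE_I2 split: if_splits)
      then show "AE x in D h. 0 \<le> x \<and> x \<le> 1"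
        unfolding D_def by (subst AE_distr_iff) auto
      \<comment> \<open>The substitution is invertible, so equality of the laws on
        \<open>[0, 1]\<close> can be carried back.\<close>
      show "N h = distr (D h) borel (\<lambda>x. - ln x)"
        unfolding D_def by (subst distr_distr) (auto simp: comp_def distr_id2[OF s[symmetric]])
    qed
    have "(\<integral>\<^sup>+x. ennreal (x ^ n) \<partial>D h) = (\<integral>\<^sup>+x. ennreal (exp (- (v + real n) * x)) * h x * indicator {0<..} x \<partial>lborel) / c"
      if [measurable]: "h \<in> borel_measurable borel" for h n
    proof -
      have "(\<integral>\<^sup>+x. ennreal (x ^ n) \<partial>D h) = (\<integral>\<^sup>+x. w h x / c * ennreal (exp (- x) ^ n) \<partial>lborel)"
        unfolding D_def N_def by (subst nn_integral_distr) (auto simp: nn_integral_density)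
      also have "\<dots> = (\<integral>\<^sup>+x. ennreal (exp (- (v + real n) * x)) * h x * indicator {0<..} x / c \<partial>lborel)"
      proof (intro nn_integral_cong)
        fix x :: real
        have "exp (- v * x) * exp (- x) ^ n = exp (- (v + real n) * x)"
          by (simp add: exp_of_nat_mult[symmetric] exp_add[symmetric] algebra_simps)
        then have "ennreal (exp (- (v + real n) * x)) = ennreal (exp (- v * x)) * ennreal (exp (- x) ^ n)"
          by (simp add: ennreal_mult[symmetric])
        then show "w h x / c * ennreal (exp (- x) ^ n) = ennreal (exp (- (v + real n) * x)) * h x * indicator {0<..} x / c"
          by (simp add: w_def divide_ennreal_def mult_ac)
      qed
      also have "\<dots> = (\<integral>\<^sup>+x. ennreal (exp (- (v + real n) * x)) * h x * indicator {0<..} x \<partial>lborel) / c"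
        by (subst nn_integral_divide) auto
      finally show ?thesis .
    qed
    then have "D f = D g"
      using c eq[of "v + real n" for n] N(2,3)
      by (intro real_distribution_eqI_moments) (auto simp: c_def v_def)
    then have "N f = N g"
      using N(4)[of f] N(4)[of g] c by (simp add: c_def)
    then have "AE x in lborel. w f x / c = w g x / c"
      unfolding N_def by (intro sigma_finite_measure.density_unique[OF sigma_finite_lborel]) auto
    then show ?thesis
    proof eventually_elim
      case (elim x)
      then have "w f x / c * c = w g x / c * c" by simp
      then have "w f x = w g x"
        using False c(2) by (simp add: ennreal_divide_times ennreal_times_divide[symmetric] ennreal_divide_self)
      then show ?case using cancel by blast
    qed
  qed
qed

lemma nn_integral_powr_exp:
  assumes "0 < s" "0 < u"
  shows "(\<integral>\<^sup>+x. ennreal (exp (- u * x)) * ennreal (x powr (s - 1)) * indicator {0<..} x \<partial>lborel)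
    = ennreal (Gamma s / u powr s)"
proof -
  have "ennreal (Gamma s) = (\<integral>\<^sup>+t. ennreal (indicator {0..} t * t powr (s - 1) / exp t) \<partial>lborel)"
    by (rule Gamma_conv_nn_integral_real[OF assms(1)])
  also have "\<dots> = ennreal u * (\<integral>\<^sup>+x. ennreal (indicator {0..} (u * x) * (u * x) powr (s - 1) / exp (u * x)) \<partial>lborel)"
    using assms by (subst nn_integral_real_affine[where c=u and t=0]) auto
  also have "\<dots> = (\<integral>\<^sup>+x. ennreal u * ennreal (indicator {0..} (u * x) * (u * x) powr (s - 1) / exp (u * x)) \<partial>lborel)"
    by (subst nn_integral_cmult) auto
  also have "\<dots> = (\<integral>\<^sup>+x. ennreal (u powr s) * (ennreal (exp (- u * x)) * ennreal (x powr (s - 1)) * indicator {0<..} x) \<partial>lborel)"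
  proof (intro nn_integral_cong)
    fix x :: real
    show "ennreal u * ennreal (indicator {0..} (u * x) * (u * x) powr (s - 1) / exp (u * x))
        = ennreal (u powr s) * (ennreal (exp (- u * x)) * ennreal (x powr (s - 1)) * indicator {0<..} x)"
    proof (cases "0 < x")
      case True
      have "u * (indicator {0..} (u * x) * (u * x) powr (s - 1) / exp (u * x)) = u powr s * (exp (- u * x) * x powr (s - 1))"
        using True assms by (simp add: powr_mult powr_diff exp_minus field_simps)
      then show ?thesis using True assms by (simp add: ennreal_mult[symmetric])
    next
      case False
      then show ?thesis using assms by (cases "x = 0") (auto simp: indicator_def zero_le_mult_iff)
    qed
  qed
  also have "\<dots> = ennreal (u powr s) * (\<integral>\<^sup>+x. ennreal (exp (- u * x)) * ennreal (x powr (s - 1)) * indicator {0<..} x \<partial>lborel)"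
    by (subst nn_integral_cmult) auto
  finally have *: "ennreal (Gamma s) = ennreal (u powr s) * (\<integral>\<^sup>+x. ennreal (exp (- u * x)) * ennreal (x powr (s - 1)) * indicator {0<..} x \<partial>lborel)"
    (is "_ = _ * ?I") .
  have "ennreal (Gamma s / u powr s) = ennreal (1 / u powr s) * ennreal (Gamma s)"
    using assms Gamma_real_pos[of s] by (simp add: ennreal_mult[symmetric] del: ennreal_1)
  also have "\<dots> = ennreal (1 / u powr s) * ennreal (u powr s) * ?I"
    unfolding * by (simp add: mult.assoc)
  also have "ennreal (1 / u powr s) * ennreal (u powr s) = 1"
    using assms by (subst ennreal_mult[symmetric]) auto
  finally show ?thesis by simp
qed

section \<open>The Mittag-Leffler waiting time distribution\<close>

lemma AE_lborel_obtains:
  assumes "AE x in lborel. P x" "a < b"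
  obtains x :: real where "a < x" "x < b" "P x"
proof -
  have "\<exists>x. a < x \<and> x < b \<and> P x"
  proof (rule ccontr)
    assume "\<not> (\<exists>x. a < x \<and> x < b \<and> P x)"
    then have "AE x in lborel. x \<notin> {a<..<b}" using assms(1) by (auto elim!: eventually_mono)
    then have "emeasure lborel {a<..<b} = 0"
      using AE_iff_null_sets[of "{a<..<b}" lborel] by auto
    then show False using \<open>a < b\<close> by simp
  qed
  then show thesis using that by blast
qed

locale mittag_leffler_terms =
  fixes \<alpha> r :: real
  assumes \<alpha>: "0 < \<alpha>" and r: "0 < r"
begin

text \<open>The absolute value of a term of the Mittag-Leffler series at the negative argument that
  occurs in the waiting time distribution.\<close>

definition ml_term :: "nat \<Rightarrow> real \<Rightarrow> real" where
  "ml_term l x = (r powr \<alpha> * x powr \<alpha>) ^ l / Gamma (1 + \<alpha> * real l)"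

lemma ml_term_measurable[measurable]: "ml_term l \<in> borel_measurable borel"
  unfolding ml_term_def by measurable

lemma Gamma_pos: "0 < Gamma (1 + \<alpha> * real l)"
  using \<alpha> by (intro Gamma_real_pos add_pos_nonneg) auto

lemma ml_term_nonneg: "0 \<le> ml_term l x"
  using Gamma_pos[of l] by (simp add: ml_term_def)

lemma ml_term_mono: "0 \<le> x \<Longrightarrow> x \<le> y \<Longrightarrow> ml_term l x \<le> ml_term l y"
  using Gamma_pos[of l] \<alpha> unfolding ml_term_def
  by (intro divide_right_mono power_mono mult_left_mono powr_mono2) auto

text \<open>The Gamma integral of \<open>x powr (\<alpha> * l)\<close> cancels the denominator, so
  the Laplace transform turns the Mittag-Leffler series into a geometric series of ratio
  \<open>(r / u) powr \<alpha>\<close>.\<close>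

lemma nn_integral_ml_term:
  assumes "0 < u"
  shows "(\<integral>\<^sup>+x. ennreal (exp (- u * x)) * ennreal (ml_term l x) * indicator {0<..} x \<partial>lborel)
    = ennreal (((r / u) powr \<alpha>) ^ l / u)"
proof -
  have "(\<integral>\<^sup>+x. ennreal (exp (- u * x)) * ennreal (ml_term l x) * indicator {0<..} x \<partial>lborel)
     = (\<integral>\<^sup>+x. ennreal ((r powr \<alpha>) ^ l / Gamma (1 + \<alpha> * real l)) *
         (ennreal (exp (- u * x)) * ennreal (x powr ((1 + \<alpha> * real l) - 1)) * indicator {0<..} x) \<partial>lborel)"
  proof (intro nn_integral_cong)
    fix x :: real
    have "(x powr \<alpha>) ^ l = x powr (\<alpha> * real l)" if "0 < x"
      using that by (simp add: powr_powr[symmetric] powr_realpow)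
    then have "ennreal (ml_term l x) = ennreal ((r powr \<alpha>) ^ l / Gamma (1 + \<alpha> * real l)) * ennreal (x powr ((1 + \<alpha> * real l) - 1))" if "0 < x"
      using that Gamma_pos[of l] by (simp add: ml_term_def power_mult_distrib ennreal_mult[symmetric])
    then show "ennreal (exp (- u * x)) * ennreal (ml_term l x) * indicator {0<..} x
        = ennreal ((r powr \<alpha>) ^ l / Gamma (1 + \<alpha> * real l)) *
         (ennreal (exp (- u * x)) * ennreal (x powr ((1 + \<alpha> * real l) - 1)) * indicator {0<..} x)"
      by (cases "0 < x") (simp_all add: mult_ac)
  qed
  also have "\<dots> = ennreal ((r powr \<alpha>) ^ l / Gamma (1 + \<alpha> * real l)) *
      ennreal (Gamma (1 + \<alpha> * real l) / u powr (1 + \<alpha> * real l))"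
    using assms \<alpha> by (subst nn_integral_cmult, simp, subst nn_integral_powr_exp) (auto simp: add_pos_nonneg)
  also have "\<dots> = ennreal ((r powr \<alpha>) ^ l / Gamma (1 + \<alpha> * real l) * (Gamma (1 + \<alpha> * real l) / u powr (1 + \<alpha> * real l)))"
    using Gamma_pos[of l] by (subst ennreal_mult) auto
  also have "(r powr \<alpha>) ^ l / Gamma (1 + \<alpha> * real l) * (Gamma (1 + \<alpha> * real l) / u powr (1 + \<alpha> * real l))
      = ((r / u) powr \<alpha>) ^ l / u"
  proof -
    have "u powr (1 + \<alpha> * real l) = u * (u powr \<alpha>) ^ l"
      using assms by (simp add: powr_add powr_powr[symmetric] powr_realpow)
    then show ?thesis
      using Gamma_pos[of l] assms r by (simp add: powr_divide power_divide)
  qed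
  finally show ?thesis .
qed

lemma ratio_bounds: "r < u \<Longrightarrow> 0 < (r / u) powr \<alpha>" "r < u \<Longrightarrow> (r / u) powr \<alpha> < 1"
  using r \<alpha> powr_less_mono2[of \<alpha> "r / u" 1] by auto

text \<open>The progression \<open>k * l + j\<close> serves the full series (\<open>k = 1\<close>,
  \<open>j = 0\<close>) as well as its even and odd halves (\<open>k = 2\<close>).\<close>

lemma nn_integral_suminf_ml_term:
  assumes "r < u"
  shows "(\<integral>\<^sup>+x. ennreal (exp (- u * x)) * (\<Sum>l. ennreal (ml_term (k * l + j) x)) * indicator {0<..} x \<partial>lborel)
    = (\<Sum>l. ennreal (((r / u) powr \<alpha>) ^ (k * l + j) / u))"
proof -
  have "(\<integral>\<^sup>+x. ennreal (exp (- u * x)) * (\<Sum>l. ennreal (ml_term (k * l + j) x)) * indicator {0<..} x \<partial>lborel)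
    = (\<integral>\<^sup>+x. (\<Sum>l. ennreal (exp (- u * x)) * ennreal (ml_term (k * l + j) x) * indicator {0<..} x) \<partial>lborel)"
    by (intro nn_integral_cong) (simp add: ennreal_suminf_cmult ennreal_suminf_multc)
  also have "\<dots> = (\<Sum>l. (\<integral>\<^sup>+x. ennreal (exp (- u * x)) * ennreal (ml_term (k * l + j) x) * indicator {0<..} x \<partial>lborel))"
    by (subst nn_integral_suminf) auto
  also have "\<dots> = (\<Sum>l. ennreal (((r / u) powr \<alpha>) ^ (k * l + j) / u))"
    using assms r by (subst nn_integral_ml_term) auto
  finally show ?thesis .
qed

lemma suminf_ratio:
  assumes "r < u" "0 < k"
  shows "(\<Sum>l. ennreal (((r / u) powr \<alpha>) ^ (k * l + j) / u)) = ennreal (((r / u) powr \<alpha>) ^ j / u / (1 - ((r / u) powr \<alpha>) ^ k))"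
proof -
  let ?q = "(r / u) powr \<alpha>"
  have "\<bar>?q ^ k\<bar> < 1" using ratio_bounds[OF assms(1)] assms(2) by (simp add: power_less_one_iff abs_less_iff power_strict_mono)
  then have "(\<lambda>l. (?q ^ j / u) * (?q ^ k) ^ l) sums ((?q ^ j / u) * (1 / (1 - ?q ^ k)))"
    by (intro sums_mult geometric_sums) simp
  moreover have "(?q ^ j / u) * (?q ^ k) ^ l = ?q ^ (k * l + j) / u" for l
    by (simp add: power_add power_mult)
  ultimately have "(\<lambda>l. ?q ^ (k * l + j) / u) sums (?q ^ j / u / (1 - ?q ^ k))"
    by (simp only: times_divide_eq_right mult_1_right)
  then show ?thesis
    using assms r by (intro suminf_ennreal_eq) auto
qed

text \<open>Convergence comes from the transform instead of growth estimates for Gamma: the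
  transform of the sum is finite at \<open>r + 1\<close>, so the sum is finite almost everywhere, in
  particular at some point beyond \<open>x\<close>, and the terms increase with the
  argument.\<close>

lemma ml_term_summable: "0 \<le> x \<Longrightarrow> summable (\<lambda>l. ml_term l x)"
proof -
  assume x: "0 \<le> x"
  have "(\<integral>\<^sup>+y. ennreal (exp (- (r + 1) * y)) * (\<Sum>l. ennreal (ml_term l y)) * indicator {0<..} y \<partial>lborel) < \<infinity>"
    using nn_integral_suminf_ml_term[of "r + 1" 1 0] suminf_ratio[of "r + 1" 1 0] by simp
  then have "AE y in lborel. ennreal (exp (- (r + 1) * y)) * (\<Sum>l. ennreal (ml_term l y)) * indicator {0<..} y \<noteq> \<infinity>"
    by (intro nn_integral_noteq_infinite) auto
  then have "AE y in lborel. 0 < y \<longrightarrow> (\<Sum>l. ennreal (ml_term l y)) \<noteq> \<infinity>"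
    by eventually_elim (auto simp: ennreal_mult_eq_top_iff)
  then have *: "AE y in lborel. 0 < y \<longrightarrow> (\<Sum>l. ennreal (ml_term l y)) \<noteq> \<infinity>" .
  obtain y where y: "x < y" "(\<Sum>l. ennreal (ml_term l y)) \<noteq> \<infinity>"
    using x by (rule_tac AE_lborel_obtains[OF *, of x "x + 1"]) auto
  have "summable (\<lambda>l. ml_term l y)"
    using y(2) ml_term_nonneg by (intro summable_suminf_not_top) auto
  then show ?thesis
  proof (rule summable_comparison_test'[where N=0])
    show "norm (ml_term l x) \<le> ml_term l y" for l
      using ml_term_mono[OF x less_imp_le[OF y(1)], of l] ml_term_nonneg[of l x] by simp
  qed
qed

lemma mittag_leffler_summable: "summable (\<lambda>l. z ^ l / Gamma (1 + \<alpha> * real l))"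
proof (rule summable_norm_cancel)
  \<comment> \<open>Solves \<open>r powr \<alpha> * x powr \<alpha> = |z|\<close> for
    \<open>x\<close>, so that the absolute series at \<open>z\<close> is one already known to
    converge.\<close>
  have *: "(r powr \<alpha> * ((\<bar>z\<bar> / r powr \<alpha>) powr (1 / \<alpha>)) powr \<alpha>) = \<bar>z\<bar>"
    using r \<alpha> by (simp add: powr_powr)
  show "summable (\<lambda>l. norm (z ^ l / Gamma (1 + \<alpha> * real l)))"
    using ml_term_summable[of "(\<bar>z\<bar> / r powr \<alpha>) powr (1 / \<alpha>)"] Gamma_pos
    unfolding ml_term_def * by (simp add: power_abs abs_of_pos)
qed

lemma mittag_leffler_isCont: "isCont (mittag_leffler \<alpha>) z"
  unfolding mittag_leffler_def
  using isCont_powser_converges_everywhere[of "\<lambda>l. 1 / Gamma (1 + \<alpha> * real l)" z] mittag_leffler_summable by simp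

text \<open>Splitting the alternating series into its even and odd terms keeps all integrands nonnegative.\<close>

lemma mittag_leffler_even_odd:
  assumes "0 \<le> x"
  shows "summable (\<lambda>l. ml_term (2 * l + 0) x)" "summable (\<lambda>l. ml_term (2 * l + 1) x)"
    "mittag_leffler \<alpha> (- (r powr \<alpha> * x powr \<alpha>)) = (\<Sum>l. ml_term (2 * l + 0) x) - (\<Sum>l. ml_term (2 * l + 1) x)"
proof -
  have *: "summable (\<lambda>l. ml_term (2 * l + j) x)" for j
    using summable_reindex[OF ml_term_summable[OF assms], of "\<lambda>l. 2 * l + j"] ml_term_nonneg
    by (simp add: comp_def inj_on_def)
  then show 0: "summable (\<lambda>l. ml_term (2 * l + 0) x)" "summable (\<lambda>l. ml_term (2 * l + 1) x)" by blast+
  have "(\<lambda>l. (- (r powr \<alpha> * x powr \<alpha>)) ^ l / Gamma (1 + \<alpha> * real l)) sums mittag_leffler \<alpha> (- (r powr \<alpha> * x powr \<alpha>))"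
    unfolding mittag_leffler_def using mittag_leffler_summable by (rule summable_sums)
  then have "(\<lambda>n. \<Sum>l\<in>{n * 2..<n * 2 + 2}. (- (r powr \<alpha> * x powr \<alpha>)) ^ l / Gamma (1 + \<alpha> * real l)) sums mittag_leffler \<alpha> (- (r powr \<alpha> * x powr \<alpha>))"
    by (rule sums_group) simp
  also have "(\<lambda>n. \<Sum>l\<in>{n * 2..<n * 2 + 2}. (- (r powr \<alpha> * x powr \<alpha>)) ^ l / Gamma (1 + \<alpha> * real l))
      = (\<lambda>n. ml_term (2 * n + 0) x - ml_term (2 * n + 1) x)"
  proof (rule ext)
    fix n :: nat
    have "{n * 2..<n * 2 + 2} = {2 * n, 2 * n + 1}" by auto
    then show "(\<Sum>l\<in>{n * 2..<n * 2 + 2}. (- (r powr \<alpha> * x powr \<alpha>)) ^ l / Gamma (1 + \<alpha> * real l))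
        = ml_term (2 * n + 0) x - ml_term (2 * n + 1) x"
      by (simp add: ml_term_def power_minus_even)
  qed
  finally show "mittag_leffler \<alpha> (- (r powr \<alpha> * x powr \<alpha>)) = (\<Sum>l. ml_term (2 * l + 0) x) - (\<Sum>l. ml_term (2 * l + 1) x)"
    using sums_diff[OF 0[THEN summable_sums]] by (intro sums_unique2)
qed

end

text \<open>A set of full measure meets every interval to the right of \<open>x\<close>, which gives
  points of agreement tending to \<open>x\<close> from the right.\<close>

lemma right_continuous_eq_AE:
  fixes f g :: "real \<Rightarrow> real"
  assumes "AE x in lborel. a < x \<longrightarrow> f x = g x" and "a \<le> x"
    and f: "(f \<longlongrightarrow> f x) (at_right x)" and g: "(g \<longlongrightarrow> g x) (at_right x)"
  shows "f x = g x"
proof -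
  have "\<exists>y. x < y \<and> y < x + inverse (real (Suc n)) \<and> f y = g y" for n
    by (rule AE_lborel_obtains[OF assms(1), of x "x + inverse (real (Suc n))"]) (use \<open>a \<le> x\<close> in auto)
  then obtain y where y: "\<And>n. x < y n" "\<And>n. y n < x + inverse (real (Suc n))" "\<And>n. f (y n) = g (y n)"
    by metis
  have "y \<longlonglongrightarrow> x"
  proof (rule real_tendsto_sandwich[where f="\<lambda>_. x"])
    show "(\<lambda>n. x + inverse (real (Suc n))) \<longlonglongrightarrow> x"
      using LIMSEQ_inverse_real_of_nat_add by simp
  qed (auto intro!: always_eventually less_imp_le y simp del: of_nat_Suc)
  then have "filterlim y (at_right x) sequentially"
    using y(1) by (auto simp: filterlim_at less_imp_neq[symmetric])
  from LIMSEQ_unique[OF filterlim_compose[OF f this]] filterlim_compose[OF g this] show ?thesis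
    by (simp add: y(3))
qed

text \<open>By Fubini, \<open>exp (- u * x)\<close> is integrated first over
  \<open>0 < x < t\<close> and then over the law of \<open>t\<close>, giving the mean of
  \<open>(1 - exp (- u * t)) / u\<close>.\<close>

lemma (in real_distribution) nn_laplace_tail:
  assumes pos: "AE t in M. 0 \<le> t" and u: "0 < u"
    and l: "(\<integral>\<^sup>+t. ennreal (exp (- u * t)) \<partial>M) = ennreal l" "0 \<le> l"
  shows "(\<integral>\<^sup>+x. ennreal (exp (- u * x)) * emeasure M {x<..} * indicator {0<..} x \<partial>lborel) = ennreal ((1 - l) / u)"
proof -
  interpret lebM: pair_sigma_finite lborel M ..
  have "emeasure M {x<..} = (\<integral>\<^sup>+t. indicator {x<..} t \<partial>M)" for x by simp
  then have "(\<integral>\<^sup>+x. ennreal (exp (- u * x)) * emeasure M {x<..} * indicator {0<..} x \<partial>lborel)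
    = (\<integral>\<^sup>+x. (\<integral>\<^sup>+t. ennreal (exp (- u * x)) * indicator {0<..} x * indicator {p. fst p < snd p} (x, t) \<partial>M) \<partial>lborel)"
    by (intro nn_integral_cong, subst nn_integral_cmult)
       (auto simp: mult_ac indicator_def intro!: arg_cong2[where f="(*)"] arg_cong[where f="emeasure M"] simp flip: nn_integral_indicator)
  also have "\<dots> = (\<integral>\<^sup>+t. (\<integral>\<^sup>+x. ennreal (exp (- u * x)) * indicator {0<..} x * indicator {p. fst p < snd p} (x, t) \<partial>lborel) \<partial>M)"
    by (subst lebM.Fubini') (auto simp: split_beta')
  also have "\<dots> = (\<integral>\<^sup>+t. ennreal ((1 - exp (- u * t)) / u) \<partial>M)"
  proof (rule nn_integral_cong_AE, use pos in eventually_elim)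
    case (elim t)
    have "(\<integral>\<^sup>+x. ennreal (exp (- u * x)) * indicator {0<..} x * indicator {p. fst p < snd p} (x, t) \<partial>lborel)
        = (\<integral>\<^sup>+x. ennreal (exp (- u * x)) * indicator {0..t} x \<partial>lborel)"
      by (intro nn_integral_cong_AE eventually_mono[OF eventually_conj[OF AE_lborel_singleton[of 0] AE_lborel_singleton[of t]]])
         (auto simp: indicator_def)
    also have "\<dots> = ennreal (- exp (- u * t) / u - - exp (- u * 0) / u)"
      using elim u by (intro nn_integral_FTC_Icc) (auto intro!: derivative_eq_intros)
    also have "- exp (- u * t) / u - - exp (- u * 0) / u = (1 - exp (- u * t)) / u"
      using u by (simp add: field_simps)
    finally show ?case .
  qed
  also have "\<dots> = (\<integral>\<^sup>+t. ennreal (1 / u) * (1 - ennreal (exp (- u * t))) \<partial>M)"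
  proof (rule nn_integral_cong_AE, use pos in eventually_elim)
    case (elim t)
    have "ennreal ((1 - exp (- u * t)) / u) = ennreal (1 / u) * ennreal (1 - exp (- u * t))"
      using u by (subst ennreal_mult'[symmetric]) auto
    then show ?case using ennreal_minus[of "exp (- u * t)" 1] by simp
  qed
  also have "\<dots> = ennreal (1 / u) * (\<integral>\<^sup>+t. (1 - ennreal (exp (- u * t))) \<partial>M)"
    by (subst nn_integral_cmult) auto
  also have "(\<integral>\<^sup>+t. (1 - ennreal (exp (- u * t))) \<partial>M) = (\<integral>\<^sup>+t. 1 \<partial>M) - (\<integral>\<^sup>+t. ennreal (exp (- u * t)) \<partial>M)"
  proof (rule nn_integral_diff)
    show "AE t in M. ennreal (exp (- u * t)) \<le> 1"
      using pos by eventually_elim (use u in \<open>simp flip: ennreal_1\<close>)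
  qed (use l(1) in auto)
  also have "\<dots> = ennreal (1 - l)"
    unfolding l(1) using l(2) emeasure_space_1 ennreal_minus[of l 1] by simp
  also have "ennreal (1 / u) * ennreal (1 - l) = ennreal ((1 - l) / u)"
    using u by (subst ennreal_mult'[symmetric]) auto
  finally show ?thesis .
qed

context mittag_leffler_terms
begin

text \<open>With \<open>q = (r / u) powr \<alpha>\<close>, the even part, the odd part and the tail have Laplace transforms
  \<open>1 / (u (1 - q\<^sup>2))\<close>, \<open>q / (u (1 - q\<^sup>2))\<close> and \<open>1 / (u (1 + q))\<close>; the first is the sum of the other two.\<close>

lemma tail_eq_mittag_leffler:
  assumes "real_distribution M" and pos: "AE t in M. 0 \<le> t"
    and l: "\<And>u. 0 < u \<Longrightarrow> (\<integral>\<^sup>+t. ennreal (exp (- u * t)) \<partial>M) = ennreal (r powr \<alpha> / (r powr \<alpha> + u powr \<alpha>))"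
    and "0 \<le> x"
  shows "1 - cdf M x = mittag_leffler \<alpha> (- (r powr \<alpha> * x powr \<alpha>))"
proof -
  interpret real_distribution M by fact
  let ?f = "\<lambda>x. \<Sum>l. ennreal (ml_term (2 * l + 0) x)"
  let ?g = "\<lambda>x. (\<Sum>l. ennreal (ml_term (2 * l + 1) x)) + emeasure M {x<..}"
  have tail: "emeasure M {x<..} = ennreal (1 - cdf M x)" for x
  proof -
    have "emeasure M {x<..} = ennreal (prob (UNIV - {..x}))"
      by (auto simp: emeasure_eq_measure intro!: arg_cong[where f=prob])
    also have "prob (UNIV - {..x}) = 1 - cdf M x"
      using prob_compl[of "{..x}"] by (simp add: cdf_def)
    finally show ?thesis .
  qed
  have [measurable]: "(\<lambda>x. emeasure M {x<..}) \<in> borel_measurable borel"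
    unfolding tail using borel_measurable_mono[of "cdf M"] cdf_nondecreasing by (simp add: mono_def)
  have eq: "(\<integral>\<^sup>+x. ennreal (exp (- u * x)) * ?f x * indicator {0<..} x \<partial>lborel) = ennreal (1 / u / (1 - ((r / u) powr \<alpha>)\<^sup>2))"
    "(\<integral>\<^sup>+x. ennreal (exp (- u * x)) * ?g x * indicator {0<..} x \<partial>lborel) = ennreal (1 / u / (1 - ((r / u) powr \<alpha>)\<^sup>2))"
    if u: "r < u" for u
  proof -
    let ?q = "(r / u) powr \<alpha>"
    note q = ratio_bounds[OF u]
    have q2: "?q\<^sup>2 < 1" using q by (simp add: power_less_one_iff)
    have u0: "0 < u" using u r by simp
    show "(\<integral>\<^sup>+x. ennreal (exp (- u * x)) * ?f x * indicator {0<..} x \<partial>lborel) = ennreal (1 / u / (1 - ?q\<^sup>2))"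
      unfolding nn_integral_suminf_ml_term[OF u] using suminf_ratio[OF u, of 2 0] by simp
    have "(\<integral>\<^sup>+x. ennreal (exp (- u * x)) * ?g x * indicator {0<..} x \<partial>lborel)
      = (\<integral>\<^sup>+x. ennreal (exp (- u * x)) * (\<Sum>l. ennreal (ml_term (2 * l + 1) x)) * indicator {0<..} x \<partial>lborel)
        + (\<integral>\<^sup>+x. ennreal (exp (- u * x)) * emeasure M {x<..} * indicator {0<..} x \<partial>lborel)"
      by (subst nn_integral_add[symmetric]) (auto simp: distrib_left distrib_right)
    also have "\<dots> = ennreal (?q / u / (1 - ?q\<^sup>2)) + ennreal ((1 - r powr \<alpha> / (r powr \<alpha> + u powr \<alpha>)) / u)"
      unfolding nn_integral_suminf_ml_term[OF u] using suminf_ratio[OF u, of 2 1] r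
      by (subst nn_laplace_tail[OF pos u0 l[OF u0]]) auto
    also have "1 - r powr \<alpha> / (r powr \<alpha> + u powr \<alpha>) = 1 / (1 + ?q)"
    proof -
      define a b where "a = r powr \<alpha>" and "b = u powr \<alpha>"
      have ab: "0 < a" "0 < b" and q_eq: "?q = a / b" using u0 r by (simp_all add: a_def b_def powr_divide)
      show ?thesis
        unfolding q_eq a_def[symmetric] b_def[symmetric] using ab by (simp add: field_simps)
    qed
    also have "ennreal (?q / u / (1 - ?q\<^sup>2)) + ennreal (1 / (1 + ?q) / u) = ennreal (?q / u / (1 - ?q\<^sup>2) + 1 / (1 + ?q) / u)"
      using q q2 u0 by (intro ennreal_plus[symmetric]) auto
    also have "?q / u / (1 - ?q\<^sup>2) + 1 / (1 + ?q) / u = 1 / u / (1 - ?q\<^sup>2)"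
    proof -
      have "1 + ?q \<noteq> 0" "1 - ?q \<noteq> 0" using q by linarith+
      moreover have "1 - ?q\<^sup>2 = (1 + ?q) * (1 - ?q)" by (simp add: power2_eq_square algebra_simps)
      ultimately show ?thesis using u0 by (simp add: divide_simps)
    qed
    finally show "(\<integral>\<^sup>+x. ennreal (exp (- u * x)) * ?g x * indicator {0<..} x \<partial>lborel) = ennreal (1 / u / (1 - ?q\<^sup>2))" .
  qed
  \<comment> \<open>The series can be transformed only for \<open>u > r\<close>, where the geometric
    ratio is below 1; uniqueness from a half line of arguments is enough.\<close>
  have "AE x in lborel. 0 < x \<longrightarrow> ?f x = ?g x"
  proof (rule nn_laplace_unique[where a=r])
    fix u assume "r < u"
    note * = eq[OF this]
    show "(\<integral>\<^sup>+x. ennreal (exp (- u * x)) * ?f x * indicator {0<..} x \<partial>lborel)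
      = (\<integral>\<^sup>+x. ennreal (exp (- u * x)) * ?g x * indicator {0<..} x \<partial>lborel)"
      unfolding * by (rule refl)
    show "(\<integral>\<^sup>+x. ennreal (exp (- u * x)) * ?f x * indicator {0<..} x \<partial>lborel) < \<infinity>"
      unfolding * by (simp only: ennreal_less_top infinity_ennreal_def)
  qed measurable
  then have "AE x in lborel. 0 < x \<longrightarrow> 1 - cdf M x = mittag_leffler \<alpha> (- (r powr \<alpha> * x powr \<alpha>))"
  proof (rule eventually_mono)
    fix x assume elim: "0 < x \<longrightarrow> ?f x = ?g x"
    show "0 < x \<longrightarrow> 1 - cdf M x = mittag_leffler \<alpha> (- (r powr \<alpha> * x powr \<alpha>))"
    proof
      assume x: "0 < x"
      note s = mittag_leffler_even_odd[OF less_imp_le[OF x]]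
      have nonneg: "0 \<le> (\<Sum>l. ml_term (2 * l + 0) x)" "0 \<le> (\<Sum>l. ml_term (2 * l + 1) x)" "0 \<le> 1 - cdf M x"
        using suminf_nonneg[OF s(1) ml_term_nonneg] suminf_nonneg[OF s(2) ml_term_nonneg] cdf_bounded_prob[of x] by linarith+
      have "ennreal (\<Sum>l. ml_term (2 * l + 0) x) = ?g x"
        using elim x suminf_ennreal2[OF ml_term_nonneg s(1)] by (simp only: simp_thms)
      also have "\<dots> = ennreal ((\<Sum>l. ml_term (2 * l + 1) x) + (1 - cdf M x))"
        unfolding tail suminf_ennreal2[OF ml_term_nonneg s(2)] by (rule ennreal_plus[OF nonneg(2,3), symmetric])
      finally have "(\<Sum>l. ml_term (2 * l + 0) x) = (\<Sum>l. ml_term (2 * l + 1) x) + (1 - cdf M x)"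
        by (rule ennreal_inj[THEN iffD1, rotated 2]) (intro nonneg add_nonneg_nonneg)+
      then show "1 - cdf M x = mittag_leffler \<alpha> (- (r powr \<alpha> * x powr \<alpha>))"
        unfolding s(3) by simp
    qed
  qed
  \<comment> \<open>Agreement almost everywhere becomes agreement at every \<open>x\<close>, since
    distribution functions are right continuous and the Mittag-Leffler function is
    continuous.\<close>
  then show ?thesis
  proof (rule right_continuous_eq_AE[OF _ \<open>0 \<le> x\<close>])
    show "((\<lambda>x. 1 - cdf M x) \<longlongrightarrow> 1 - cdf M x) (at_right x)"
      using cdf_is_right_cont[of x] by (intro tendsto_intros) (simp add: continuous_within)
    have "eventually (\<lambda>y. 0 \<le> y) (at_right x)"
      using eventually_at_right_less[of x] by eventually_elim (use \<open>0 \<le> x\<close> in simp)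
    then have "((\<lambda>y. y powr \<alpha>) \<longlongrightarrow> x powr \<alpha>) (at_right x)"
      using \<alpha> by (intro tendsto_powr2 tendsto_ident_at tendsto_const) auto
    then show "((\<lambda>x. mittag_leffler \<alpha> (- (r powr \<alpha> * x powr \<alpha>))) \<longlongrightarrow> mittag_leffler \<alpha> (- (r powr \<alpha> * x powr \<alpha>))) (at_right x)"
      by (intro isCont_tendsto_compose[OF mittag_leffler_isCont] tendsto_minus tendsto_mult tendsto_const)
  qed
qed

text \<open>Links the measure in \<open>FPP\<close>, which is given by a distribution function, to
  any law that is known by its Laplace transform.\<close>

lemma interval_measure_fpp_waiting_cdf:
  assumes M: "real_distribution M" and pos: "AE t in M. 0 \<le> t"
    and l: "\<And>u. 0 < u \<Longrightarrow> (\<integral>\<^sup>+t. ennreal (exp (- u * t)) \<partial>M) = ennreal (r powr \<alpha> / (r powr \<alpha> + u powr \<alpha>))"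
  shows "interval_measure (fpp_waiting_cdf \<alpha> r) = M"
proof -
  interpret real_distribution M by fact
  have "cdf M = fpp_waiting_cdf \<alpha> r"
  proof
    fix x
    show "cdf M x = fpp_waiting_cdf \<alpha> r x"
    proof (cases "x < 0")
      case True
      have "AE t in M. t \<notin> {..x}" using pos by eventually_elim (use True in auto)
      then have "emeasure M {..x} = 0" using AE_iff_null_sets[of "{..x}" M] by auto
      then show ?thesis using True by (simp add: fpp_waiting_cdf_def cdf_def measure_def)
    next
      case False
      then show ?thesis using tail_eq_mittag_leffler[OF assms, of x] by (simp add: fpp_waiting_cdf_def)
    qed
  qed
  moreover have "interval_measure (cdf M) = M"
  proof (rule cdf_unique)
    show "real_distribution (interval_measure (cdf M))"
      using cdf_nondecreasing cdf_is_right_cont cdf_lim_at_bot cdf_lim_at_top_prob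
      by (intro real_distribution_interval_measure)
    show "cdf (interval_measure (cdf M)) = cdf M"
      using cdf_nondecreasing cdf_is_right_cont cdf_lim_at_bot by (intro cdf_interval_measure)
  qed (rule M)
  ultimately show ?thesis by simp
qed

end

section \<open>Marked exponential renewals\<close>

lemma AE_exponential_nonneg: "AE x in density lborel (exponential_density \<mu>). 0 \<le> x"
  by (subst AE_density) (auto simp: exponential_density_def)

text \<open>Memorylessness: on the event that the gap exceeds \<open>y\<close>, which has
  probability \<open>exp (- \<mu> * y)\<close>, the overshoot is again exponential.\<close>

lemma nn_integral_exponential_shift:
  assumes "0 < \<mu>" "0 \<le> y" and g[measurable]: "g \<in> borel_measurable borel"
  shows "(\<integral>\<^sup>+x. indicator {y<..} x * g (x - y) \<partial>density lborel (exponential_density \<mu>))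
    = ennreal (exp (- \<mu> * y)) * (\<integral>\<^sup>+x. g x \<partial>density lborel (exponential_density \<mu>))"
proof -
  have "(\<integral>\<^sup>+x. indicator {y<..} x * g (x - y) \<partial>density lborel (exponential_density \<mu>))
      = (\<integral>\<^sup>+x. ennreal (exponential_density \<mu> x) * (indicator {y<..} x * g (x - y)) \<partial>lborel)"
    by (subst nn_integral_density) auto
  also have "\<dots> = (\<integral>\<^sup>+x. ennreal (exponential_density \<mu> (y + x)) * (indicator {y<..} (y + x) * g (y + x - y)) \<partial>lborel)"
    by (subst nn_integral_real_affine[where c=1 and t=y]) auto
  also have "\<dots> = (\<integral>\<^sup>+x. ennreal (exp (- \<mu> * y)) * (ennreal (exponential_density \<mu> x) * g x) \<partial>lborel)"
  proof (intro nn_integral_cong_AE eventually_mono[OF AE_lborel_singleton[of 0]])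
    \<comment> \<open>At \<open>x = 0\<close> the strict indicator vanishes while the density is
      \<open>\<mu>\<close>; the point is discarded as a null set.\<close>
    fix x :: real assume "x \<noteq> 0"
    show "ennreal (exponential_density \<mu> (y + x)) * (indicator {y<..} (y + x) * g (y + x - y)) =
        ennreal (exp (- \<mu> * y)) * (ennreal (exponential_density \<mu> x) * g x)"
    proof (cases "x < 0")
      case True then show ?thesis by (simp add: exponential_density_def)
    next
      case False
      then have "exponential_density \<mu> (y + x) = exp (- \<mu> * y) * exponential_density \<mu> x"
        using assms(2) by (simp add: exponential_density_def exp_add[symmetric] algebra_simps)
      then have "ennreal (exponential_density \<mu> (y + x)) = ennreal (exp (- \<mu> * y)) * ennreal (exponential_density \<mu> x)"
        by (simp add: ennreal_mult' del: erlang_density_def)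
      then show ?thesis using False \<open>x \<noteq> 0\<close> by (simp add: mult.assoc)
    qed
  qed
  also have "\<dots> = ennreal (exp (- \<mu> * y)) * (\<integral>\<^sup>+x. g x \<partial>density lborel (exponential_density \<mu>))"
    by (subst nn_integral_cmult) (auto simp: nn_integral_density)
  finally show ?thesis .
qed

text \<open>Multiplying the density of rate \<open>\<mu>\<close> by \<open>exp (- s * x)\<close>
  gives \<open>\<mu> / (\<mu> + s)\<close> times the density of rate
  \<open>\<mu> + s\<close>.\<close>

lemma nn_integral_exponential_laplace:
  assumes "0 < \<mu>" "0 \<le> s"
  shows "(\<integral>\<^sup>+x. ennreal (exp (- s * x)) \<partial>density lborel (exponential_density \<mu>)) = ennreal (\<mu> / (\<mu> + s))"
proof -
  interpret prob_space "density lborel (exponential_density (\<mu> + s))"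
    using assms by (intro prob_space_exponential_density) auto
  have "(\<integral>\<^sup>+x. ennreal (exp (- s * x)) \<partial>density lborel (exponential_density \<mu>))
      = (\<integral>\<^sup>+x. ennreal (exponential_density \<mu> x) * ennreal (exp (- s * x)) \<partial>lborel)"
    by (subst nn_integral_density) auto
  also have "\<dots> = (\<integral>\<^sup>+x. ennreal (\<mu> / (\<mu> + s)) * ennreal (exponential_density (\<mu> + s) x) \<partial>lborel)"
    using assms by (intro nn_integral_cong)
      (auto simp: exponential_density_def ennreal_mult[symmetric] exp_add[symmetric] field_simps intro!: arg_cong[where f=ennreal])
  also have "\<dots> = ennreal (\<mu> / (\<mu> + s)) * (\<integral>\<^sup>+x. ennreal (exponential_density (\<mu> + s) x) \<partial>lborel)"
    by (subst nn_integral_cmult) auto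
  also have "(\<integral>\<^sup>+x. ennreal (exponential_density (\<mu> + s) x) \<partial>lborel) = 1"
    using emeasure_space_1 by (simp add: emeasure_density)
  finally show ?thesis by simp
qed

section \<open>First-step decomposition and restart of marked gap sequences\<close>

lemma (in sequence_space) nn_integral_PiM_iter:
  assumes [measurable]: "f \<in> borel_measurable S"
  shows "(\<integral>\<^sup>+w. f w \<partial>S) = (\<integral>\<^sup>+x. \<integral>\<^sup>+w. f (case_nat x w) \<partial>S \<partial>M)"
proof -
  have "(\<integral>\<^sup>+w. f w \<partial>S) = (\<integral>\<^sup>+w. f w \<partial>distr (M \<Otimes>\<^sub>M S) S (\<lambda>(s, \<omega>). case_nat s \<omega>))"
    by (simp only: PiM_iter)
  also have "\<dots> = (\<integral>\<^sup>+x. \<integral>\<^sup>+w. f (case_nat x w) \<partial>S \<partial>M)"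
    by (subst nn_integral_distr) (auto simp: P.nn_integral_fst[symmetric] split_beta')
  finally show ?thesis .
qed

text \<open>The formula also covers \<open>x = 0\<close>, where it is the point mass at 0: the
  inverse subordinator may be constant between two times.\<close>

definition poisson_weight :: "real \<Rightarrow> nat \<Rightarrow> real" where
  "poisson_weight x k = x ^ k / fact k * exp (- x)"

lemma poisson_weight_nonneg: "0 \<le> x \<Longrightarrow> 0 \<le> poisson_weight x k"
  by (simp add: poisson_weight_def)

text \<open>The gap sequence as seen from time \<open>y\<close> when exactly \<open>n\<close>
  arrivals have occurred: it starts with the remaining wait, that is, the sum of the first
  \<open>n + 1\<close> gaps minus \<open>y\<close>.\<close>

definition residual :: "nat \<Rightarrow> real \<Rightarrow> (nat \<Rightarrow> real) \<Rightarrow> nat \<Rightarrow> real" where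
  "residual n y e = (\<lambda>k. if k = 0 then sum e {..n} - y else e (n + k))"

lemma sum_residual: "sum (residual n y e) {..<Suc k} = sum e {..<Suc (n + k)} - y"
proof (induction k)
  case 0 then show ?case by (simp add: residual_def lessThan_Suc_atMost)
next
  case (Suc k)
  have "sum (residual n y e) {..<Suc (Suc k)} = sum (residual n y e) {..<Suc k} + e (n + Suc k)"
    by (simp add: residual_def)
  then show ?case unfolding Suc.IH by simp
qed

lemma sum_case_nat: "sum (case_nat x e) {..<Suc k} = x + sum e {..<k}"
  by (subst sum.lessThan_Suc_shift) simp

lemma card_case_nat: "card {k. k < Suc n \<and> (case k of 0 \<Rightarrow> a | Suc k \<Rightarrow> c k) = i}
    = (if a = i then 1 else 0) + card {k. k < n \<and> c k = i}"
proof -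
  have "{k. k < Suc n \<and> (case k of 0 \<Rightarrow> a | Suc k \<Rightarrow> c k) = i}
      = (if a = i then {0} else {}) \<union> Suc ` {k. k < n \<and> c k = i}"
  proof (rule set_eqI)
    fix k show "k \<in> {k. k < Suc n \<and> (case k of 0 \<Rightarrow> a | Suc k \<Rightarrow> c k) = i}
      \<longleftrightarrow> k \<in> (if a = i then {0} else {}) \<union> Suc ` {k. k < n \<and> c k = i}"
      by (cases k) auto
  qed
  also have "card \<dots> = (if a = i then 1 else 0) + card {k. k < n \<and> c k = i}"
    by (subst card_Un_disjoint) (auto simp: card_image)
  finally show ?thesis .
qed

text \<open>Bounding every partial sum, and not only the \<open>n\<close>-th one, makes the recursion \<open>arrivals_Suc\<close>
  valid for gaps of any sign; it also makes the predicate false for \<open>y < 0\<close>.\<close>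

definition arrivals :: "'i set \<Rightarrow> nat \<Rightarrow> real \<Rightarrow> ('i \<Rightarrow> nat) \<Rightarrow> (nat \<Rightarrow> real) \<Rightarrow> (nat \<Rightarrow> 'i) \<Rightarrow> bool" where
  "arrivals I n y d e c \<longleftrightarrow> (\<forall>k\<le>n. sum e {..<k} \<le> y) \<and> y < sum e {..<Suc n} \<and>
     (\<forall>i\<in>I. card {k. k < n \<and> c k = i} = d i)"

text \<open>Removing the first gap and the first mark shortens the time by \<open>x\<close> and the
  count of class \<open>a\<close> by one. The condition \<open>0 \<le> y\<close> is the bound on the
  empty sum, lost in the shift, and \<open>0 < d a\<close> keeps the truncated subtraction
  exact.\<close>

lemma arrivals_Suc:
  assumes "a \<in> I"
  shows "arrivals I (Suc n) y d (case_nat x e) (case_nat a c) \<longleftrightarrow>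
    0 \<le> y \<and> 0 < d a \<and> arrivals I n (y - x) (d(a := d a - 1)) e c"
proof -
  have "(\<forall>k\<le>Suc n. sum (case_nat x e) {..<k} \<le> y) \<longleftrightarrow> 0 \<le> y \<and> (\<forall>k\<le>n. sum e {..<k} \<le> y - x)"
    unfolding All_less_Suc2[of "Suc n", unfolded less_Suc_eq_le] sum_case_nat
    by (simp add: algebra_simps)
  moreover have "y < sum (case_nat x e) {..<Suc (Suc n)} \<longleftrightarrow> y - x < sum e {..<Suc n}"
    unfolding sum_case_nat by linarith
  moreover have "(\<forall>i\<in>I. card {k. k < Suc n \<and> case_nat a c k = i} = d i) \<longleftrightarrow>
      0 < d a \<and> (\<forall>i\<in>I. card {k. k < n \<and> c k = i} = (d(a := d a - 1)) i)"
    using assms unfolding card_case_nat by (auto split: if_splits)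
  ultimately show ?thesis
    unfolding arrivals_def by blast
qed

lemma residual_Suc: "residual (Suc n) y (case_nat x e) = residual n (y - x) e"
  by (auto simp: residual_def fun_eq_iff sum.atMost_Suc_shift simp del: sum.atMost_Suc)

lemma residual_0: "residual 0 y (case_nat x e) = case_nat (x - y) e"
  by (auto simp: residual_def fun_eq_iff split: nat.split)

text \<open>A pathwise restart: once the state at time \<open>y\<close> is known, a condition at a
  later time concerns only the residual gaps and the marks not yet used.\<close>

lemma arrivals_shift:
  assumes a: "arrivals I n y d e c" and "y \<le> y'" "n \<le> n'" "\<And>i. i \<in> I \<Longrightarrow> d i \<le> d' i"
  shows "arrivals I n' y' d' e c \<longleftrightarrow>
    arrivals I (n' - n) (y' - y) (\<lambda>i. d' i - d i) (residual n y e) (\<lambda>k. c (n + k))"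
proof -
  \<comment> \<open>False for the empty sum, which is \<open>0\<close> instead of
    \<open>sum e {..<n} - y\<close>; that case rests on \<open>y \<le> y'\<close> below.\<close>
  have S: "sum (residual n y e) {..<k} = sum e {..<n + k} - y" if "0 < k" for k
    using that sum_residual[of n y e "k - 1"] by simp
  have P1: "(\<forall>k\<le>n'. sum e {..<k} \<le> y') \<longleftrightarrow> (\<forall>k\<le>n' - n. sum (residual n y e) {..<k} \<le> y' - y)"
  proof safe
    fix k assume "\<forall>k\<le>n'. sum e {..<k} \<le> y'" "k \<le> n' - n"
    then show "sum (residual n y e) {..<k} \<le> y' - y"
      using S[of k] assms by (cases "k = 0") auto
  next
    fix k assume *: "\<forall>k\<le>n' - n. sum (residual n y e) {..<k} \<le> y' - y" "k \<le> n'"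
    show "sum e {..<k} \<le> y'"
    proof (cases "k \<le> n")
      case True
      then show ?thesis using a \<open>y \<le> y'\<close> unfolding arrivals_def by force
    next
      case False
      then show ?thesis using *(1)[rule_format, of "k - n"] *(2) S[of "k - n"] by simp
    qed
  qed
  have P2: "y' < sum e {..<Suc n'} \<longleftrightarrow> y' - y < sum (residual n y e) {..<Suc (n' - n)}"
    using \<open>n \<le> n'\<close> by (simp only: sum_residual) (simp add: less_diff_eq)
  have P3: "card {k. k < n' \<and> c k = i} = d' i \<longleftrightarrow> card {k. k < n' - n \<and> c (n + k) = i} = d' i - d i"
    if "i \<in> I" for i
  proof -
    have "{k. k < n' \<and> c k = i} = {k. k < n \<and> c k = i} \<union> (+) n ` {k. k < n' - n \<and> c (n + k) = i}"
    proof (rule set_eqI)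
      fix k show "k \<in> {k. k < n' \<and> c k = i}
        \<longleftrightarrow> k \<in> {k. k < n \<and> c k = i} \<union> (+) n ` {k. k < n' - n \<and> c (n + k) = i}"
      proof (cases "k < n")
        case False
        then obtain l where "k = n + l" by (metis le_add_diff_inverse not_less)
        then show ?thesis by auto
      qed (use \<open>n \<le> n'\<close> in auto)
    qed
    also have "card \<dots> = card {k. k < n \<and> c k = i} + card {k. k < n' - n \<and> c (n + k) = i}"
      by (subst card_Un_disjoint) (auto simp: card_image)
    finally have "card {k. k < n' \<and> c k = i} = d i + card {k. k < n' - n \<and> c (n + k) = i}"
      using a that by (simp add: arrivals_def)
    then show ?thesis using assms(4)[OF that] by linarith
  qed
  show ?thesis unfolding arrivals_def by (intro arg_cong2[where f="(\<and>)"] ball_cong P1 P2 P3 refl)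
qed

locale marked_exponential =
  fixes \<mu> :: real and q :: "nat pmf" and I :: "nat set"
  assumes \<mu>: "0 < \<mu>" and I: "finite I" "set_pmf q = I"
begin

abbreviation "E1 \<equiv> density lborel (exponential_density \<mu>)"
abbreviation "Es \<equiv> \<Pi>\<^sub>M i\<in>(UNIV :: nat set). E1"
abbreviation "Qs \<equiv> \<Pi>\<^sub>M i\<in>(UNIV :: nat set). measure_pmf q"
abbreviation "Z \<equiv> Es \<Otimes>\<^sub>M Qs"

sublocale E1: prob_space E1
  using \<mu> by (rule prob_space_exponential_density)
sublocale E: sequence_space E1 ..
sublocale Q: sequence_space "measure_pmf q" ..
sublocale Z: pair_prob_space Es Qs ..

lemma sum_pmf_I: "(\<Sum>i\<in>I. pmf q i) = 1"
  using sum_pmf_eq_1[of I q] I by simp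

lemma residual_measurable[measurable]: "residual n y \<in> measurable Es Es"
  unfolding residual_def by (intro measurable_abs_UNIV) measurable

lemma arrivals_measurable[measurable]:
  "Measurable.pred Z (\<lambda>z. arrivals I n y d (fst z) (snd z))"
  using I(1) unfolding arrivals_def by measurable

lemma shift_measurable[measurable]: "(\<lambda>c k. c (n + k)) \<in> measurable Qs Qs"
  by (intro measurable_abs_UNIV) measurable

text \<open>The first gap and the first mark are independent of the rest of the sequences, which
  again has law \<open>Z\<close>.\<close>

lemma emeasure_Z_iter:
  assumes B[measurable]: "B \<in> sets Z"
  shows "emeasure Z B = (\<Sum>a\<in>I. ennreal (pmf q a) *
    (\<integral>\<^sup>+x. emeasure Z {z\<in>space Z. (case_nat x (fst z), case_nat a (snd z)) \<in> B} \<partial>E1))"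
proof -
  have [measurable]: "(\<lambda>c. case_nat a c) \<in> measurable Qs Qs" for a
    by measurable
  have "emeasure Z B = (\<integral>\<^sup>+e. \<integral>\<^sup>+c. indicator B (e, c) \<partial>Qs \<partial>Es)"
    by (rule Q.P.emeasure_pair_measure[OF B])
  also have "\<dots> = (\<integral>\<^sup>+e. (\<Sum>a\<in>I. ennreal (pmf q a) * (\<integral>\<^sup>+c. indicator B (e, case_nat a c) \<partial>Qs)) \<partial>Es)"
    by (intro nn_integral_cong, subst Q.nn_integral_PiM_iter)
       (auto simp: nn_integral_measure_pmf_finite I mult.commute)
  also have "\<dots> = (\<Sum>a\<in>I. ennreal (pmf q a) * (\<integral>\<^sup>+e. (\<integral>\<^sup>+c. indicator B (e, case_nat a c) \<partial>Qs) \<partial>Es))"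
    by (subst nn_integral_sum) (auto simp: nn_integral_cmult)
  also have "\<dots> = (\<Sum>a\<in>I. ennreal (pmf q a) * (\<integral>\<^sup>+x. \<integral>\<^sup>+e. (\<integral>\<^sup>+c. indicator B (case_nat x e, case_nat a c) \<partial>Qs) \<partial>Es \<partial>E1))"
    by (subst E.nn_integral_PiM_iter) auto
  also have "\<dots> = (\<Sum>a\<in>I. ennreal (pmf q a) *
    (\<integral>\<^sup>+x. emeasure Z {z\<in>space Z. (case_nat x (fst z), case_nat a (snd z)) \<in> B} \<partial>E1))"
  proof (intro sum.cong arg_cong2[where f="(*)"] nn_integral_cong refl)
    fix x a
    have [measurable]: "{z\<in>space Z. (case_nat x (fst z), case_nat a (snd z)) \<in> B} \<in> sets Z"
      by measurable
    show "(\<integral>\<^sup>+e. (\<integral>\<^sup>+c. indicator B (case_nat x e, case_nat a c) \<partial>Qs) \<partial>Es)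
       = emeasure Z {z\<in>space Z. (case_nat x (fst z), case_nat a (snd z)) \<in> B}"
      by (subst Q.P.emeasure_pair_measure, measurable)
         (auto simp: space_pair_measure indicator_def intro!: nn_integral_cong)
  qed
  finally show ?thesis .
qed

end

text \<open>The density and the integrand combine to the constant factor
  \<open>\<mu> * exp (- \<mu> * y)\<close>, leaving the integral of \<open>(y - x) ^ n\<close>. This
  is the convolution that adds one arrival to a Poisson weight.\<close>

lemma nn_integral_exponential_power:
  assumes "0 \<le> y" "0 < \<mu>"
  shows "(\<integral>\<^sup>+x. (if x \<le> y then ennreal (exp (- \<mu> * (y - x)) * (y - x) ^ n) else 0) \<partial>density lborel (exponential_density \<mu>))
    = ennreal (\<mu> * exp (- \<mu> * y) * y ^ Suc n / (n + 1))"
proof -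
  have "(\<integral>\<^sup>+x. (if x \<le> y then ennreal (exp (- \<mu> * (y - x)) * (y - x) ^ n) else 0) \<partial>density lborel (exponential_density \<mu>))
      = (\<integral>\<^sup>+x. ennreal (exponential_density \<mu> x) * (if x \<le> y then ennreal (exp (- \<mu> * (y - x)) * (y - x) ^ n) else 0) \<partial>lborel)"
    by (subst nn_integral_density) auto
  also have "\<dots> = (\<integral>\<^sup>+x. ennreal (\<mu> * exp (- \<mu> * y) * (y - x) ^ n) * indicator {0..y} x \<partial>lborel)"
    using assms by (intro nn_integral_cong)
      (auto simp: exponential_density_def ennreal_mult'[symmetric] exp_add[symmetric] algebra_simps
        intro!: arg_cong[where f=ennreal] split: split_indicator)
  also have "\<dots> = ennreal (- (\<mu> * exp (- \<mu> * y) * (y - y) ^ Suc n / (n + 1)) - - (\<mu> * exp (- \<mu> * y) * (y - 0) ^ Suc n / (n + 1)))"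
  proof (rule nn_integral_FTC_Icc[where F="\<lambda>x. - (\<mu> * exp (- \<mu> * y) * (y - x) ^ Suc n / (n + 1))"])
    fix x :: real assume "x \<in> {0..y}"
    have "real n + 1 \<noteq> 0" by linarith
    then have "c * (real (Suc n) * (y - x) ^ n * - 1) / (real n + 1) = - (c * (y - x) ^ n)" for c
      by (simp add: field_simps)
    then show "((\<lambda>x. - (\<mu> * exp (- \<mu> * y) * (y - x) ^ Suc n / (n + 1))) has_real_derivative \<mu> * exp (- \<mu> * y) * (y - x) ^ n) (at x)"
      by (auto intro!: derivative_eq_intros simp del: power_Suc)
  qed (use assms in auto)
  finally show ?thesis by simp
qed

lemma arrivals_nonneg: "arrivals I n y d e c \<Longrightarrow> 0 \<le> y"
  by (auto simp: arrivals_def dest!: spec[of _ 0])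

context marked_exponential
begin

definition poisson_weights :: "real \<Rightarrow> (nat \<Rightarrow> nat) \<Rightarrow> real" where
  "poisson_weights y d = (\<Prod>i\<in>I. poisson_weight (\<mu> * pmf q i * y) (d i))"

lemma poisson_weights_nonneg: "0 \<le> y \<Longrightarrow> 0 \<le> poisson_weights y d"
  using \<mu> unfolding poisson_weights_def by (intro prod_nonneg) (auto intro!: poisson_weight_nonneg)

text \<open>As the class probabilities sum to one, the exponential factors merge, and the dependence
  on time is that of a single Poisson process of rate \<open>\<mu>\<close>.\<close>

lemma poisson_weights_eq:
  assumes "(\<Sum>i\<in>I. d i) = n"
  shows "poisson_weights y d = (\<Prod>i\<in>I. (\<mu> * pmf q i) ^ d i / fact (d i)) * (exp (- \<mu> * y) * y ^ n)"
proof -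
  have "poisson_weights y d = (\<Prod>i\<in>I. (\<mu> * pmf q i) ^ d i / fact (d i)) * (\<Prod>i\<in>I. y ^ d i) * (\<Prod>i\<in>I. exp (- (\<mu> * pmf q i * y)))"
    unfolding poisson_weights_def poisson_weight_def prod.distrib[symmetric]
    by (intro prod.cong) (auto simp: power_mult_distrib)
  also have "(\<Prod>i\<in>I. y ^ d i) = y ^ n"
    using assms by (simp add: power_sum[symmetric])
  also have "(\<Prod>i\<in>I. exp (- (\<mu> * pmf q i * y))) = exp (- \<mu> * y)"
    using sum_pmf_I I(1)
    by (simp add: exp_sum[symmetric] sum_negf sum_distrib_left[symmetric] sum_distrib_right[symmetric])
  finally show ?thesis by (simp add: mult_ac)
qed

text \<open>The part of the weight of \<open>d\<close> for which the first mark is \<open>a\<close>: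
  given the counts, all orders of the \<open>n + 1\<close> marks are equally likely, so its share is
  \<open>d a / (n + 1)\<close>.\<close>

lemma poisson_weights_decrement:
  assumes "(\<Sum>i\<in>I. d i) = Suc n" "a \<in> I" "0 < d a"
  shows "pmf q a * (\<mu> * exp (- \<mu> * y) * y ^ Suc n / (n + 1) *
      (\<Prod>i\<in>I. (\<mu> * pmf q i) ^ (d(a := d a - 1)) i / fact ((d(a := d a - 1)) i)))
    = real (d a) / (n + 1) * poisson_weights y d"
proof -
  obtain k where k: "d a = Suc k" using assms(3) by (cases "d a") auto
  have pos: "pmf q a \<noteq> 0" using assms(2) I(2) by (auto simp: set_pmf_iff)
  define R where "R = (\<Prod>i\<in>I - {a}. (\<mu> * pmf q i) ^ d i / fact (d i))"
  have 1: "(\<Prod>i\<in>I. (\<mu> * pmf q i) ^ d i / fact (d i)) = (\<mu> * pmf q a) ^ Suc k / (real (Suc k) * fact k) * R"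
    using prod.remove[OF I(1) assms(2), of "\<lambda>i. (\<mu> * pmf q i) ^ d i / fact (d i)"] by (simp add: k R_def)
  have 2: "(\<Prod>i\<in>I. (\<mu> * pmf q i) ^ (d(a := d a - 1)) i / fact ((d(a := d a - 1)) i)) = (\<mu> * pmf q a) ^ k / fact k * R"
    using I(1) assms(2) by (subst prod.remove[of _ a]) (auto simp: k R_def)
  show ?thesis
    unfolding poisson_weights_eq[OF assms(1)] 1 2 unfolding k by (simp add: divide_simps del: of_nat_Suc)
qed

lemma emeasure_arrivals_residual:
  assumes "(\<Sum>i\<in>I. d i) = n" and A[measurable]: "A \<in> sets Z"
  shows "emeasure Z {z\<in>space Z. arrivals I n y d (fst z) (snd z) \<and> (residual n y (fst z), \<lambda>k. snd z (n + k)) \<in> A}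
    = (if y < 0 then 0 else ennreal (poisson_weights y d) * emeasure Z A)"
  using assms(1)
proof (induction n arbitrary: d y)
  case 0
  then have d: "d i = 0" if "i \<in> I" for i using that I(1) by simp
  let ?B = "{z\<in>space Z. arrivals I 0 y d (fst z) (snd z) \<and> (residual 0 y (fst z), \<lambda>k. snd z (0 + k)) \<in> A}"
  have B[measurable]: "?B \<in> sets Z" by measurable
  show ?case
  proof (cases "y < 0")
    case True
    then have "\<not> arrivals I 0 y d e c" for e c using arrivals_nonneg by force
    then show ?thesis using True by simp
  next
    case False
    define g where "g x a = emeasure Z {z\<in>space Z. (case_nat x (fst z), case_nat a (snd z)) \<in> A}" for x a
    have [measurable]: "(\<lambda>x. g x a) \<in> borel_measurable borel" for a
    proof -
      have "(\<lambda>x. emeasure Z (Pair x -` {p\<in>space (borel \<Otimes>\<^sub>M Z). (case_nat (fst p) (fst (snd p)), case_nat a (snd (snd p))) \<in> A})) \<in> borel_measurable borel"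
        by (intro Z.P.measurable_emeasure_Pair) measurable
      then show ?thesis unfolding g_def by (simp add: vimage_def space_pair_measure)
    qed
    have "emeasure Z ?B = (\<Sum>a\<in>I. ennreal (pmf q a) *
        (\<integral>\<^sup>+x. emeasure Z {z\<in>space Z. (case_nat x (fst z), case_nat a (snd z)) \<in> ?B} \<partial>E1))"
      by (rule emeasure_Z_iter[OF B])
    also have "\<dots> = (\<Sum>a\<in>I. ennreal (pmf q a) * (\<integral>\<^sup>+x. indicator {y<..} x * g (x - y) a \<partial>E1))"
    proof (intro sum.cong refl arg_cong2[where f="(*)"] nn_integral_cong)
      fix a x assume "a \<in> I"
      have "case_nat x (fst z) \<in> space Es" "case_nat a (snd z) \<in> space Qs" for z :: "(nat \<Rightarrow> real) \<times> (nat \<Rightarrow> nat)"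
        by (auto simp: space_PiM)
      then show "emeasure Z {z\<in>space Z. (case_nat x (fst z), case_nat a (snd z)) \<in> ?B} = indicator {y<..} x * g (x - y) a"
        using False d
        by (auto simp: arrivals_def g_def residual_0 space_pair_measure indicator_def intro!: arg_cong[where f="emeasure Z"])
    qed
    \<comment> \<open>No arrival before \<open>y\<close> means that the first gap exceeds
      \<open>y\<close>; memorylessness makes its overshoot a fresh first gap.\<close>
    also have "\<dots> = (\<Sum>a\<in>I. ennreal (pmf q a) * (ennreal (exp (- \<mu> * y)) * (\<integral>\<^sup>+x. g x a \<partial>E1)))"
      using False \<mu> by (subst nn_integral_exponential_shift) auto
    also have "\<dots> = ennreal (exp (- \<mu> * y)) * emeasure Z A"
      unfolding emeasure_Z_iter[OF A] g_def by (simp add: sum_distrib_left mult_ac)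
    also have "exp (- \<mu> * y) = poisson_weights y d"
      using poisson_weights_eq[OF 0] d by simp
    finally show ?thesis using False by simp
  qed
next
  case (Suc n)
  let ?B = "{z\<in>space Z. arrivals I (Suc n) y d (fst z) (snd z) \<and> (residual (Suc n) y (fst z), \<lambda>k. snd z (Suc n + k)) \<in> A}"
  let ?C = "\<lambda>y d. {z\<in>space Z. arrivals I n y d (fst z) (snd z) \<and> (residual n y (fst z), \<lambda>k. snd z (n + k)) \<in> A}"
  have B[measurable]: "?B \<in> sets Z" by measurable
  show ?case
  proof (cases "y < 0")
    case True
    then have "\<not> arrivals I (Suc n) y d e c" for e c using arrivals_nonneg by force
    then show ?thesis using True by simp
  next
    case False
    define K where "K d = (\<Prod>i\<in>I. (\<mu> * pmf q i) ^ d i / fact (d i))" for d :: "nat \<Rightarrow> nat"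
    have K: "0 \<le> K d" for d unfolding K_def using \<mu> by (intro prod_nonneg) auto
    have "emeasure Z ?B = (\<Sum>a\<in>I. ennreal (pmf q a) *
        (\<integral>\<^sup>+x. emeasure Z {z\<in>space Z. (case_nat x (fst z), case_nat a (snd z)) \<in> ?B} \<partial>E1))"
      by (rule emeasure_Z_iter[OF B])
    also have "\<dots> = (\<Sum>a\<in>I. ennreal (real (d a) / (n + 1) * poisson_weights y d) * emeasure Z A)"
    proof (intro sum.cong refl)
      fix a assume a: "a \<in> I"
      have *: "emeasure Z {z\<in>space Z. (case_nat x (fst z), case_nat a (snd z)) \<in> ?B}
          = (if 0 < d a then emeasure Z (?C (y - x) (d(a := d a - 1))) else 0)" for x
      proof -
        have "case_nat x (fst z) \<in> space Es" "case_nat a (snd z) \<in> space Qs" for z :: "(nat \<Rightarrow> real) \<times> (nat \<Rightarrow> nat)"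
          by (auto simp: space_PiM)
        then show ?thesis
          using False a
          by (auto simp: arrivals_Suc residual_Suc space_pair_measure intro!: arg_cong[where f="emeasure Z"])
      qed
      show "ennreal (pmf q a) * (\<integral>\<^sup>+x. emeasure Z {z\<in>space Z. (case_nat x (fst z), case_nat a (snd z)) \<in> ?B} \<partial>E1)
          = ennreal (real (d a) / (n + 1) * poisson_weights y d) * emeasure Z A"
      proof (cases "0 < d a")
        case True
        let ?d = "d(a := d a - 1)"
        have sd: "(\<Sum>i\<in>I. ?d i) = n"
        proof -
          have "(\<Sum>i\<in>I. d i) = d a + (\<Sum>i\<in>I - {a}. d i)" using I(1) a by (rule sum.remove)
          moreover have "(\<Sum>i\<in>I. ?d i) = (d a - 1) + (\<Sum>i\<in>I - {a}. d i)"
            using I(1) a by (subst sum.remove[of _ a]) auto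
          ultimately show ?thesis using Suc.prems True by simp
        qed
        have pw: "ennreal (poisson_weights s ?d) = ennreal (exp (- \<mu> * s) * s ^ n) * ennreal (K ?d)" if "0 \<le> s" for s
          unfolding poisson_weights_eq[OF sd] K_def[symmetric] using that K[of ?d]
          by (subst ennreal_mult[symmetric]) (auto simp: mult.commute)
        \<comment> \<open>Gaps \<open>x > y\<close> leave a negative remaining time and contribute
          \<open>0\<close> by the induction hypothesis.\<close>
        have "(\<integral>\<^sup>+x. emeasure Z {z\<in>space Z. (case_nat x (fst z), case_nat a (snd z)) \<in> ?B} \<partial>E1)
            = (\<integral>\<^sup>+x. (if x \<le> y then ennreal (exp (- \<mu> * (y - x)) * (y - x) ^ n) else 0) * (ennreal (K ?d) * emeasure Z A) \<partial>E1)"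
          unfolding * Suc.IH[OF sd] using True pw by (intro nn_integral_cong) (auto simp: mult.assoc)
        also have "\<dots> = ennreal (\<mu> * exp (- \<mu> * y) * y ^ Suc n / (n + 1)) * (ennreal (K ?d) * emeasure Z A)"
          using False \<mu> by (subst nn_integral_multc) (auto simp: nn_integral_exponential_power)
        finally have "ennreal (pmf q a) * (\<integral>\<^sup>+x. emeasure Z {z\<in>space Z. (case_nat x (fst z), case_nat a (snd z)) \<in> ?B} \<partial>E1)
          = ennreal (pmf q a) * (ennreal (\<mu> * exp (- \<mu> * y) * y ^ Suc n / (n + 1)) * (ennreal (K ?d) * emeasure Z A))"
          by simp
        also have "\<dots> = ennreal (pmf q a * (\<mu> * exp (- \<mu> * y) * y ^ Suc n / (n + 1) * K ?d)) * emeasure Z A"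
          using K[of ?d] \<mu> False
          by (subst ennreal_mult, simp, simp, subst ennreal_mult) (auto simp: mult.assoc)
        also have "pmf q a * (\<mu> * exp (- \<mu> * y) * y ^ Suc n / (n + 1) * K ?d) = real (d a) / (n + 1) * poisson_weights y d"
          unfolding K_def by (rule poisson_weights_decrement[OF Suc.prems a True])
        finally show ?thesis .
      next
        case False
        then show ?thesis unfolding * by simp
      qed
    qed
    also have "\<dots> = ennreal (\<Sum>a\<in>I. real (d a) / (n + 1) * poisson_weights y d) * emeasure Z A"
      using poisson_weights_nonneg[of y d] False
      by (subst sum_ennreal[symmetric]) (auto simp: sum_distrib_right simp del: sum_ennreal)
    \<comment> \<open>The counts add up to \<open>n + 1\<close>, so the shares by first mark add up
      to one.\<close>
    also have "(\<Sum>a\<in>I. real (d a) / (n + 1) * poisson_weights y d) = poisson_weights y d"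
      using Suc.prems
      by (simp add: sum_distrib_right[symmetric] sum_divide_distrib[symmetric] of_nat_sum[symmetric] del: of_nat_sum)
    finally show ?thesis using False by simp
  qed
qed

end

section \<open>Counts of the marked renewal process at finitely many fixed times\<close>

definition renewals :: "(nat \<Rightarrow> real) \<Rightarrow> real \<Rightarrow> nat" where
  "renewals e y = Max {n. sum e {..<n} \<le> y}"

text \<open>For \<open>b < a\<close> the truncated difference \<open>b - a\<close> is
  \<open>0\<close>, whose weight is positive; hence the explicit zero.\<close>

definition poisson_transition :: "real \<Rightarrow> nat \<Rightarrow> nat \<Rightarrow> real" where
  "poisson_transition x a b = (if a \<le> b then poisson_weight x (b - a) else 0)"

lemma renewals_bounds:
  assumes e: "\<And>k. 0 \<le> e k" and y: "0 \<le> y" and l: "y < sum e {..<l}"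
  shows "sum e {..<renewals e y} \<le> y" "y < sum e {..<Suc (renewals e y)}"
    "\<And>n. sum e {..<n} \<le> y \<longleftrightarrow> n \<le> renewals e y"
proof -
  have mono: "sum e {..<k} \<le> sum e {..<n}" if "k \<le> n" for k n :: nat
    using that e by (intro sum_mono2) auto
  have "{n. sum e {..<n} \<le> y} \<subseteq> {..<l}"
    using l mono by (force simp: not_less[symmetric])
  then have fin: "finite {n. sum e {..<n} \<le> y}" by (rule finite_subset) simp
  have "0 \<in> {n. sum e {..<n} \<le> y}" using y by simp
  then have "renewals e y \<in> {n. sum e {..<n} \<le> y}"
    unfolding renewals_def using fin by (intro Max_in) blast+
  then show 1: "sum e {..<renewals e y} \<le> y" by simp
  show 3: "sum e {..<n} \<le> y \<longleftrightarrow> n \<le> renewals e y" for n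
    using fin 1 mono[of n "renewals e y"] by (auto simp: renewals_def intro: Max_ge)
  show "y < sum e {..<Suc (renewals e y)}" using 3[of "Suc (renewals e y)"] by simp
qed

lemma renewals_mono:
  assumes e: "\<And>k. 0 \<le> e k" and y: "0 \<le> y" "y \<le> y'" and l: "y' < sum e {..<l}"
  shows "renewals e y \<le> renewals e y'"
  using renewals_bounds(1)[where e=e, OF e y(1), of l] renewals_bounds(3)[where e=e, OF e _ l, of "renewals e y"] y l by simp

text \<open>All marks lie in \<open>I\<close>, so the class counts add up to the number of arrivals,
  and prescribing them prescribes that number.\<close>

lemma arrivals_iff_renewals:
  assumes e: "\<And>k. 0 \<le> e k" and y: "0 \<le> y" and l: "y < sum e {..<l}"
    and I: "finite I" "\<And>k. c k \<in> I"
  shows "arrivals I (\<Sum>i\<in>I. d i) y d e c \<longleftrightarrow> (\<forall>i\<in>I. card {k. k < renewals e y \<and> c k = i} = d i)"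
proof -
  note R = renewals_bounds[where e=e, OF e y l]
  have n: "(\<forall>k\<le>n. sum e {..<k} \<le> y) \<and> y < sum e {..<Suc n} \<longleftrightarrow> n = renewals e y" for n
    unfolding R(3) not_le[symmetric] by (auto simp: not_le intro: antisym)
  have "(\<Sum>i\<in>I. card {k. k < m \<and> c k = i}) = m" for m
  proof -
    have "(\<Sum>i\<in>I. card {k. k < m \<and> c k = i}) = card (\<Union>i\<in>I. {k. k < m \<and> c k = i})"
      using I(1) by (subst card_UN_disjoint) auto
    also have "(\<Union>i\<in>I. {k. k < m \<and> c k = i}) = {..<m}" using I(2) by auto
    finally show ?thesis by simp
  qed
  then have sum: "(\<Sum>i\<in>I. d i) = renewals e y"
    if "\<forall>i\<in>I. card {k. k < renewals e y \<and> c k = i} = d i"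
    using that[rule_format, symmetric] by (simp cong: sum.cong)
  show ?thesis
  proof
    assume *: "arrivals I (\<Sum>i\<in>I. d i) y d e c"
    then have "(\<Sum>i\<in>I. d i) = renewals e y"
      using n[of "\<Sum>i\<in>I. d i"] unfolding arrivals_def by blast
    then show "\<forall>i\<in>I. card {k. k < renewals e y \<and> c k = i} = d i"
      using * unfolding arrivals_def by metis
  next
    assume *: "\<forall>i\<in>I. card {k. k < renewals e y \<and> c k = i} = d i"
    show "arrivals I (\<Sum>i\<in>I. d i) y d e c"
      using n[of "\<Sum>i\<in>I. d i"] * unfolding arrivals_def sum[OF *] by blast
  qed
qed

context marked_exponential
begin

text \<open>Restart at the first time and apply \<open>emeasure_arrivals_residual\<close> with the
  remaining conditions as the event \<open>A\<close>. The induction generalises over the clock and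
  the counts because the restart recentres both.\<close>

lemma emeasure_arrivals_fidi:
  assumes "mono y" "y 0 = 0" "\<And>i. i \<in> I \<Longrightarrow> n 0 i = 0"
    and "\<And>j i. j < m \<Longrightarrow> i \<in> I \<Longrightarrow> n j i \<le> n (Suc j) i"
  shows "emeasure Z {z\<in>space Z. \<forall>j<m. arrivals I (\<Sum>i\<in>I. n (Suc j) i) (y (Suc j)) (n (Suc j)) (fst z) (snd z)}
    = ennreal (\<Prod>j<m. poisson_weights (y (Suc j) - y j) (\<lambda>i. n (Suc j) i - n j i))"
  using assms
proof (induction m arbitrary: y n)
  case 0
  then show ?case using Z.emeasure_space_1 by simp
next
  case (Suc m)
  let ?y = "\<lambda>j. y (Suc j) - y 1" and ?n = "\<lambda>j i. n (Suc j) i - n 1 i"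
  let ?N = "\<Sum>i\<in>I. n 1 i"
  let ?A = "{z\<in>space Z. \<forall>j<m. arrivals I (\<Sum>i\<in>I. ?n (Suc j) i) (?y (Suc j)) (?n (Suc j)) (fst z) (snd z)}"
  have n1: "n 1 i \<le> n (Suc j) i" if "j \<le> m" "i \<in> I" for j i
    using that
  proof (induction j)
    case (Suc j)
    then show ?case using Suc.prems(1) \<open>\<And>j i. j < Suc m \<Longrightarrow> i \<in> I \<Longrightarrow> n j i \<le> n (Suc j) i\<close>[of "Suc j" i] by simp
  qed simp
  have y1: "y 1 \<le> y (Suc j)" for j using Suc.prems(1) by (auto intro: monoD)
  have nn: "\<not> y 1 < 0" using monoD[OF Suc.prems(1), of 0 1] Suc.prems(2) by simp
  have A: "?A \<in> sets Z" by measurable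
  have IH: "emeasure Z ?A = ennreal (\<Prod>j<m. poisson_weights (?y (Suc j) - ?y j) (\<lambda>i. ?n (Suc j) i - ?n j i))"
  proof (rule Suc.IH)
    show "mono ?y" using Suc.prems(1) by (auto simp: mono_def)
    show "?n j i \<le> ?n (Suc j) i" if "j < m" "i \<in> I" for j i
      using Suc.prems(4)[of "Suc j" i] that by (simp add: diff_le_mono)
  qed auto
  \<comment> \<open>Given the state at the first time, the other \<open>m\<close> conditions concern
    the restarted gaps and marks alone.\<close>
  have ev: "{z\<in>space Z. \<forall>j<Suc m. arrivals I (\<Sum>i\<in>I. n (Suc j) i) (y (Suc j)) (n (Suc j)) (fst z) (snd z)}
      = {z\<in>space Z. arrivals I ?N (y 1) (n 1) (fst z) (snd z) \<and> (residual ?N (y 1) (fst z), \<lambda>k. snd z (?N + k)) \<in> ?A}"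
  proof (rule Collect_cong)
    fix z :: "(nat \<Rightarrow> real) \<times> (nat \<Rightarrow> nat)"
    have *: "arrivals I (\<Sum>i\<in>I. n (Suc (Suc j)) i) (y (Suc (Suc j))) (n (Suc (Suc j))) (fst z) (snd z)
        \<longleftrightarrow> arrivals I (\<Sum>i\<in>I. ?n (Suc j) i) (?y (Suc j)) (?n (Suc j)) (residual ?N (y 1) (fst z)) (\<lambda>k. snd z (?N + k))"
      if "j < m" "arrivals I ?N (y 1) (n 1) (fst z) (snd z)" for j
    proof -
      have "n 1 i \<le> n (Suc (Suc j)) i" if "i \<in> I" for i using n1[of "Suc j" i] \<open>j < m\<close> that by simp
      moreover from this have "(\<Sum>i\<in>I. ?n (Suc j) i) = (\<Sum>i\<in>I. n (Suc (Suc j)) i) - ?N"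
        by (intro sum_subtractf_nat) simp
      ultimately show ?thesis
        using y1[of "Suc j"] by (simp only:) (intro arrivals_shift[OF that(2)] sum_mono)
    qed
    have inA: "(residual ?N (y 1) (fst z), \<lambda>k. snd z (?N + k)) \<in> ?A \<longleftrightarrow>
        (\<forall>j<m. arrivals I (\<Sum>i\<in>I. ?n (Suc j) i) (?y (Suc j)) (?n (Suc j)) (residual ?N (y 1) (fst z)) (\<lambda>k. snd z (?N + k)))"
      by (simp add: space_pair_measure space_PiM)
    show "z \<in> space Z \<and> (\<forall>j<Suc m. arrivals I (\<Sum>i\<in>I. n (Suc j) i) (y (Suc j)) (n (Suc j)) (fst z) (snd z))
      \<longleftrightarrow> z \<in> space Z \<and> arrivals I ?N (y 1) (n 1) (fst z) (snd z) \<and> (residual ?N (y 1) (fst z), \<lambda>k. snd z (?N + k)) \<in> ?A"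
    proof (cases "arrivals I ?N (y 1) (n 1) (fst z) (snd z)")
      case True
      then show ?thesis using *[OF _ True] unfolding All_less_Suc2 inA unfolding One_nat_def by blast
    next
      case False
      then show ?thesis unfolding All_less_Suc2 One_nat_def by blast
    qed
  qed
  have "emeasure Z {z\<in>space Z. \<forall>j<Suc m. arrivals I (\<Sum>i\<in>I. n (Suc j) i) (y (Suc j)) (n (Suc j)) (fst z) (snd z)}
      = ennreal (poisson_weights (y 1) (n 1)) * emeasure Z ?A"
    unfolding ev by (simp only: emeasure_arrivals_residual[OF refl A] nn if_False)
  also have "\<dots> = ennreal (poisson_weights (y 1) (n 1) *
      (\<Prod>j<m. poisson_weights (?y (Suc j) - ?y j) (\<lambda>i. ?n (Suc j) i - ?n j i)))"
    unfolding IH using nn by (intro ennreal_mult'[symmetric] poisson_weights_nonneg) simp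
  also have "poisson_weights (y 1) (n 1) * (\<Prod>j<m. poisson_weights (?y (Suc j) - ?y j) (\<lambda>i. ?n (Suc j) i - ?n j i))
     = (\<Prod>j<Suc m. poisson_weights (y (Suc j) - y j) (\<lambda>i. n (Suc j) i - n j i))"
  proof -
    have "poisson_weights (?y (Suc j) - ?y j) (\<lambda>i. ?n (Suc j) i - ?n j i)
        = poisson_weights (y (Suc (Suc j)) - y (Suc j)) (\<lambda>i. n (Suc (Suc j)) i - n (Suc j) i)" if "j < m" for j
      using n1[of j] that unfolding poisson_weights_def by (intro prod.cong) auto
    moreover have "poisson_weights (y 1) (n 1) = poisson_weights (y (Suc 0) - y 0) (\<lambda>i. n (Suc 0) i - n 0 i)"
      using Suc.prems(2,3) unfolding poisson_weights_def by (intro prod.cong) auto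
    ultimately show ?thesis by (subst prod.lessThan_Suc_shift) simp
  qed
  finally show ?case .
qed

lemma AE_gaps_nonneg: "AE e in Es. \<forall>k. 0 \<le> e k"
  unfolding AE_all_countable
  by (intro allI E.AE_component AE_exponential_nonneg UNIV_I)

lemma AE_marks: "AE c in Qs. \<forall>k. c k \<in> I"
  unfolding AE_all_countable using I(2)
  by (intro allI Q.AE_component UNIV_I) (simp add: AE_measure_pmf_iff)

lemma nn_integral_exp_sum:
  "(\<integral>\<^sup>+e. ennreal (exp (- sum e {..<n})) \<partial>Es) = ennreal ((\<mu> / (\<mu> + 1)) ^ n)"
proof (induction n)
  case 0 then show ?case using E.P.emeasure_space_1 by simp
next
  case (Suc n)
  have "(\<integral>\<^sup>+e. ennreal (exp (- sum e {..<Suc n})) \<partial>Es)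
      = (\<integral>\<^sup>+x. \<integral>\<^sup>+e. ennreal (exp (- sum (case_nat x e) {..<Suc n})) \<partial>Es \<partial>E1)"
    by (subst E.nn_integral_PiM_iter) auto
  also have "\<dots> = (\<integral>\<^sup>+x. ennreal (exp (- 1 * x)) * (\<integral>\<^sup>+e. ennreal (exp (- sum e {..<n})) \<partial>Es) \<partial>E1)"
    unfolding sum_case_nat by (subst nn_integral_cmult[symmetric]) (auto simp: ennreal_mult[symmetric] exp_add[symmetric])
  also have "\<dots> = ennreal (\<mu> / (\<mu> + 1)) * ennreal ((\<mu> / (\<mu> + 1)) ^ n)"
    unfolding Suc.IH using nn_integral_exponential_laplace[OF \<mu>, of 1] by (subst nn_integral_multc) auto
  finally show ?case using \<mu> by (simp add: ennreal_mult[symmetric])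
qed

text \<open>An exponential Markov bound: the probability that all partial sums stay below
  \<open>y\<close> is at most \<open>exp y * (\<mu> / (\<mu> + 1)) ^ n\<close> for every
  \<open>n\<close>.\<close>

lemma AE_gaps_unbounded: "AE e in Es. \<exists>l. y < sum e {..<l}"
proof -
  let ?B = "{e\<in>space Es. \<forall>l. sum e {..<l} \<le> y}"
  have B[measurable]: "?B \<in> sets Es" by measurable
  have "emeasure Es ?B \<le> ennreal (exp y * (\<mu> / (\<mu> + 1)) ^ n)" for n
  proof -
    have "emeasure Es ?B = (\<integral>\<^sup>+e. indicator ?B e \<partial>Es)" by simp
    also have "\<dots> \<le> (\<integral>\<^sup>+e. ennreal (exp y) * ennreal (exp (- sum e {..<n})) \<partial>Es)"
      by (intro nn_integral_mono)
         (auto split: split_indicator simp: ennreal_mult[symmetric] exp_add[symmetric] ennreal_1[symmetric]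
            simp del: ennreal_1)
    also have "\<dots> = ennreal (exp y * (\<mu> / (\<mu> + 1)) ^ n)"
      using \<mu> by (subst nn_integral_cmult) (auto simp: nn_integral_exp_sum ennreal_mult)
    finally show ?thesis .
  qed
  moreover have "(\<lambda>n. ennreal (exp y * (\<mu> / (\<mu> + 1)) ^ n)) \<longlonglongrightarrow> ennreal (exp y * 0)"
    using \<mu> by (intro tendsto_ennrealI tendsto_mult tendsto_const LIMSEQ_power_zero) (simp add: field_simps)
  ultimately have "emeasure Es ?B \<le> ennreal (exp y * 0)"
    by (intro LIMSEQ_le_const) auto
  then have "?B \<in> null_sets Es" using B by (intro null_setsI) auto
  then show ?thesis by (rule AE_I') (auto simp: not_less)
qed

text \<open>The prescribed counts may be arbitrary: if one of them decreases, the event is null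
  because counts grow with time, and the product has a zero factor.\<close>

lemma emeasure_renewals_fidi:
  assumes y: "mono y" "y 0 = 0" and n0: "\<And>i. i \<in> I \<Longrightarrow> n 0 i = 0"
  shows "emeasure Z {z\<in>space Z. \<forall>j<m. \<forall>i\<in>I. card {k. k < renewals (fst z) (y (Suc j)) \<and> snd z k = i} = n (Suc j) i}
    = ennreal (\<Prod>j<m. \<Prod>i\<in>I. poisson_transition (\<mu> * pmf q i * (y (Suc j) - y j)) (n j i) (n (Suc j) i))"
    (is "emeasure Z ?L = _")
proof -
  have y0: "0 \<le> y j" for j using y monoD[OF y(1), of 0 j] by simp
  have [measurable]: "(\<lambda>z. renewals (fst z) t) \<in> measurable Z (count_space UNIV)" for t
    unfolding renewals_def by measurable
  have L[measurable]: "?L \<in> sets Z" using I(1) by measurable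
  have "AE z in Z. (\<forall>k. 0 \<le> fst z k) \<and> (\<exists>l. y m < sum (fst z) {..<l}) \<and> (\<forall>k. snd z k \<in> I)"
  proof (rule Z.AE_pair_measure)
    show "AE e in Es. AE c in Qs. (\<forall>k. 0 \<le> fst (e, c) k) \<and> (\<exists>l. y m < sum (fst (e, c)) {..<l}) \<and> (\<forall>k. snd (e, c) k \<in> I)"
      using AE_gaps_nonneg AE_gaps_unbounded[of "y m"]
    proof eventually_elim
      case (elim e)
      show ?case using AE_marks by eventually_elim (simp add: elim)
    qed
  qed measurable
  then have AE: "AE z in Z. (\<forall>k. 0 \<le> fst z k) \<and> (\<exists>l. \<forall>j\<le>m. y j < sum (fst z) {..<l}) \<and> (\<forall>k. snd z k \<in> I)"
    by eventually_elim (metis monoD[OF y(1)] le_less_trans)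
  show ?thesis
  proof (cases "\<forall>j<m. \<forall>i\<in>I. n j i \<le> n (Suc j) i")
    case True
    have "emeasure Z ?L
        = emeasure Z {z\<in>space Z. \<forall>j<m. arrivals I (\<Sum>i\<in>I. n (Suc j) i) (y (Suc j)) (n (Suc j)) (fst z) (snd z)}"
    proof (rule emeasure_eq_AE)
      show "AE z in Z. z \<in> ?L \<longleftrightarrow> z \<in> {z\<in>space Z. \<forall>j<m. arrivals I (\<Sum>i\<in>I. n (Suc j) i) (y (Suc j)) (n (Suc j)) (fst z) (snd z)}"
        using AE
      proof eventually_elim
        case (elim z)
        then obtain l where "\<And>j. j \<le> m \<Longrightarrow> y j < sum (fst z) {..<l}" by blast
        then have "arrivals I (\<Sum>i\<in>I. n (Suc j) i) (y (Suc j)) (n (Suc j)) (fst z) (snd z) \<longleftrightarrow>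
          (\<forall>i\<in>I. card {k. k < renewals (fst z) (y (Suc j)) \<and> snd z k = i} = n (Suc j) i)" if "j < m" for j
          using elim y0 that I(1) by (intro arrivals_iff_renewals[where l=l]) auto
        then show ?case by auto
      qed
    qed measurable
    also have "\<dots> = ennreal (\<Prod>j<m. poisson_weights (y (Suc j) - y j) (\<lambda>i. n (Suc j) i - n j i))"
      using True n0 by (intro emeasure_arrivals_fidi y) auto
    finally show ?thesis
      unfolding poisson_weights_def using True by (simp add: poisson_transition_def)
  next
    case False
    then obtain j i where ji: "j < m" "i \<in> I" "n (Suc j) i < n j i" by (auto simp: not_le)
    have "AE z in Z. z \<notin> ?L"
      using AE
    proof eventually_elim
      case (elim z)
      then obtain l where l: "\<And>j. j \<le> m \<Longrightarrow> y j < sum (fst z) {..<l}" by blast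
      \<comment> \<open>A decrease cannot start at index \<open>0\<close>, where the prescribed
        counts vanish.\<close>
      obtain j' where j': "j = Suc j'" using ji n0 by (cases j) auto
      have "card {k. k < renewals (fst z) (y j) \<and> snd z k = i} \<le> card {k. k < renewals (fst z) (y (Suc j)) \<and> snd z k = i}"
        using elim y0 renewals_mono[of "fst z" "y j" "y (Suc j)" l] l[of "Suc j"] ji(1) monoD[OF y(1), of j "Suc j"]
        by (intro card_mono) auto
      then show ?case using ji by (force simp: j')
    qed
    then have "emeasure Z ?L = 0" using AE_iff_null_sets[OF L] by auto
    moreover have "(\<Prod>i\<in>I. poisson_transition (\<mu> * pmf q i * (y (Suc j) - y j)) (n j i) (n (Suc j) i)) = 0"
      using ji I(1) by (intro prod_zero) (auto simp: poisson_transition_def intro!: bexI[of _ i])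
    then have "(\<Prod>j<m. \<Prod>i\<in>I. poisson_transition (\<mu> * pmf q i * (y (Suc j) - y j)) (n j i) (n (Suc j) i)) = 0"
      using ji by (intro prod_zero) auto
    ultimately show ?thesis by (simp only: ennreal_0)
  qed
qed

end

section \<open>Finite-dimensional distributions of Poisson processes\<close>

lemma (in prob_space) levy_increment_distr:
  assumes L: "levy_process M X" and s: "0 \<le> s" "s \<le> t" and A: "A \<in> sets borel"
  shows "prob {\<omega>\<in>space M. X t \<omega> - X s \<omega> \<in> A} = prob {\<omega>\<in>space M. X (t - s) \<omega> \<in> A}"
proof -
  have [measurable]: "X u \<in> borel_measurable M" if "0 \<le> u" for u
    using L that by (auto simp: levy_process_def stochastic_process_def)
  have "\<forall>s\<ge>0. \<forall>t\<ge>0. distr M borel (\<lambda>\<omega>. X (s + t) \<omega> - X s \<omega>) = distr M borel (X t)"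
    using L unfolding levy_process_def by blast
  from this[rule_format, of s "t - s"] s have "measure (distr M borel (\<lambda>\<omega>. X t \<omega> - X s \<omega>)) A = measure (distr M borel (X (t - s))) A"
    by simp
  then show ?thesis
    using s A by (simp add: measure_distr vimage_def Int_def conj_commute)
qed

lemma (in prob_space) levy_increments_prob:
  assumes L: "levy_process M X" and t: "mono t" "0 \<le> t 0"
    and J: "finite J" "\<And>j. j \<in> J \<Longrightarrow> A j \<in> sets borel"
  shows "prob {\<omega>\<in>space M. \<forall>j\<in>J. X (t (Suc j)) \<omega> - X (t j) \<omega> \<in> A j}
    = (\<Prod>j\<in>J. prob {\<omega>\<in>space M. X (t (Suc j) - t j) \<omega> \<in> A j})"
proof (cases "J = {}")
  case True
  then show ?thesis by (simp add: prob_space)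
next
  case False
  have t0: "0 \<le> t j" for j using t monoD[OF t(1), of 0 j] by simp
  obtain n where n: "J \<subseteq> {..<n}"
    using finite_nat_iff_bounded J(1) by blast
  have "indep_vars (\<lambda>_. borel) (\<lambda>j \<omega>. X (t (Suc j)) \<omega> - X (t j) \<omega>) {..<n}"
    using L t unfolding levy_process_def by blast
  from indep_varsD[OF this False J(1) n J(2)]
  have "prob (\<Inter>j\<in>J. (\<lambda>\<omega>. X (t (Suc j)) \<omega> - X (t j) \<omega>) -` A j \<inter> space M)
    = (\<Prod>j\<in>J. prob ((\<lambda>\<omega>. X (t (Suc j)) \<omega> - X (t j) \<omega>) -` A j \<inter> space M))"
    by simp
  also have "(\<Inter>j\<in>J. (\<lambda>\<omega>. X (t (Suc j)) \<omega> - X (t j) \<omega>) -` A j \<inter> space M)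
      = {\<omega>\<in>space M. \<forall>j\<in>J. X (t (Suc j)) \<omega> - X (t j) \<omega> \<in> A j}"
    using False by auto
  also have "(\<Prod>j\<in>J. prob ((\<lambda>\<omega>. X (t (Suc j)) \<omega> - X (t j) \<omega>) -` A j \<inter> space M))
      = (\<Prod>j\<in>J. prob {\<omega>\<in>space M. X (t (Suc j) - t j) \<omega> \<in> A j})"
  proof (rule prod.cong)
    fix j assume "j \<in> J"
    then show "prob ((\<lambda>\<omega>. X (t (Suc j)) \<omega> - X (t j) \<omega>) -` A j \<inter> space M) = prob {\<omega>\<in>space M. X (t (Suc j) - t j) \<omega> \<in> A j}"
      using levy_increment_distr[OF L t0[of j] monoD[OF t(1)] J(2), of "Suc j" j] by (simp add: vimage_def Int_def conj_commute)
  qed simp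
  finally show ?thesis .
qed

lemma poisson_process_measurable:
  assumes "poisson_process l M N" "0 \<le> t"
  shows "N t \<in> measurable M (count_space UNIV)"
proof -
  have "(\<lambda>\<omega>. real (N t \<omega>)) \<in> borel_measurable M"
    using assms by (auto simp: poisson_process_def levy_process_def stochastic_process_def)
  then have "(\<lambda>\<omega>. nat \<lfloor>real (N t \<omega>)\<rfloor>) \<in> measurable M (count_space UNIV)" by measurable
  then show ?thesis by simp
qed

lemma (in prob_space) poisson_process_prob:
  assumes N: "poisson_process l M N" and l: "0 < l" and t: "0 \<le> t"
  shows "prob {\<omega>\<in>space M. N t \<omega> = k} = poisson_weight (l * t) k"
proof (cases "t = 0")
  \<comment> \<open>The rate is \<open>0\<close> here, and the law comes from the almost sure
    starting value instead of a Poisson distribution of positive rate.\<close>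
  case True
  have [measurable]: "N 0 \<in> measurable M (count_space UNIV)"
    using poisson_process_measurable[OF N] by simp
  have "AE \<omega> in M. N 0 \<omega> = 0"
    using N by (simp add: poisson_process_def levy_process_def)
  then have "prob {\<omega>\<in>space M. N 0 \<omega> = k} = (if k = 0 then 1 else 0)"
    by (cases "k = 0") (auto intro!: prob_Collect_eq_1[THEN iffD2] prob_Collect_eq_0[THEN iffD2] simp: prob_eq_0)
  then show ?thesis using True by (simp add: poisson_weight_def power_0_left)
next
  case False
  have d: "distr M (count_space UNIV) (N t) = measure_pmf (poisson_pmf (l * t))"
    using N t by (simp add: poisson_process_def)
  have [measurable]: "N t \<in> measurable M (count_space UNIV)"
    by (rule poisson_process_measurable[OF N t])
  have "prob {\<omega>\<in>space M. N t \<omega> = k} = measure (distr M (count_space UNIV) (N t)) {k}"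
    by (simp add: measure_distr vimage_def Int_def conj_commute)
  also have "\<dots> = poisson_weight (l * t) k"
    unfolding d using False l t by (simp add: measure_pmf_single poisson_weight_def)
  finally show ?thesis .
qed

text \<open>As the process starts at \<open>0\<close> almost surely, prescribing its values is the
  same as prescribing its increments. These are compared as reals, so that a prescribed decrease
  stays visible.\<close>

lemma (in prob_space) poisson_process_fidi:
  assumes N: "poisson_process l M N" and l: "0 < l" and t: "mono t" "t 0 = 0" and n0: "n 0 = 0"
  shows "prob {\<omega>\<in>space M. \<forall>j<m. N (t (Suc j)) \<omega> = n (Suc j)}
    = (\<Prod>j<m. poisson_transition (l * (t (Suc j) - t j)) (n j) (n (Suc j)))"
proof -
  have L: "levy_process M (\<lambda>t \<omega>. real (N t \<omega>))" using N by (simp add: poisson_process_def)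
  have t0: "0 \<le> t j" for j using t monoD[OF t(1), of 0 j] by simp
  have [measurable]: "N (t j) \<in> measurable M (count_space UNIV)" for j
    by (rule poisson_process_measurable[OF N t0])
  let ?d = "\<lambda>j. real (n (Suc j)) - real (n j)"
  have "prob {\<omega>\<in>space M. \<forall>j<m. N (t (Suc j)) \<omega> = n (Suc j)}
      = prob {\<omega>\<in>space M. \<forall>j\<in>{..<m}. real (N (t (Suc j)) \<omega>) - real (N (t j) \<omega>) \<in> {?d j}}"
  proof (rule measure_eq_AE)
    have "AE \<omega> in M. N 0 \<omega> = 0" using L by (simp add: levy_process_def)
    then show "AE \<omega> in M. \<omega> \<in> {\<omega>\<in>space M. \<forall>j<m. N (t (Suc j)) \<omega> = n (Suc j)} \<longleftrightarrow>
      \<omega> \<in> {\<omega>\<in>space M. \<forall>j\<in>{..<m}. real (N (t (Suc j)) \<omega>) - real (N (t j) \<omega>) \<in> {?d j}}"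
    proof eventually_elim
      case (elim \<omega>)
      have "(\<forall>j<m. N (t (Suc j)) \<omega> = n (Suc j)) \<longleftrightarrow> (\<forall>j<m. real (N (t (Suc j)) \<omega>) - real (N (t j) \<omega>) = ?d j)"
      proof (intro iffI allI impI)
        fix j assume *: "\<forall>j<m. N (t (Suc j)) \<omega> = n (Suc j)" "j < m"
        have "N (t j) \<omega> = n j" using * elim t(2) n0 by (cases j) auto
        then show "real (N (t (Suc j)) \<omega>) - real (N (t j) \<omega>) = ?d j" using * by simp
      next
        fix j assume *: "\<forall>j<m. real (N (t (Suc j)) \<omega>) - real (N (t j) \<omega>) = ?d j" "j < m"
        have "k \<le> m \<Longrightarrow> N (t k) \<omega> = n k" for k
        proof (induction k)
          case 0 then show ?case using elim t(2) n0 by simp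
        next
          case (Suc k)
          then have "real (N (t (Suc k)) \<omega>) = real (n (Suc k))" using *(1)[rule_format, of k] by simp
          then show ?case by linarith
        qed
        then show "N (t (Suc j)) \<omega> = n (Suc j)" using *(2) by simp
      qed
      then show ?case by auto
    qed
  qed measurable
  also have "\<dots> = (\<Prod>j\<in>{..<m}. prob {\<omega>\<in>space M. real (N (t (Suc j) - t j) \<omega>) \<in> {?d j}})"
    using t by (intro levy_increments_prob[OF L]) auto
  also have "\<dots> = (\<Prod>j<m. poisson_transition (l * (t (Suc j) - t j)) (n j) (n (Suc j)))"
  proof (rule prod.cong)
    fix j
    have \<delta>: "0 \<le> t (Suc j) - t j" using monoD[OF t(1), of j "Suc j"] by simp
    \<comment> \<open>A negative value is never attained by a count; the empty event matches the
      zero branch of \<open>poisson_transition\<close>.\<close>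
    have "{\<omega>\<in>space M. real (N (t (Suc j) - t j) \<omega>) \<in> {?d j}}
        = (if n j \<le> n (Suc j) then {\<omega>\<in>space M. N (t (Suc j) - t j) \<omega> = n (Suc j) - n j} else {})"
      by (auto simp: of_nat_diff[symmetric] simp del: of_nat_diff)
    then show "prob {\<omega>\<in>space M. real (N (t (Suc j) - t j) \<omega>) \<in> {?d j}} = poisson_transition (l * (t (Suc j) - t j)) (n j) (n (Suc j))"
      using poisson_process_prob[OF N l \<delta>] by (simp add: poisson_transition_def)
  qed simp
  finally show ?thesis .
qed

lemma process_sigma_measurable:
  assumes "stochastic_process I S M X" "t \<in> I"
  shows "X t \<in> measurable (sigma (space M) (process_sigma I S M X)) S"
proof -
  have sp: "(\<lambda>\<omega>. \<lambda>t\<in>I. X t \<omega>) \<in> space M \<rightarrow> space (\<Pi>\<^sub>M t\<in>I. S)"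
    using assms(1) by (auto simp: stochastic_process_def space_PiM intro: measurable_space[of _ M S])
  have "(\<lambda>\<omega>. \<lambda>t\<in>I. X t \<omega>) \<in> measurable (vimage_algebra (space M) (\<lambda>\<omega>. \<lambda>t\<in>I. X t \<omega>) (\<Pi>\<^sub>M t\<in>I. S)) (\<Pi>\<^sub>M t\<in>I. S)"
    using sp by (rule measurable_vimage_algebra1)
  from measurable_compose[OF this measurable_component_singleton[OF assms(2)]] assms(2)
  have "X t \<in> measurable (vimage_algebra (space M) (\<lambda>\<omega>. \<lambda>t\<in>I. X t \<omega>) (\<Pi>\<^sub>M t\<in>I. S)) S" by simp
  moreover have "sets (sigma (space M) (process_sigma I S M X)) = process_sigma I S M X"
    unfolding process_sigma_def variable_sigma_def
    by (metis sets.sigma_sets_eq sets.space_closed sets_measure_of space_vimage_algebra)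
  ultimately show ?thesis
    by (simp add: measurable_def process_sigma_def variable_sigma_def space_measure_of_conv)
qed

lemma sigma_algebra_process_sigma: "sigma_algebra (space M) (process_sigma I S M X)"
  unfolding process_sigma_def variable_sigma_def
  by (metis sets.sigma_algebra_axioms space_vimage_algebra)

lemma sigma_algebra_variable_sigma: "sigma_algebra (space M) (variable_sigma S M X)"
  unfolding variable_sigma_def by (metis sets.sigma_algebra_axioms space_vimage_algebra)

lemma process_sigma_Collect_finite:
  assumes X: "stochastic_process I S M X" and J: "finite J" "t ` J \<subseteq> I" "\<And>j. j \<in> J \<Longrightarrow> A j \<in> sets S"
  shows "{\<omega>\<in>space M. \<forall>j\<in>J. X (t j) \<omega> \<in> A j} \<in> process_sigma I S M X"
proof -
  interpret sigma_algebra "space M" "process_sigma I S M X" by (rule sigma_algebra_process_sigma)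
  have s: "sets (sigma (space M) (process_sigma I S M X)) = process_sigma I S M X"
    by (simp add: sigma_sets_eq space_closed)
  have "{\<omega>\<in>space M. X (t j) \<omega> \<in> A j} \<in> process_sigma I S M X" if "j \<in> J" for j
    using measurable_sets[OF process_sigma_measurable[OF X, of "t j"] J(3)[OF that]] that J(2)
    by (simp add: s space_closed vimage_def Int_def conj_commute image_subset_iff)
  then show ?thesis using J(1) by (intro sets_Collect_finite_All) auto
qed

section \<open>Subordination of exponential renewals\<close>

lemma (in sequence_space) indep_vars_coordinates: "P.indep_vars (\<lambda>_. M) (\<lambda>i \<omega>. \<omega> i) UNIV"
proof -
  have "distr S (\<Pi>\<^sub>M i\<in>UNIV. M) (\<lambda>\<omega>. \<lambda>i\<in>UNIV. \<omega> i) = (\<Pi>\<^sub>M i\<in>UNIV. distr S M (\<lambda>\<omega>. \<omega> i))"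
    using PiM_component by (simp add: restrict_UNIV distr_id)
  then show ?thesis by (subst P.indep_vars_iff_distr_eq_PiM) auto
qed

lemma (in sequence_space) nn_integral_prod_coordinates:
  assumes "finite J" "\<And>j. j \<in> J \<Longrightarrow> f j \<in> borel_measurable M"
  shows "(\<integral>\<^sup>+\<omega>. (\<Prod>j\<in>J. f j (\<omega> j)) \<partial>S) = (\<Prod>j\<in>J. \<integral>\<^sup>+x. f j x \<partial>M)"
proof -
  have "(\<integral>\<^sup>+\<omega>. (\<Prod>j\<in>J. f j (\<omega> j)) \<partial>S) = (\<Prod>j\<in>J. \<integral>\<^sup>+\<omega>. f j (\<omega> j) \<partial>S)"
    using assms
    by (intro P.indep_vars_nn_integral P.indep_vars_compose2[OF P.indep_vars_subset[OF indep_vars_coordinates]]) auto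
  also have "\<dots> = (\<Prod>j\<in>J. \<integral>\<^sup>+x. f j x \<partial>M)"
  proof (rule prod.cong)
    fix j assume "j \<in> J"
    then have "(\<integral>\<^sup>+x. f j x \<partial>distr S M (\<lambda>\<omega>. \<omega> j)) = (\<integral>\<^sup>+\<omega>. f j (\<omega> j) \<partial>S)"
      using assms(2) by (intro nn_integral_distr) auto
    then show "(\<integral>\<^sup>+\<omega>. f j (\<omega> j) \<partial>S) = (\<integral>\<^sup>+x. f j x \<partial>M)"
      using PiM_component[of j] by simp
  qed simp
  finally show ?thesis .
qed

lemma sets_Collect_path:
  assumes "finite J" "J \<subseteq> I"
  shows "{f\<in>space (\<Pi>\<^sub>M t\<in>I. count_space UNIV). \<forall>s\<in>J. Q s (f s)} \<in> sets (\<Pi>\<^sub>M t\<in>I. count_space UNIV)"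
proof (rule sets.sets_Collect_finite_All[OF _ assms(1)])
  fix s assume "s \<in> J"
  then have "(\<lambda>f. f s) \<in> measurable (\<Pi>\<^sub>M t\<in>I. count_space UNIV) (count_space UNIV)"
    using assms by (intro measurable_component_singleton) auto
  then show "{f\<in>space (\<Pi>\<^sub>M t\<in>I. count_space UNIV). Q s (f s)} \<in> sets (\<Pi>\<^sub>M t\<in>I. count_space UNIV)"
    using measurable_sets[of "\<lambda>f. f s" _ "count_space UNIV" "{n. Q s n}"] by (simp add: vimage_def Int_def conj_commute)
qed

section \<open>The inverse of a nondecreasing path\<close>

lemma inverse_process_nonneg: "0 \<le> inverse_process L t \<omega>"
  unfolding inverse_process_def by (auto intro!: cInf_greatest)

text \<open>The witness \<open>s\<close> makes both infima range over nonempty sets. Without it the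
  default value \<open>0\<close> at the later time could break monotonicity.\<close>

lemma inverse_process_mono:
  assumes "0 < s" "t' < L s \<omega>" "t \<le> t'"
  shows "inverse_process L t \<omega> \<le> inverse_process L t' \<omega>"
proof -
  have "Inf {s. 0 < s \<and> t < L s \<omega>} \<le> Inf {s. 0 < s \<and> t' < L s \<omega>}"
    using assms by (intro cInf_superset_mono bdd_belowI[of _ 0]) auto
  moreover have "t < L s \<omega>" using assms by simp
  ultimately show ?thesis using assms unfolding inverse_process_def by auto
qed

text \<open>At \<open>u = Y t\<close> the path may already have jumped above \<open>t\<close>, so
  the equivalence can fail there and this \<open>u\<close> is excluded. The point
  \<open>u = 0\<close> is safe because \<open>L 0 = 0\<close>.\<close>

lemma le_inverse_process_iff:
  assumes mono: "mono_on {0..} (\<lambda>s. L s \<omega>)" and L0: "L 0 \<omega> = 0" and s: "0 < s" "t < L s \<omega>"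
    and t: "0 \<le> t" and u: "0 \<le> u" "u \<noteq> inverse_process L t \<omega> \<or> u = 0"
  shows "L u \<omega> \<le> t \<longleftrightarrow> u \<le> inverse_process L t \<omega>"
proof
  have Y: "inverse_process L t \<omega> = Inf {s. 0 < s \<and> t < L s \<omega>}"
    using s by (auto simp: inverse_process_def)
  show "u \<le> inverse_process L t \<omega>" if "L u \<omega> \<le> t"
    unfolding Y
  proof (rule cInf_greatest)
    fix v assume v: "v \<in> {s. 0 < s \<and> t < L s \<omega>}"
    then have "L u \<omega> < L v \<omega>" using that by simp
    then show "u \<le> v" using mono_onD[OF mono, of v u] v u(1) by (auto simp: not_le[symmetric] intro: ccontr)
  qed (use s in auto)
  show "L u \<omega> \<le> t" if "u \<le> inverse_process L t \<omega>"
  proof (cases "u = 0")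
    case False
    show ?thesis
    proof (rule ccontr)
      assume "\<not> L u \<omega> \<le> t"
      then have "Inf {s. 0 < s \<and> t < L s \<omega>} \<le> u"
        using False u(1) by (intro cInf_lower bdd_belowI[of _ 0]) auto
      then show False using that u(2) False Y by auto
    qed
  qed (use L0 t in simp)
qed

text \<open>Measurability of the inverse is assumed here; in the theorem it is supplied by
  \<open>stochastic_process_borelI\<close>.\<close>

locale subordinated_clock = marked_exponential "r powr \<alpha>" q I + mittag_leffler_terms \<alpha> r + M: prob_space M
  for q :: "nat pmf" and I :: "nat set" and r \<alpha> :: real and M :: "'b measure" +
  fixes L :: "real \<Rightarrow> 'b \<Rightarrow> real"
  assumes L: "stable_subordinator \<alpha> M L"
    and Y_measurable: "\<And>t. 0 \<le> t \<Longrightarrow> inverse_process L t \<in> borel_measurable M"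
begin

abbreviation "Y \<equiv> inverse_process L"

lemma levy: "levy_process M L" using L by (simp add: stable_subordinator_def)

lemma L_measurable: "0 \<le> t \<Longrightarrow> L t \<in> borel_measurable M"
  using levy by (auto simp: levy_process_def stochastic_process_def)

lemma L_right_cont: "\<omega> \<in> space M \<Longrightarrow> 0 \<le> t \<Longrightarrow> ((\<lambda>s. L s \<omega>) \<longlongrightarrow> L t \<omega>) (at_right t)"
  using levy by (auto simp: levy_process_def)

lemma L_mono: "\<omega> \<in> space M \<Longrightarrow> 0 \<le> s \<Longrightarrow> s \<le> t \<Longrightarrow> L s \<omega> \<le> L t \<omega>"
  using L by (auto simp: stable_subordinator_def mono_on_def)

lemma L_0: "AE \<omega> in M. L 0 \<omega> = 0"
  using levy by (simp add: levy_process_def)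

lemma L_nonneg: "AE \<omega> in M. \<forall>t\<ge>0. 0 \<le> L t \<omega>"
  using L_0 AE_space by eventually_elim (metis L_mono order_refl)

lemma L_laplace:
  assumes "0 \<le> s" "0 \<le> u"
  shows "(\<integral>\<^sup>+\<omega>. ennreal (exp (- u * L s \<omega>)) \<partial>M) = ennreal (exp (- s * u powr \<alpha>))"
proof -
  have [measurable]: "L s \<in> borel_measurable M" using assms by (intro L_measurable)
  have "integrable M (\<lambda>\<omega>. exp (- u * L s \<omega>))"
  proof (rule M.integrable_const_bound[where B=1])
    show "AE \<omega> in M. norm (exp (- u * L s \<omega>)) \<le> 1"
      using L_nonneg by eventually_elim (simp add: assms)
  qed measurable
  then have "(\<integral>\<^sup>+\<omega>. ennreal (exp (- u * L s \<omega>)) \<partial>M) = ennreal (M.expectation (\<lambda>\<omega>. exp (- u * L s \<omega>)))"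
    by (intro nn_integral_eq_integral) auto
  then show ?thesis using L assms by (simp add: stable_subordinator_def)
qed

text \<open>The exponential Markov bound again: remaining below \<open>k\<close> at time
  \<open>n + 1\<close> has probability at most \<open>exp k * exp (- (n + 1))\<close>, by the
  Laplace transform at \<open>1\<close>.\<close>

lemma L_unbounded: "AE \<omega> in M. \<forall>t. \<exists>s>0. t < L s \<omega>"
proof -
  have "AE \<omega> in M. \<exists>s>0. real k < L s \<omega>" for k :: nat
  proof -
    have [measurable]: "L (real (Suc n)) \<in> borel_measurable M" for n by (rule L_measurable) simp
    let ?B = "{\<omega>\<in>space M. \<forall>n. L (real (Suc n)) \<omega> \<le> real k}"
    have B: "?B \<in> sets M" by measurable
    have "emeasure M ?B \<le> ennreal (exp (real k) * exp (- real (Suc n)))" for n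
    proof -
      have "emeasure M ?B = (\<integral>\<^sup>+\<omega>. indicator ?B \<omega> \<partial>M)" using B by simp
      also have "\<dots> \<le> (\<integral>\<^sup>+\<omega>. ennreal (exp (real k)) * ennreal (exp (- 1 * L (real (Suc n)) \<omega>)) \<partial>M)"
        by (intro nn_integral_mono)
           (auto split: split_indicator simp: ennreal_mult[symmetric] exp_add[symmetric] ennreal_1[symmetric]
              simp del: ennreal_1 of_nat_Suc)
      also have "\<dots> = ennreal (exp (real k)) * ennreal (exp (- real (Suc n)))"
      proof (subst nn_integral_cmult)
        show "ennreal (exp (real k)) * (\<integral>\<^sup>+\<omega>. ennreal (exp (- 1 * L (real (Suc n)) \<omega>)) \<partial>M)
            = ennreal (exp (real k)) * ennreal (exp (- real (Suc n)))"
          by (subst L_laplace) (simp_all del: of_nat_Suc)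
      qed measurable
      finally show ?thesis by (simp add: ennreal_mult)
    qed
    moreover have "(\<lambda>n. ennreal (exp (real k) * exp (- real (Suc n)))) \<longlonglongrightarrow> ennreal (exp (real k) * 0)"
    proof (intro tendsto_ennrealI tendsto_mult tendsto_const)
      show "(\<lambda>n. exp (- real (Suc n))) \<longlonglongrightarrow> 0"
        by (intro filterlim_compose[OF exp_at_bot] filterlim_compose[OF filterlim_uminus_at_bot_at_top]
            filterlim_compose[OF filterlim_real_sequentially] filterlim_Suc)
    qed
    ultimately have "emeasure M ?B \<le> ennreal (exp (real k) * 0)"
      by (intro LIMSEQ_le_const) auto
    then have "?B \<in> null_sets M" using B by (intro null_setsI) auto
    then show ?thesis by (rule AE_I') (force simp: not_less)
  qed
  then have "AE \<omega> in M. \<forall>k. \<exists>s>0. real k < L s \<omega>" by (simp add: AE_all_countable)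
  then show ?thesis
    by eventually_elim (metis less_trans reals_Archimedean2)
qed

text \<open>The absolute values alter partial sums of gaps only on a null set, and they make the
  clock nonnegative and monotone for every \<open>e\<close>, so that \<open>L\<close> is always
  evaluated at a legitimate time.\<close>

definition clock :: "(nat \<Rightarrow> real) \<Rightarrow> nat \<Rightarrow> real" where
  "clock e k = (\<Sum>i<k. \<bar>e i\<bar>)"

definition waiting :: "'b \<times> (nat \<Rightarrow> real) \<Rightarrow> nat \<Rightarrow> real" where
  "waiting z k = L (clock (snd z) k) (fst z) - L (clock (snd z) (k - 1)) (fst z)"

definition waiting_law :: "real measure" where
  "waiting_law = distr (M \<Otimes>\<^sub>M E1) borel (\<lambda>z. L \<bar>snd z\<bar> (fst z))"

sublocale ME: pair_prob_space M Es ..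
sublocale M1: pair_prob_space M E1 ..

lemma L_eval_measurable:
  assumes [measurable]: "T \<in> borel_measurable N" and "\<And>e. 0 \<le> T e"
  shows "(\<lambda>z. L (T (snd z)) (fst z)) \<in> borel_measurable (M \<Otimes>\<^sub>M N)"
proof (rule right_continuous_eval_measurable[where X="\<lambda>t z. L t (fst z)" and T="\<lambda>z. T (snd z)"])
  show "(\<lambda>z. L t (fst z)) \<in> borel_measurable (M \<Otimes>\<^sub>M N)" if "0 \<le> t" for t
    using L_measurable[OF that] by measurable
qed (use assms(2) L_right_cont in \<open>auto simp: space_pair_measure\<close>)

lemma clock_nonneg: "0 \<le> clock e k"
  by (auto simp: clock_def intro: sum_nonneg)

lemma clock_measurable[measurable]: "(\<lambda>e. clock e k) \<in> borel_measurable Es"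
  unfolding clock_def by measurable

lemma waiting_measurable[measurable]: "(\<lambda>z. waiting z k) \<in> borel_measurable (M \<Otimes>\<^sub>M Es)"
  unfolding waiting_def by (intro borel_measurable_diff L_eval_measurable clock_nonneg clock_measurable)

lemma L_abs_measurable[measurable]: "(\<lambda>z. L \<bar>snd z\<bar> (fst z)) \<in> borel_measurable (M \<Otimes>\<^sub>M E1)"
  by (rule L_eval_measurable) auto

lemma real_distribution_waiting_law: "real_distribution waiting_law"
  unfolding waiting_law_def by (intro M1.P.real_distribution_distr) measurable

text \<open>For a fixed gap \<open>x\<close> the transform of \<open>L x\<close> is
  \<open>exp (- x * u powr \<alpha>)\<close>; integrating over \<open>x\<close> evaluates the
  exponential transform at \<open>u powr \<alpha>\<close>.\<close>

lemma interval_measure_waiting: "interval_measure (fpp_waiting_cdf \<alpha> r) = waiting_law"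
proof (rule interval_measure_fpp_waiting_cdf[OF real_distribution_waiting_law])
  have "AE z in M \<Otimes>\<^sub>M E1. 0 \<le> L \<bar>snd z\<bar> (fst z)"
  proof (rule M1.AE_pair_measure)
    show "AE \<omega> in M. AE x in E1. 0 \<le> L \<bar>snd (\<omega>, x)\<bar> (fst (\<omega>, x))"
      using L_nonneg by eventually_elim simp
  qed measurable
  then show "AE t in waiting_law. 0 \<le> t"
    unfolding waiting_law_def by (subst AE_distr_iff) auto
  fix u :: real assume u: "0 < u"
  have "(\<integral>\<^sup>+t. ennreal (exp (- u * t)) \<partial>waiting_law) = (\<integral>\<^sup>+z. ennreal (exp (- u * L \<bar>snd z\<bar> (fst z))) \<partial>(M \<Otimes>\<^sub>M E1))"
    unfolding waiting_law_def by (subst nn_integral_distr) auto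
  also have "\<dots> = (\<integral>\<^sup>+x. \<integral>\<^sup>+\<omega>. ennreal (exp (- u * L \<bar>x\<bar> \<omega>)) \<partial>M \<partial>E1)"
    by (subst M1.nn_integral_snd[symmetric]) auto
  also have "\<dots> = (\<integral>\<^sup>+x. ennreal (exp (- (u powr \<alpha>) * x)) \<partial>E1)"
  proof (rule nn_integral_cong_AE, use AE_exponential_nonneg in eventually_elim)
    case (elim x)
    then show ?case using u by (subst L_laplace) (auto simp: mult.commute)
  qed
  also have "\<dots> = ennreal (r powr \<alpha> / (r powr \<alpha> + u powr \<alpha>))"
    by (rule nn_integral_exponential_laplace) (use r in auto)
  finally show "(\<integral>\<^sup>+t. ennreal (exp (- u * t)) \<partial>waiting_law) = ennreal (r powr \<alpha> / (r powr \<alpha> + u powr \<alpha>))" .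
qed

text \<open>With the gaps frozen, the clock times are deterministic, so the increments of
  \<open>L\<close> over successive gaps are independent, and by stationarity each factor depends on
  its own gap only. Independence of the gaps then factors the outer integral.\<close>

lemma distr_waiting:
  "distr (M \<Otimes>\<^sub>M Es) (\<Pi>\<^sub>M k\<in>{1..}. borel) (\<lambda>z. \<lambda>k\<in>{1..}. waiting z k) = (\<Pi>\<^sub>M k\<in>{1..}. waiting_law)"
proof -
  interpret W: real_distribution waiting_law by (rule real_distribution_waiting_law)
  interpret W: product_prob_space "\<lambda>_. waiting_law" "{1::nat..}" ..
  show ?thesis
  proof (rule W.PiM_eq)
    show "sets (distr (M \<Otimes>\<^sub>M Es) (\<Pi>\<^sub>M k\<in>{1..}. borel) (\<lambda>z. \<lambda>k\<in>{1..}. waiting z k)) = sets (\<Pi>\<^sub>M k\<in>{1..}. waiting_law)"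
      by (simp cong: sets_PiM_cong)
    fix J :: "nat set" and F assume J: "finite J" "J \<subseteq> {1..}" and F: "\<And>j. j \<in> J \<Longrightarrow> F j \<in> sets waiting_law"
    then have F'[measurable]: "\<And>j. j \<in> J \<Longrightarrow> F j \<in> sets borel" by simp
    let ?D = "{z\<in>space (M \<Otimes>\<^sub>M Es). \<forall>j\<in>J. waiting z j \<in> F j}"
    have D[measurable]: "?D \<in> sets (M \<Otimes>\<^sub>M Es)" using J(1) by measurable
    define h where "h j x = emeasure M {\<omega>\<in>space M. L \<bar>x\<bar> \<omega> \<in> F j}" for j x
    have H: "{z\<in>space (M \<Otimes>\<^sub>M E1). L \<bar>snd z\<bar> (fst z) \<in> F j} \<in> sets (M \<Otimes>\<^sub>M E1)" if "j \<in> J" for j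
      using F'[OF that] by measurable
    have h_eq: "h j x = emeasure M ((\<lambda>\<omega>. (\<omega>, x)) -` {z\<in>space (M \<Otimes>\<^sub>M E1). L \<bar>snd z\<bar> (fst z) \<in> F j})" for j x
      unfolding h_def by (intro arg_cong[where f="emeasure M"]) (auto simp: space_pair_measure)
    have h[measurable]: "h j \<in> borel_measurable E1" if "j \<in> J" for j
      using M1.measurable_emeasure_Pair2[OF H[OF that]] by (simp add: h_eq[abs_def])
    have law: "emeasure waiting_law (F j) = (\<integral>\<^sup>+x. h j x \<partial>E1)" if "j \<in> J" for j
      unfolding waiting_law_def h_eq M1.emeasure_pair_measure_alt2[OF H[OF that], symmetric]
      using F'[OF that] by (subst emeasure_distr) (auto simp: vimage_def Int_def conj_commute)
    have "emeasure (distr (M \<Otimes>\<^sub>M Es) (\<Pi>\<^sub>M k\<in>{1..}. borel) (\<lambda>z. \<lambda>k\<in>{1..}. waiting z k)) (prod_emb {1..} (\<lambda>_. waiting_law) J (Pi\<^sub>E J F))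
        = emeasure (M \<Otimes>\<^sub>M Es) ?D"
    proof (subst emeasure_distr)
      have "prod_emb {1..} (\<lambda>_. borel) J (Pi\<^sub>E J F) \<in> sets (\<Pi>\<^sub>M k\<in>{1..}. borel)"
        using J F' by (intro sets_PiM_I) auto
      then show "prod_emb {1..} (\<lambda>_. waiting_law) J (Pi\<^sub>E J F) \<in> sets (\<Pi>\<^sub>M k\<in>{1..}. borel)"
        by (simp add: prod_emb_def)
      show "emeasure (M \<Otimes>\<^sub>M Es) ((\<lambda>z. \<lambda>k\<in>{1..}. waiting z k) -` prod_emb {1..} (\<lambda>_. waiting_law) J (Pi\<^sub>E J F) \<inter> space (M \<Otimes>\<^sub>M Es))
          = emeasure (M \<Otimes>\<^sub>M Es) ?D"
        using J(2) by (intro arg_cong[where f="emeasure (M \<Otimes>\<^sub>M Es)"]) (auto simp: prod_emb_def PiE_iff subset_eq)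
    qed measurable
    also have "\<dots> = (\<integral>\<^sup>+e. emeasure M ((\<lambda>\<omega>. (\<omega>, e)) -` ?D) \<partial>Es)"
      by (rule ME.emeasure_pair_measure_alt2[OF D])
    \<comment> \<open>Waiting times are numbered from \<open>1\<close> and gaps from
      \<open>0\<close>, so waiting time \<open>j\<close> uses gap \<open>j - 1\<close>.\<close>
    also have "\<dots> = (\<integral>\<^sup>+e. (\<Prod>k\<in>(\<lambda>j. j - 1) ` J. h (Suc k) (e k)) \<partial>Es)"
    proof (intro nn_integral_cong)
      fix e assume e: "e \<in> space Es"
      have sj: "Suc (j - Suc 0) = j" if "j \<in> J" for j using that J(2) by (auto simp: subset_eq)
      have ck: "mono (clock e)" "0 \<le> clock e 0"
        by (auto simp: clock_def intro!: incseq_SucI)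
      have "(\<lambda>\<omega>. (\<omega>, e)) -` ?D = {\<omega>\<in>space M. \<forall>k\<in>(\<lambda>j. j - 1) ` J. L (clock e (Suc k)) \<omega> - L (clock e k) \<omega> \<in> F (Suc k)}"
        using sj e by (auto simp: space_pair_measure waiting_def)
      also have "emeasure M \<dots> = ennreal (\<Prod>k\<in>(\<lambda>j. j - 1) ` J. M.prob {\<omega>\<in>space M. L (clock e (Suc k) - clock e k) \<omega> \<in> F (Suc k)})"
        unfolding M.emeasure_eq_measure using J ck F'
        by (subst M.levy_increments_prob[OF levy]) (auto simp: subset_eq)
      also have "\<dots> = (\<Prod>k\<in>(\<lambda>j. j - 1) ` J. h (Suc k) (e k))"
        unfolding h_def M.emeasure_eq_measure by (subst prod_ennreal) (auto simp: clock_def)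
      finally show "emeasure M ((\<lambda>\<omega>. (\<omega>, e)) -` ?D) = (\<Prod>k\<in>(\<lambda>j. j - 1) ` J. h (Suc k) (e k))" .
    qed
    also have "\<dots> = (\<Prod>k\<in>(\<lambda>j. j - 1) ` J. \<integral>\<^sup>+x. h (Suc k) x \<partial>E1)"
    proof (rule E.nn_integral_prod_coordinates)
      show "h (Suc k) \<in> borel_measurable E1" if "k \<in> (\<lambda>j. j - 1) ` J" for k
        using that J(2) by (intro h) (auto simp: subset_eq)
    qed (use J(1) in simp)
    also have "\<dots> = (\<Prod>j\<in>J. \<integral>\<^sup>+x. h j x \<partial>E1)"
      using J(2) by (intro prod.reindex_bij_witness[where i="\<lambda>j. j - 1" and j=Suc]) (auto simp: subset_eq image_iff)
    also have "\<dots> = (\<Prod>j\<in>J. emeasure waiting_law (F j))"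
      by (simp add: law)
    finally show "emeasure (distr (M \<Otimes>\<^sub>M Es) (\<Pi>\<^sub>M k\<in>{1..}. borel) (\<lambda>z. \<lambda>k\<in>{1..}. waiting z k)) (prod_emb {1..} (\<lambda>_. waiting_law) J (Pi\<^sub>E J F))
      = (\<Prod>j\<in>J. emeasure waiting_law (F j))" .
  qed
qed

end

section \<open>The law \<open>FPP\<close> through a renewal process run on the clock
  \<open>Y\<close>\<close>

context subordinated_clock
begin

text \<open>With the later gaps fixed, only one value of the first gap produces the sum
  \<open>c\<close>, and the first gap has a density.\<close>

lemma AE_gap_sum_neq: "AE e in Es. sum e {..<Suc n} \<noteq> c"
proof -
  let ?B = "{e\<in>space Es. sum e {..<Suc n} = c}"
  have B[measurable]: "?B \<in> sets Es" by measurable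
  have [measurable]: "{p. fst p + sum (snd p) {..<n} = c} \<in> sets (E1 \<Otimes>\<^sub>M Es)"
  proof -
    have "{p\<in>space (E1 \<Otimes>\<^sub>M Es). fst p + sum (snd p) {..<n} = c} \<in> sets (E1 \<Otimes>\<^sub>M Es)" by measurable
    then show ?thesis by (simp add: space_pair_measure space_PiM)
  qed
  interpret EE: pair_prob_space E1 Es ..
  have "emeasure Es ?B = (\<integral>\<^sup>+e. indicator ?B e \<partial>Es)" by simp
  also have "\<dots> = (\<integral>\<^sup>+x. \<integral>\<^sup>+e. indicator ?B (case_nat x e) \<partial>Es \<partial>E1)"
    by (subst E.nn_integral_PiM_iter) auto
  also have "\<dots> = (\<integral>\<^sup>+x. \<integral>\<^sup>+e. indicator {p. fst p + sum (snd p) {..<n} = c} (x, e) \<partial>Es \<partial>E1)"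
    by (intro nn_integral_cong) (simp add: indicator_def sum_case_nat space_PiM del: sum.lessThan_Suc)
  also have "\<dots> = (\<integral>\<^sup>+e. \<integral>\<^sup>+x. indicator {p. fst p + sum (snd p) {..<n} = c} (x, e) \<partial>E1 \<partial>Es)"
    by (subst EE.Fubini') (auto simp: split_beta')
  also have "\<dots> = (\<integral>\<^sup>+e. 0 \<partial>Es)"
  proof (intro nn_integral_cong)
    fix e :: "nat \<Rightarrow> real"
    have "AE x in lborel. x \<noteq> c - sum e {..<n}" by (rule AE_lborel_singleton)
    then have "AE x in E1. indicator {p. fst p + sum (snd p) {..<n} = c} (x, e) = (0 :: ennreal)"
      by (subst AE_density) (auto elim!: eventually_mono simp: indicator_def)
    then show "(\<integral>\<^sup>+x. indicator {p. fst p + sum (snd p) {..<n} = c} (x, e) \<partial>E1) = 0"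
      by (subst nn_integral_cong_AE) auto
  qed
  finally have "?B \<in> null_sets Es" using B by (intro null_setsI) auto
  then show ?thesis by (rule AE_I') auto
qed

text \<open>Telescoping leaves \<open>L 0\<close>, which vanishes only almost surely.\<close>

lemma sum_waiting: "(\<Sum>k=1..n. (\<lambda>k\<in>{1..}. waiting z k) k) = L (clock (snd z) n) (fst z) - L 0 (fst z)"
  by (induction n) (auto simp: waiting_def clock_def)

lemma renewals_measurable:
  assumes f: "f \<in> measurable N Es" and [measurable]: "g \<in> borel_measurable N"
  shows "(\<lambda>z. renewals (f z) (g z)) \<in> measurable N (count_space UNIV)"
proof -
  have [measurable]: "(\<lambda>z. f z k) \<in> borel_measurable N" for k
    using measurable_compose[OF f measurable_component_singleton[of k]] by simp
  show ?thesis unfolding renewals_def by measurable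
qed

lemma sets_Collect_nat_eq:
  fixes f g :: "'c \<Rightarrow> nat"
  assumes [measurable]: "f \<in> measurable N (count_space UNIV)" "g \<in> measurable N (count_space UNIV)"
  shows "{z\<in>space N. f z = g z} \<in> sets N"
proof -
  have "{z\<in>space N. real (f z) = real (g z)} \<in> sets N" by measurable
  then show ?thesis by simp
qed

text \<open>Off the null events of a nonzero start, a bounded path, a negative gap or an arrival
  exactly at \<open>Y t\<close>, the two sets under \<open>Max\<close> coincide.\<close>

lemma AE_renewal_count:
  assumes t: "0 \<le> t"
  shows "AE z in M \<Otimes>\<^sub>M Es. renewal_count (\<lambda>k\<in>{1..}. waiting z k) t = renewals (snd z) (Y t (fst z))"
proof (rule ME.AE_pair_measure)
  have [measurable]: "Y t \<in> borel_measurable M" using t by (rule Y_measurable)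
  have [measurable]: "(\<lambda>z. renewals (snd z) (Y t (fst z))) \<in> measurable (M \<Otimes>\<^sub>M Es) (count_space UNIV)"
    by (intro renewals_measurable) measurable
  have [measurable]: "(\<lambda>z. L (clock (snd z) n) (fst z)) \<in> borel_measurable (M \<Otimes>\<^sub>M Es)" for n
    by (intro L_eval_measurable clock_nonneg clock_measurable)
  have [measurable]: "L 0 \<in> borel_measurable M" by (rule L_measurable) simp
  have [measurable]: "(\<lambda>z. renewal_count (\<lambda>k\<in>{1..}. waiting z k) t) \<in> measurable (M \<Otimes>\<^sub>M Es) (count_space UNIV)"
    unfolding renewal_count_def sum_waiting by (rule measurable_Max_nat) measurable
  show "{z \<in> space (M \<Otimes>\<^sub>M Es). renewal_count (\<lambda>k\<in>{1..}. waiting z k) t = renewals (snd z) (Y t (fst z))} \<in> sets (M \<Otimes>\<^sub>M Es)"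
    by (rule sets_Collect_nat_eq) fact+
  show "AE \<omega> in M. AE e in Es. renewal_count (\<lambda>k\<in>{1..}. waiting (\<omega>, e) k) t = renewals (snd (\<omega>, e)) (Y t (fst (\<omega>, e)))"
    using L_0 L_unbounded AE_space
  proof eventually_elim
    case (elim \<omega>)
    obtain s where s: "0 < s" "t < L s \<omega>" using elim by blast
    have mono: "mono_on {0..} (\<lambda>s. L s \<omega>)" using elim(3) L_mono by (auto simp: mono_on_def)
    \<comment> \<open>The path of \<open>L\<close> is fixed here, so \<open>Y t \<omega>\<close> is
      a constant, and arrival times have no atoms.\<close>
    have "AE e in Es. \<forall>n. sum e {..<Suc n} \<noteq> Y t \<omega>"
      unfolding AE_all_countable by (intro allI AE_gap_sum_neq)
    with AE_gaps_nonneg show ?case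
    proof eventually_elim
      case e: (elim e)
      have clock: "clock e n = sum e {..<n}" for n using e(1) by (simp add: clock_def)
      have "L (clock e n) \<omega> - L 0 \<omega> \<le> t \<longleftrightarrow> sum e {..<n} \<le> Y t \<omega>" for n
      proof -
        have "sum e {..<n} \<noteq> Y t \<omega> \<or> sum e {..<n} = 0" using e(2) by (cases n) auto
        then show ?thesis
          using le_inverse_process_iff[where L=L and \<omega>=\<omega>, OF mono elim(1) s t, of "clock e n"] clock_nonneg[of e n] elim(1)
          by (simp add: clock)
      qed
      then show ?case unfolding renewal_count_def sum_waiting renewals_def by simp
    qed
  qed
qed

lemma renewal_count_measurable:
  "(\<lambda>x. renewal_count x t) \<in> measurable (\<Pi>\<^sub>M k\<in>{1..}. waiting_law) (count_space UNIV)"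
proof -
  have [measurable]: "(\<lambda>x. \<Sum>k=1..n. x k) \<in> borel_measurable (\<Pi>\<^sub>M k\<in>{1..}. waiting_law)" for n
  proof (rule borel_measurable_sum)
    fix k assume "k \<in> {1..n}"
    then have "(\<lambda>x. x k) \<in> measurable (\<Pi>\<^sub>M k\<in>{1..}. waiting_law) waiting_law"
      by (intro measurable_component_singleton) simp
    then show "(\<lambda>x. x k) \<in> borel_measurable (\<Pi>\<^sub>M k\<in>{1..}. waiting_law)"
      by (simp add: waiting_law_def)
  qed
  show ?thesis unfolding renewal_count_def by measurable
qed

text \<open>The predicate \<open>Q\<close> is arbitrary so that a frozen sequence of marks can be
  put inside it.\<close>

lemma emeasure_FPP:
  assumes J: "finite J" "J \<subseteq> {0..}"
  shows "emeasure (FPP \<alpha> r) {f\<in>space (\<Pi>\<^sub>M t\<in>{0..}. count_space UNIV). \<forall>s\<in>J. Q s (f s)}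
    = emeasure (M \<Otimes>\<^sub>M Es) {z\<in>space (M \<Otimes>\<^sub>M Es). \<forall>s\<in>J. Q s (renewals (snd z) (Y s (fst z)))}"
proof -
  let ?W = "\<Pi>\<^sub>M k\<in>{1..}. waiting_law"
  let ?w = "\<lambda>z. \<lambda>k\<in>{1..}. waiting z k"
  have [measurable]: "(\<lambda>x. renewal_count x t) \<in> measurable ?W (count_space UNIV)" for t
    by (rule renewal_count_measurable)
  have F[measurable]: "(\<lambda>x. \<lambda>t\<in>{0..}. renewal_count x t) \<in> measurable ?W (\<Pi>\<^sub>M t\<in>{0..}. count_space UNIV)"
    by (intro measurable_restrict) measurable
  have w[measurable]: "?w \<in> measurable (M \<Otimes>\<^sub>M Es) (\<Pi>\<^sub>M k\<in>{1..}. borel)"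
    by (intro measurable_restrict) measurable
  have sW: "sets ?W = sets (\<Pi>\<^sub>M k\<in>{1..}. borel)"
    by (intro sets_PiM_cong) (simp_all add: waiting_law_def)
  have w'[measurable]: "?w \<in> measurable (M \<Otimes>\<^sub>M Es) ?W"
    using w unfolding measurable_cong_sets[OF refl sW] .
  have W: "?W = distr (M \<Otimes>\<^sub>M Es) ?W ?w"
    unfolding distr_waiting[symmetric] by (intro distr_cong) (simp_all add: distr_waiting sW)
  have S: "{f\<in>space (\<Pi>\<^sub>M t\<in>{0..}. count_space UNIV). \<forall>s\<in>J. Q s (f s)} \<in> sets (\<Pi>\<^sub>M t\<in>{0..}. count_space UNIV)"
    by (rule sets_Collect_path[OF J])
  have ren[measurable]: "(\<lambda>z. renewals (snd z) (Y s (fst z))) \<in> measurable (M \<Otimes>\<^sub>M Es) (count_space UNIV)" if "s \<in> J" for s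
    using Y_measurable[of s] that J(2) by (intro renewals_measurable) auto
  have S1: "{x\<in>space ?W. \<forall>s\<in>J. Q s (renewal_count x s)} \<in> sets ?W"
    using J(1) by measurable
  have "emeasure (FPP \<alpha> r) {f\<in>space (\<Pi>\<^sub>M t\<in>{0..}. count_space UNIV). \<forall>s\<in>J. Q s (f s)}
      = emeasure ?W {x\<in>space ?W. \<forall>s\<in>J. Q s (renewal_count x s)}"
  proof -
    have "(\<lambda>x. \<lambda>t\<in>{0..}. renewal_count x t) -` {f\<in>space (\<Pi>\<^sub>M t\<in>{0..}. count_space UNIV). \<forall>s\<in>J. Q s (f s)} \<inter> space ?W
        = {x\<in>space ?W. \<forall>s\<in>J. Q s (renewal_count x s)}"
      using J(2) by (auto simp: space_PiM subset_eq)
    then show ?thesis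
      unfolding FPP_def process_law_def interval_measure_waiting by (subst emeasure_distr[OF F S]) (simp only:)
  qed
  also have "\<dots> = emeasure (M \<Otimes>\<^sub>M Es) {z\<in>space (M \<Otimes>\<^sub>M Es). \<forall>s\<in>J. Q s (renewal_count (?w z) s)}"
    using measurable_space[OF w']
    by (subst W, subst emeasure_distr[OF w' S1]) (auto intro!: arg_cong[where f="emeasure (M \<Otimes>\<^sub>M Es)"])
  also have "\<dots> = emeasure (M \<Otimes>\<^sub>M Es) {z\<in>space (M \<Otimes>\<^sub>M Es). \<forall>s\<in>J. Q s (renewals (snd z) (Y s (fst z)))}"
  proof (rule emeasure_eq_AE)
    have "AE z in M \<Otimes>\<^sub>M Es. \<forall>s\<in>J. renewal_count (?w z) s = renewals (snd z) (Y s (fst z))"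
      using J by (intro AE_finite_allI AE_renewal_count) auto
    then show "AE z in M \<Otimes>\<^sub>M Es. z \<in> {z\<in>space (M \<Otimes>\<^sub>M Es). \<forall>s\<in>J. Q s (renewal_count (?w z) s)}
      \<longleftrightarrow> z \<in> {z\<in>space (M \<Otimes>\<^sub>M Es). \<forall>s\<in>J. Q s (renewals (snd z) (Y s (fst z)))}"
      by eventually_elim simp
    show "{z\<in>space (M \<Otimes>\<^sub>M Es). \<forall>s\<in>J. Q s (renewal_count (?w z) s)} \<in> sets (M \<Otimes>\<^sub>M Es)"
      using measurable_compose[OF w' renewal_count_measurable] J(1) by measurable
    show "{z\<in>space (M \<Otimes>\<^sub>M Es). \<forall>s\<in>J. Q s (renewals (snd z) (Y s (fst z)))} \<in> sets (M \<Otimes>\<^sub>M Es)"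
      using J(1) by measurable
  qed
  finally show ?thesis .
qed

text \<open>Fubini moves the integral over the paths of \<open>L\<close> outside. Inside, the gaps
  and marks recombine to \<open>Z\<close>, run on a clock that is now deterministic.\<close>

lemma nn_integral_FPP_marks:
  assumes J: "finite J" "J \<subseteq> {0..}"
  shows "(\<integral>\<^sup>+c. emeasure (FPP \<alpha> r) {f\<in>space (\<Pi>\<^sub>M t\<in>{0..}. count_space UNIV).
        \<forall>s\<in>J. \<forall>i\<in>I. card {k. k < f s \<and> c k = i} = \<nu> s i} \<partial>Qs)
    = (\<integral>\<^sup>+\<omega>. emeasure Z {z\<in>space Z. \<forall>s\<in>J. \<forall>i\<in>I. card {k. k < renewals (fst z) (Y s \<omega>) \<and> snd z k = i} = \<nu> s i} \<partial>M)"
proof -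
  define D where "D = {p\<in>space (M \<Otimes>\<^sub>M Z). \<forall>s\<in>J. \<forall>i\<in>I.
    card {k. k < renewals (fst (snd p)) (Y s (fst p)) \<and> snd (snd p) k = i} = \<nu> s i}"
  have [measurable]: "(\<lambda>p. renewals (fst (snd p)) (Y s (fst p))) \<in> measurable (M \<Otimes>\<^sub>M Z) (count_space UNIV)" if "s \<in> J" for s
    using Y_measurable[of s] that J(2) by (intro renewals_measurable) auto
  have D[measurable]: "D \<in> sets (M \<Otimes>\<^sub>M Z)"
    unfolding D_def using J(1) I(1) by measurable
  interpret QM: pair_prob_space Qs M ..
  interpret QE: pair_prob_space Qs Es ..
  have mem: "(\<omega>, e, c) \<in> D \<longleftrightarrow> (\<forall>s\<in>J. \<forall>i\<in>I. card {k. k < renewals e (Y s \<omega>) \<and> c k = i} = \<nu> s i)"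
    if "\<omega> \<in> space M" "e \<in> space Es" "c \<in> space Qs" for \<omega> e c
    using that by (simp add: D_def space_pair_measure)
  have "(\<integral>\<^sup>+c. emeasure (FPP \<alpha> r) {f\<in>space (\<Pi>\<^sub>M t\<in>{0..}. count_space UNIV).
        \<forall>s\<in>J. \<forall>i\<in>I. card {k. k < f s \<and> c k = i} = \<nu> s i} \<partial>Qs)
     = (\<integral>\<^sup>+c. (\<integral>\<^sup>+\<omega>. \<integral>\<^sup>+e. indicator D (\<omega>, e, c) \<partial>Es \<partial>M) \<partial>Qs)"
  proof (intro nn_integral_cong)
    fix c assume c[measurable]: "c \<in> space Qs"
    have "{z\<in>space (M \<Otimes>\<^sub>M Es). (fst z, snd z, c) \<in> D} \<in> sets (M \<Otimes>\<^sub>M Es)" by measurable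
    moreover have "{z\<in>space (M \<Otimes>\<^sub>M Es). \<forall>s\<in>J. \<forall>i\<in>I. card {k. k < renewals (snd z) (Y s (fst z)) \<and> c k = i} = \<nu> s i}
        = {z\<in>space (M \<Otimes>\<^sub>M Es). (fst z, snd z, c) \<in> D}"
      using c by (auto simp: space_pair_measure mem)
    ultimately show "emeasure (FPP \<alpha> r) {f\<in>space (\<Pi>\<^sub>M t\<in>{0..}. count_space UNIV).
        \<forall>s\<in>J. \<forall>i\<in>I. card {k. k < f s \<and> c k = i} = \<nu> s i} = (\<integral>\<^sup>+\<omega>. \<integral>\<^sup>+e. indicator D (\<omega>, e, c) \<partial>Es \<partial>M)"
      by (subst emeasure_FPP[OF J]) (auto simp: E.P.emeasure_pair_measure space_pair_measure intro!: nn_integral_cong split: split_indicator)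
  qed
  also have "\<dots> = (\<integral>\<^sup>+\<omega>. (\<integral>\<^sup>+c. \<integral>\<^sup>+e. indicator D (\<omega>, e, c) \<partial>Es \<partial>Qs) \<partial>M)"
    by (subst QM.Fubini'[symmetric]) (auto simp: split_beta')
  also have "\<dots> = (\<integral>\<^sup>+\<omega>. (\<integral>\<^sup>+e. \<integral>\<^sup>+c. indicator D (\<omega>, e, c) \<partial>Qs \<partial>Es) \<partial>M)"
    by (intro nn_integral_cong, subst QE.Fubini'[symmetric]) (auto simp: split_beta')
  also have "\<dots> = (\<integral>\<^sup>+\<omega>. emeasure Z {z\<in>space Z. \<forall>s\<in>J. \<forall>i\<in>I. card {k. k < renewals (fst z) (Y s \<omega>) \<and> snd z k = i} = \<nu> s i} \<partial>M)"
  proof (intro nn_integral_cong)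
    fix \<omega> assume \<omega>[measurable]: "\<omega> \<in> space M"
    have "{z\<in>space Z. (\<omega>, z) \<in> D} \<in> sets Z" by measurable
    moreover have "{z\<in>space Z. \<forall>s\<in>J. \<forall>i\<in>I. card {k. k < renewals (fst z) (Y s \<omega>) \<and> snd z k = i} = \<nu> s i} = {z\<in>space Z. (\<omega>, z) \<in> D}"
      using \<omega> by (auto simp: space_pair_measure mem)
    ultimately show "(\<integral>\<^sup>+e. \<integral>\<^sup>+c. indicator D (\<omega>, e, c) \<partial>Qs \<partial>Es)
      = emeasure Z {z\<in>space Z. \<forall>s\<in>J. \<forall>i\<in>I. card {k. k < renewals (fst z) (Y s \<omega>) \<and> snd z k = i} = \<nu> s i}"
      by (auto simp: Q.P.emeasure_pair_measure space_pair_measure intro!: nn_integral_cong split: split_indicator)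
  qed
  finally show ?thesis .
qed

end

section \<open>The two counting processes\<close>

lemma (in prob_space) indep_sets_reindex:
  assumes ind: "indep_sets F (f ` I)" and inj: "inj_on f I"
  shows "indep_sets (\<lambda>i. F (f i)) I"
proof (rule indep_setsI)
  show "F (f i) \<subseteq> events" if "i \<in> I" for i
    using ind that by (auto simp: indep_sets_def)
  fix A J assume J: "J \<noteq> {}" "J \<subseteq> I" "finite J" "\<forall>j\<in>J. A j \<in> F (f j)"
  define A' where "A' k = A (inv_into I f k)" for k
  have A': "A' (f j) = A j" if "j \<in> J" for j
    using that J(2) inj by (auto simp: A'_def subset_eq)
  have "prob (\<Inter>k\<in>f ` J. A' k) = (\<Prod>k\<in>f ` J. prob (A' k))"
    using J A' by (intro indep_setsD[OF ind]) auto
  then show "prob (\<Inter>j\<in>J. A j) = (\<Prod>j\<in>J. prob (A j))"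
    using A' inj_on_subset[OF inj J(2)] by (simp add: prod.reindex)
qed

text \<open>Renumbers the marks from \<open>0\<close>, as in \<open>Qs\<close>.\<close>

lemma class_count_eq: "class_count N C i t \<omega> = card {k. k < N t \<omega> \<and> C (Suc k) \<omega> = i}"
proof -
  have "{k\<in>{1..N t \<omega>}. C k \<omega> = i} = Suc ` {k. k < N t \<omega> \<and> C (Suc k) \<omega> = i}"
  proof (rule set_eqI)
    fix k show "k \<in> {k\<in>{1..N t \<omega>}. C k \<omega> = i} \<longleftrightarrow> k \<in> Suc ` {k. k < N t \<omega> \<and> C (Suc k) \<omega> = i}"
      by (cases k) auto
  qed
  then show ?thesis by (simp add: class_count_def card_image)
qed

lemma class_count_measurable:
  assumes "N t \<in> measurable M (count_space UNIV)"
    and "\<And>k. 1 \<le> k \<Longrightarrow> C k \<in> measurable M (count_space UNIV)"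
  shows "class_count N C i t \<in> measurable M (count_space UNIV)"
proof -
  note [measurable] = assms(1)
  have [measurable]: "C (Suc k) \<in> measurable M (count_space UNIV)" for k using assms(2) by simp
  have "(\<lambda>\<omega>. card {k. k < N t \<omega> \<and> C (Suc k) \<omega> = i}) \<in> measurable M (count_space UNIV)"
    by measurable
  then show ?thesis unfolding class_count_eq[symmetric] .
qed

text \<open>Once the marks are frozen, \<open>N\<close> enters only through its path law, so the
  probability is a function of the mark sequence alone. Integrating it requires only that the marks
  are i.i.d. with law \<open>q\<close>.\<close>

lemma emeasure_class_counts:
  fixes M :: "'a measure" and q :: "nat pmf"
  assumes M: "prob_space M"
    and N: "stochastic_process {0..} (count_space UNIV) M N"
    and C: "stochastic_process {1..} (count_space UNIV) M C"
    and Cq: "\<And>k. 1 \<le> k \<Longrightarrow> distr M (count_space UNIV) (C k) = measure_pmf q"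
    and ind: "prob_space.indep_sets M
           (\<lambda>k. if k = 0 then process_sigma {0..} (count_space UNIV) M N
                else variable_sigma (count_space UNIV) M (C k)) {0..}"
    and J: "finite J" "J \<subseteq> {0..}" and I: "finite I"
  shows "emeasure M {\<omega>\<in>space M. \<forall>s\<in>J. \<forall>i\<in>I. class_count N C i s \<omega> = \<nu> s i}
    = (\<integral>\<^sup>+c. emeasure (process_law {0..} (count_space UNIV) M N)
         {f\<in>space (\<Pi>\<^sub>M t\<in>{0..}. count_space UNIV). \<forall>s\<in>J. \<forall>i\<in>I. card {k. k < f s \<and> c k = i} = \<nu> s i}
       \<partial>(\<Pi>\<^sub>M k\<in>UNIV. measure_pmf q))"
proof -
  interpret prob_space M by fact
  let ?F = "\<lambda>k::nat. if k = 0 then process_sigma {0..} (count_space UNIV) M N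
                else variable_sigma (count_space UNIV) M (C k)"
  let ?\<C> = "\<Union>k\<in>{0..} - {0}. ?F k"
  let ?S = "\<Pi>\<^sub>M t\<in>{0::real..}. count_space (UNIV :: nat set)"
  let ?Q = "\<Pi>\<^sub>M k\<in>(UNIV :: nat set). measure_pmf q"
  have sa: "sigma_algebra (space M) (?F k)" for k
    by (simp add: sigma_algebra_process_sigma sigma_algebra_variable_sigma)
  have ind2: "indep_set (?F 0) (sigma_sets (space M) ?\<C>)"
    using ind sa by (intro indep_sets_insert_split) auto
  have Pow: "?F k \<subseteq> Pow (space M)" for k
    using sigma_algebra.axioms(1)[OF sa[of k]] by (meson algebra.axioms(1) ring_of_sets.axioms(1) semiring_of_sets.axioms(1) subset_class.space_closed)
  define A where "A = sigma (space M) (?F 0)"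
  define B where "B = sigma (space M) ?\<C>"
  have PowU: "?\<C> \<subseteq> Pow (space M)" by (intro UN_least Pow)
  have sB: "sets B = sigma_sets (space M) ?\<C>" "space B = space M"
    unfolding B_def using PowU by (rule sets_measure_of, rule space_measure_of)
  have sA: "sets A = ?F 0" "space A = space M"
    using Pow[of 0] sigma_algebra.sigma_sets_eq[OF sa[of 0]] unfolding A_def
    by (simp_all add: sets_measure_of space_measure_of)
  have NA: "N s \<in> measurable A (count_space UNIV)" if "0 \<le> s" for s
    using process_sigma_measurable[OF N, of s] that by (simp add: A_def)
  have CM: "C k \<in> measurable M (count_space UNIV)" if "1 \<le> k" for k
    using C that by (simp add: stochastic_process_def)
  have vs: "variable_sigma (count_space UNIV) M (C k) = {C k -` A \<inter> space M | A. A \<in> sets (count_space UNIV)}" for k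
    unfolding variable_sigma_def by (rule sets_vimage_algebra2) simp
  have CB: "C (Suc k) \<in> measurable B (count_space UNIV)" for k
  proof (rule measurableI)
    fix X :: "nat set"
    have "C (Suc k) -` X \<inter> space M \<in> ?F (Suc k)" using vs[of "Suc k"] by auto
    then show "C (Suc k) -` X \<inter> space B \<in> sets B"
      unfolding sB by (intro sigma_sets.Basic) (auto intro!: bexI[of _ "Suc k"])
  qed simp
  define D where "D = {p\<in>space (A \<Otimes>\<^sub>M B). \<forall>s\<in>J. \<forall>i\<in>I. card {k. k < N s (fst p) \<and> C (Suc k) (snd p) = i} = \<nu> s i}"
  have D: "D \<in> sets (A \<Otimes>\<^sub>M B)"
  proof -
    note [measurable] = CB
    have [measurable]: "N s \<in> measurable A (count_space UNIV)" if "s \<in> J" for s using NA that J by auto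
    show ?thesis unfolding D_def using J(1) I by measurable
  qed
  have path: "(\<lambda>\<omega>. \<lambda>t\<in>{0..}. N t \<omega>) \<in> measurable M ?S"
    using N by (intro measurable_restrict) (simp add: stochastic_process_def)
  let ?R = "process_law {0..} (count_space UNIV) M N"
  define G where "G c = emeasure ?R {f\<in>space ?S. \<forall>s\<in>J. \<forall>i\<in>I. card {k. k < f s \<and> c k = i} = \<nu> s i}" for c
  interpret R: prob_space ?R
    unfolding process_law_def using path by (rule prob_space_distr)
  have sR[measurable_cong]: "sets ?R = sets ?S" by (simp add: process_law_def)
  have G: "G \<in> borel_measurable ?Q"
  proof -
    have [measurable]: "(\<lambda>f. f s) \<in> measurable ?R (count_space UNIV)" if "s \<in> J" for s
      using J(2) that unfolding measurable_cong_sets[OF sR refl] by (intro measurable_component_singleton) auto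
    have "{p\<in>space (?Q \<Otimes>\<^sub>M ?R). \<forall>s\<in>J. \<forall>i\<in>I. card {k. k < (snd p) s \<and> (fst p) k = i} = \<nu> s i} \<in> sets (?Q \<Otimes>\<^sub>M ?R)"
      using J(1) I by measurable
    from R.measurable_emeasure_Pair[OF this] show ?thesis
      by (rule measurable_cong[THEN iffD1, rotated])
         (auto simp: G_def space_pair_measure process_law_def intro!: arg_cong[where f="emeasure _"])
  qed
  have "emeasure M {\<omega>\<in>space M. \<forall>s\<in>J. \<forall>i\<in>I. class_count N C i s \<omega> = \<nu> s i} = emeasure M {\<omega>\<in>space M. (\<omega>, \<omega>) \<in> D}"
    by (intro arg_cong[where f="emeasure M"]) (auto simp: D_def class_count_eq space_pair_measure sA sB)
  also have "\<dots> = (\<integral>\<^sup>+y. emeasure M {x\<in>space M. (x, y) \<in> D} \<partial>M)"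
    using ind2 sA sB D by (intro indep_set_emeasure_diagonal(2)[of A B]) simp_all
  also have "\<dots> = (\<integral>\<^sup>+y. G (\<lambda>k. C (Suc k) y) \<partial>M)"
  proof (intro nn_integral_cong)
    fix y assume y: "y \<in> space M"
    have "{x\<in>space M. (x, y) \<in> D} = (\<lambda>\<omega>. \<lambda>t\<in>{0..}. N t \<omega>) -`
        {f\<in>space ?S. \<forall>s\<in>J. \<forall>i\<in>I. card {k. k < f s \<and> C (Suc k) y = i} = \<nu> s i} \<inter> space M"
      using y J(2) by (auto simp: D_def space_pair_measure sA sB space_PiM subset_eq)
    then show "emeasure M {x\<in>space M. (x, y) \<in> D} = G (\<lambda>k. C (Suc k) y)"
      unfolding G_def process_law_def by (subst emeasure_distr[OF path sets_Collect_path[OF J]]) simp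
  qed
  also have "\<dots> = (\<integral>\<^sup>+c. G c \<partial>?Q)"
  proof -
    have "indep_vars (\<lambda>_. count_space UNIV) (\<lambda>k. C (Suc k)) UNIV"
      unfolding indep_vars_def2
    proof (intro conjI ballI)
      have "indep_sets ?F (range Suc)"
        by (rule indep_sets_mono_index[OF _ ind]) auto
      from indep_sets_reindex[OF this]
      have "indep_sets (\<lambda>k. variable_sigma (count_space UNIV) M (C (Suc k))) UNIV" by simp
      then show "indep_sets (\<lambda>k. {C (Suc k) -` A \<inter> space M |A. A \<in> sets (count_space UNIV)}) UNIV"
        unfolding vs .
    qed (use CM in simp)
    then have "distr M (\<Pi>\<^sub>M k\<in>UNIV. count_space UNIV) (\<lambda>\<omega>. \<lambda>k\<in>UNIV. C (Suc k) \<omega>)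
        = (\<Pi>\<^sub>M k\<in>UNIV. distr M (count_space UNIV) (C (Suc k)))"
      using CM by (subst (asm) indep_vars_iff_distr_eq_PiM) auto
    then have *: "distr M (\<Pi>\<^sub>M k\<in>UNIV. count_space UNIV) (\<lambda>\<omega> k. C (Suc k) \<omega>) = ?Q"
      using Cq by (simp add: restrict_UNIV)
    have sQ: "sets ?Q = sets (\<Pi>\<^sub>M k\<in>UNIV. count_space UNIV)" by (intro sets_PiM_cong) auto
    have m: "(\<lambda>\<omega> k. C (Suc k) \<omega>) \<in> measurable M (\<Pi>\<^sub>M k\<in>UNIV. count_space UNIV)"
      using CM by (intro measurable_abs_UNIV) simp
    have "(\<integral>\<^sup>+c. G c \<partial>distr M (\<Pi>\<^sub>M k\<in>UNIV. count_space UNIV) (\<lambda>\<omega> k. C (Suc k) \<omega>)) = (\<integral>\<^sup>+y. G (\<lambda>k. C (Suc k) y) \<partial>M)"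
      using G unfolding measurable_cong_sets[OF sQ refl] by (intro nn_integral_distr m) simp
    then show ?thesis unfolding * by simp
  qed
  finally show ?thesis unfolding G_def .
qed

section \<open>Independent Poisson processes evaluated on an independent clock\<close>

lemma levy_process_right_continuous:
  assumes "levy_process M X" "\<omega> \<in> space M" "0 \<le> t"
  shows "((\<lambda>s. X s \<omega>) \<longlongrightarrow> X t \<omega>) (at_right t)"
  using assms unfolding levy_process_def by blast

lemma levy_process_measurable: "levy_process M X \<Longrightarrow> 0 \<le> t \<Longrightarrow> X t \<in> borel_measurable M"
  unfolding levy_process_def stochastic_process_def by simp

lemma time_changed_measurable:
  assumes P: "poisson_process l M P" and T: "T \<in> borel_measurable M" "\<And>\<omega>. \<omega> \<in> space M \<Longrightarrow> 0 \<le> T \<omega>"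
  shows "(\<lambda>\<omega>. P (T \<omega>) \<omega>) \<in> measurable M (count_space UNIV)"
proof -
  have L: "levy_process M (\<lambda>t \<omega>. real (P t \<omega>))" using P by (simp add: poisson_process_def)
  have "(\<lambda>\<omega>. real (P (T \<omega>) \<omega>)) \<in> borel_measurable M"
    by (rule right_continuous_eval_measurable[where X="\<lambda>t \<omega>. real (P t \<omega>)",
        OF levy_process_measurable[OF L] levy_process_right_continuous[OF L] T])
  then have "(\<lambda>\<omega>. nat \<lfloor>real (P (T \<omega>) \<omega>)\<rfloor>) \<in> measurable M (count_space UNIV)" by measurable
  then show ?thesis by simp
qed

lemma poisson_process_stochastic: "poisson_process l M P \<Longrightarrow> stochastic_process {0..} (count_space UNIV) M P"
  by (simp add: stochastic_process_def poisson_process_measurable)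

text \<open>Independence of \<open>Y\<close> from the Poisson processes allows two copies of the
  outcome, \<open>x\<close> for the clock and \<open>\<omega>\<close> for the counts, so that the
  inner probability has a deterministic clock.\<close>

lemma emeasure_time_changed:
  fixes M :: "'b measure" and P :: "nat \<Rightarrow> real \<Rightarrow> 'b \<Rightarrow> nat"
  assumes M: "prob_space M" and P: "\<And>i. i \<in> {1..K} \<Longrightarrow> poisson_process l M (P i)"
    and Y: "\<And>t \<omega>. 0 \<le> Y t \<omega>" "stochastic_process {0..} borel M Y" and p: "\<And>i. i \<in> {1..K} \<Longrightarrow> 0 \<le> p i"
    and ind: "prob_space.indep_sets M
           (\<lambda>i. if i = 0 then process_sigma {0..} borel M Y
                else process_sigma {0..} (count_space UNIV) M (P i)) {0..K}"
    and J: "finite J" "J \<subseteq> {0..}"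
  shows "emeasure M {\<omega>\<in>space M. \<forall>s\<in>J. \<forall>i\<in>{1..K}. P i (p i * Y s \<omega>) \<omega> = \<nu> s i}
    = (\<integral>\<^sup>+x. emeasure M {\<omega>\<in>space M. \<forall>s\<in>J. \<forall>i\<in>{1..K}. P i (p i * Y s x) \<omega> = \<nu> s i} \<partial>M)"
proof -
  interpret prob_space M by fact
  let ?F = "\<lambda>i::nat. if i = 0 then process_sigma {0..} borel M Y
                else process_sigma {0..} (count_space UNIV) M (P i)"
  let ?\<P> = "\<Union>i\<in>{0..K} - {0}. ?F i"
  have sa: "sigma_algebra (space M) (?F i)" for i
    by (simp add: sigma_algebra_process_sigma)
  have ind2: "indep_set (?F 0) (sigma_sets (space M) ?\<P>)"
    using ind sa by (intro indep_sets_insert_split) auto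
  have Pow: "?F i \<subseteq> Pow (space M)" for i
    using sigma_algebra.axioms(1)[OF sa[of i]] by (meson algebra.axioms(1) ring_of_sets.axioms(1) semiring_of_sets.axioms(1) subset_class.space_closed)
  define A where "A = sigma (space M) (?F 0)"
  define B where "B = sigma (space M) ?\<P>"
  have PowU: "?\<P> \<subseteq> Pow (space M)" by (intro UN_least Pow)
  have sB: "sets B = sigma_sets (space M) ?\<P>" "space B = space M"
    unfolding B_def using PowU by (rule sets_measure_of, rule space_measure_of)
  have sA: "sets A = ?F 0" "space A = space M"
    using Pow[of 0] sigma_algebra.sigma_sets_eq[OF sa[of 0]] unfolding A_def
    by (simp_all add: sets_measure_of space_measure_of)
  have YA: "Y s \<in> borel_measurable A" if "0 \<le> s" for s
    using process_sigma_measurable[OF Y(2), of s] that by (simp add: A_def)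
  have PB: "P i t \<in> measurable B (count_space UNIV)" if "i \<in> {1..K}" "0 \<le> t" for i t
  proof -
    have "P i t \<in> measurable (sigma (space M) (?F i)) (count_space UNIV)"
      using process_sigma_measurable[OF poisson_process_stochastic[OF P[OF that(1)]], of t] that by simp
    moreover have "sets (sigma (space M) (?F i)) \<subseteq> sets B"
      using that(1) Pow[of i] sigma_algebra.sigma_sets_eq[OF sa[of i]] unfolding sB
      by (auto simp: sets_measure_of intro!: sigma_sets.Basic)
    ultimately show ?thesis
      using sB(2) Pow[of i] by (auto simp: measurable_def space_measure_of)
  qed
  define D where "D = {p'\<in>space (A \<Otimes>\<^sub>M B). \<forall>s\<in>J. \<forall>i\<in>{1..K}. P i (p i * Y s (fst p')) (snd p') = \<nu> s i}"
  \<comment> \<open>Joint measurability in both outcomes: right continuity in time permits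
    evaluation at a clock value that depends on the first outcome only.\<close>
  have PD: "(\<lambda>z. P i (p i * Y s (fst z)) (snd z)) \<in> measurable (A \<Otimes>\<^sub>M B) (count_space UNIV)"
    if "i \<in> {1..K}" "s \<in> J" for i s
  proof -
    have [measurable]: "Y s \<in> borel_measurable A" using YA that J by auto
    have "(\<lambda>z. real (P i (p i * Y s (fst z)) (snd z))) \<in> borel_measurable (A \<Otimes>\<^sub>M B)"
    proof (rule right_continuous_eval_measurable[where X="\<lambda>t z. real (P i t (snd z))" and T="\<lambda>z. p i * Y s (fst z)"])
      show "(\<lambda>z. real (P i t (snd z))) \<in> borel_measurable (A \<Otimes>\<^sub>M B)" if "0 \<le> t" for t
        using PB[OF \<open>i \<in> {1..K}\<close> that] by measurable
      show "((\<lambda>t. real (P i t (snd z))) \<longlongrightarrow> real (P i t (snd z))) (at_right t)"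
        if "z \<in> space (A \<Otimes>\<^sub>M B)" "0 \<le> t" for z t
        using that levy_process_right_continuous[of M "\<lambda>t \<omega>. real (P i t \<omega>)" "snd z" t] P[OF \<open>i \<in> {1..K}\<close>]
        by (auto simp: poisson_process_def space_pair_measure sB)
    qed (use Y(1) p[OF that(1)] in auto)
    then have "(\<lambda>z. nat \<lfloor>real (P i (p i * Y s (fst z)) (snd z))\<rfloor>) \<in> measurable (A \<Otimes>\<^sub>M B) (count_space UNIV)" by measurable
    then show ?thesis by simp
  qed
  have D: "D \<in> sets (A \<Otimes>\<^sub>M B)"
    unfolding D_def
  proof (intro sets.sets_Collect_finite_All J(1) finite_atLeastAtMost)
    fix s i assume "s \<in> J" "i \<in> {1..K}"
    from measurable_sets[OF PD[OF this(2,1)], of "{\<nu> s i}"]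
    show "{p'\<in>space (A \<Otimes>\<^sub>M B). P i (p i * Y s (fst p')) (snd p') = \<nu> s i} \<in> sets (A \<Otimes>\<^sub>M B)"
      by (simp add: vimage_def Int_def conj_commute)
  qed
  have "emeasure M {\<omega>\<in>space M. \<forall>s\<in>J. \<forall>i\<in>{1..K}. P i (p i * Y s \<omega>) \<omega> = \<nu> s i} = emeasure M {\<omega>\<in>space M. (\<omega>, \<omega>) \<in> D}"
    by (intro arg_cong[where f="emeasure M"]) (auto simp: D_def space_pair_measure sA sB)
  also have "\<dots> = (\<integral>\<^sup>+x. emeasure M {y\<in>space M. (x, y) \<in> D} \<partial>M)"
    using ind2 sA sB D by (intro indep_set_emeasure_diagonal(1)[of A B]) simp_all
  also have "\<dots> = (\<integral>\<^sup>+x. emeasure M {\<omega>\<in>space M. \<forall>s\<in>J. \<forall>i\<in>{1..K}. P i (p i * Y s x) \<omega> = \<nu> s i} \<partial>M)"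
    by (intro nn_integral_cong arg_cong[where f="emeasure M"]) (auto simp: D_def space_pair_measure sA sB)
  finally show ?thesis .
qed

text \<open>Running \<open>P i\<close> at speed \<open>p i\<close> multiplies its rate by
  \<open>p i\<close>, the rate of class \<open>i\<close> on the other side; independence over
  \<open>i\<close> gives the product.\<close>

lemma emeasure_poisson_processes_fidi:
  fixes M :: "'b measure" and P :: "nat \<Rightarrow> real \<Rightarrow> 'b \<Rightarrow> nat"
  assumes M: "prob_space M" and P: "\<And>i. i \<in> {1..K} \<Longrightarrow> poisson_process l M (P i)"
    and p: "\<And>i. i \<in> {1..K} \<Longrightarrow> 0 \<le> p i" and l: "0 < l" and K: "1 \<le> K"
    and ind: "prob_space.indep_sets M (\<lambda>i. process_sigma {0..} (count_space UNIV) M (P i)) {1..K}"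
    and y: "mono y" "y 0 = 0" and n0: "\<And>i. i \<in> {1..K} \<Longrightarrow> n 0 i = 0"
  shows "emeasure M {\<omega>\<in>space M. \<forall>j<m. \<forall>i\<in>{1..K}. P i (p i * y (Suc j)) \<omega> = n (Suc j) i}
    = ennreal (\<Prod>j<m. \<Prod>i\<in>{1..K}. poisson_transition (l * p i * (y (Suc j) - y j)) (n j i) (n (Suc j) i))"
proof -
  interpret prob_space M by fact
  have y0: "0 \<le> y j" for j using y monoD[OF y(1), of 0 j] by simp
  let ?A = "\<lambda>i. {\<omega>\<in>space M. \<forall>j\<in>{..<m}. P i (p i * y (Suc j)) \<omega> \<in> {n (Suc j) i}}"
  have "{\<omega>\<in>space M. \<forall>j<m. \<forall>i\<in>{1..K}. P i (p i * y (Suc j)) \<omega> = n (Suc j) i} = (\<Inter>i\<in>{1..K}. ?A i)"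
    using K by auto
  also have "prob \<dots> = (\<Prod>i\<in>{1..K}. prob (?A i))"
  proof (rule indep_setsD[OF ind])
    show "\<forall>i\<in>{1..K}. ?A i \<in> process_sigma {0..} (count_space UNIV) M (P i)"
      using p y0 by (intro ballI process_sigma_Collect_finite poisson_process_stochastic[OF P]) auto
  qed (use K in auto)
  also have "\<dots> = (\<Prod>i\<in>{1..K}. \<Prod>j<m. poisson_transition (l * p i * (y (Suc j) - y j)) (n j i) (n (Suc j) i))"
  proof (rule prod.cong)
    fix i assume i: "i \<in> {1..K}"
    have "prob {\<omega>\<in>space M. \<forall>j<m. P i (p i * y (Suc j)) \<omega> = n (Suc j) i}
        = (\<Prod>j<m. poisson_transition (l * (p i * y (Suc j) - p i * y j)) (n j i) (n (Suc j) i))"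
      using y n0[OF i] mult_left_mono[OF _ p[OF i]]
      by (intro poisson_process_fidi[OF P[OF i] l, of "\<lambda>j. p i * y j" "\<lambda>j. n j i"]) (auto simp: mono_def)
    then show "prob (?A i) = (\<Prod>j<m. poisson_transition (l * p i * (y (Suc j) - y j)) (n j i) (n (Suc j) i))"
      by (simp add: algebra_simps Ball_def)
  qed simp
  also have "\<dots> = (\<Prod>j<m. \<Prod>i\<in>{1..K}. poisson_transition (l * p i * (y (Suc j) - y j)) (n j i) (n (Suc j) i))"
    by (rule prod.swap)
  finally show ?thesis by (simp only: emeasure_eq_measure)
qed

section \<open>Finite time sets, class laws and the final comparison\<close>

lemma finite_nonneg_enumeration:
  fixes J :: "real set"
  assumes "finite J" "J \<subseteq> {0..}"
  obtains T m where "mono T" "T 0 = 0" "J = (\<lambda>j. T (Suc j)) ` {..<m::nat}"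
proof -
  have "\<exists>T m. mono T \<and> T 0 = 0 \<and> J = (\<lambda>j. T (Suc j)) ` {..<m::nat}"
    using assms
  proof (induction J rule: finite_linorder_max_induct)
    case empty
    show ?case by (intro exI[of _ "\<lambda>_. 0"] exI[of _ 0]) (auto simp: mono_def)
  next
    case (insert b J)
    then obtain T m where T: "mono T" "T 0 = 0" "J = (\<lambda>j. T (Suc j)) ` {..<m::nat}" by auto
    \<comment> \<open>The sequence stays constant after the last time, which keeps it monotone on
      all of \<open>nat\<close>.\<close>
    define T' where "T' j = (if j \<le> m then T j else b)" for j
    have "T m \<le> b"
    proof (cases m)
      case (Suc k)
      then have "T m \<in> J" unfolding T(3) by auto
      then show ?thesis using insert.hyps by (simp add: less_imp_le)
    qed (use T(2) insert.prems in auto)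
    then have "T j \<le> b" if "j \<le> m" for j using monoD[OF T(1) that] by simp
    then have "mono T'" using monoD[OF T(1)] by (auto simp: mono_def T'_def)
    moreover have "T' 0 = 0" using T(2) by (simp add: T'_def)
    moreover have "insert b J = (\<lambda>j. T' (Suc j)) ` {..<Suc m}"
      unfolding lessThan_Suc image_insert T(3) by (auto simp: T'_def)
    ultimately show ?case by blast
  qed
  then show thesis using that by blast
qed

lemma obtain_pmf_of_weights:
  assumes "finite I" "\<And>i. i \<in> I \<Longrightarrow> 0 < p i" "(\<Sum>i\<in>I. p i) = (1 :: real)"
  obtains q where "set_pmf q = I" "\<And>i. i \<in> I \<Longrightarrow> pmf q i = p i"
proof
  let ?f = "\<lambda>i. if i \<in> I then p i else 0"
  have f: "pmf (embed_pmf ?f) i = ?f i" for i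
  proof (rule pmf_embed_pmf)
    show "0 \<le> ?f i" for i using assms(2) by (simp add: less_imp_le)
    have "(\<integral>\<^sup>+i. ennreal (?f i) \<partial>count_space UNIV) = (\<Sum>i\<in>I. ennreal (?f i))"
      using assms(1) by (intro nn_integral_count_space') auto
    also have "\<dots> = ennreal (\<Sum>i\<in>I. ?f i)"
      using assms(2) by (intro sum_ennreal) (simp add: less_imp_le)
    finally show "(\<integral>\<^sup>+i. ennreal (?f i) \<partial>count_space UNIV) = 1"
      using assms(3) by simp
  qed
  show "set_pmf (embed_pmf ?f) = I"
    using assms(2) by (force simp: set_pmf_iff f split: if_splits)
  show "pmf (embed_pmf ?f) i = p i" if "i \<in> I" for i using that by (simp add: f)
qed

text \<open>The values in the support already exhaust the mass one, so any other value has
  probability zero.\<close>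

lemma (in prob_space) distr_eq_measure_pmfI:
  fixes X :: "'a \<Rightarrow> nat"
  assumes X[measurable]: "X \<in> measurable M (count_space UNIV)" and fin: "finite (set_pmf q)"
    and eq: "\<And>i. i \<in> set_pmf q \<Longrightarrow> prob {\<omega>\<in>space M. X \<omega> = i} = pmf q i"
  shows "distr M (count_space UNIV) X = measure_pmf q"
proof (rule measure_eqI_countable[of _ UNIV])
  fix i
  have "prob {\<omega>\<in>space M. X \<omega> = i} = pmf q i"
  proof (cases "i \<in> set_pmf q")
    case False
    have "prob (\<Union>j\<in>insert i (set_pmf q). {\<omega>\<in>space M. X \<omega> = j}) = (\<Sum>j\<in>insert i (set_pmf q). prob {\<omega>\<in>space M. X \<omega> = j})"
      using fin by (intro finite_measure_finite_Union) (auto simp: disjoint_family_on_def)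
    also have "\<dots> = prob {\<omega>\<in>space M. X \<omega> = i} + (\<Sum>j\<in>set_pmf q. pmf q j)"
      using fin False eq by simp
    also have "(\<Sum>j\<in>set_pmf q. pmf q j) = 1" using fin by (intro sum_pmf_eq_1) auto
    finally have "prob {\<omega>\<in>space M. X \<omega> = i} \<le> 0"
      using prob_le_1[of "\<Union>j\<in>insert i (set_pmf q). {\<omega>\<in>space M. X \<omega> = j}"] by linarith
    then show ?thesis using False measure_nonneg[of M "{\<omega>\<in>space M. X \<omega> = i}"] by (simp add: pmf_eq_0_set_pmf)
  qed (rule eq)
  then show "emeasure (distr M (count_space UNIV) X) {i} = emeasure (measure_pmf q) {i}"
    by (subst emeasure_distr) (auto simp: emeasure_eq_measure emeasure_pmf_single vimage_def Int_def conj_commute)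
qed auto

text \<open>Independence requires the sigma-algebra generated by \<open>Y\<close> to consist of
  events, and this yields the measurability of \<open>Y\<close>.\<close>

lemma stochastic_process_borelI:
  fixes X :: "'i \<Rightarrow> 'a \<Rightarrow> 'b :: topological_space"
  assumes "process_sigma I borel M X \<subseteq> sets M"
  shows "stochastic_process I borel M X"
  unfolding stochastic_process_def
proof
  fix t assume t: "t \<in> I"
  let ?X = "\<lambda>\<omega>. \<lambda>t\<in>I. X t \<omega>"
  have "?X \<in> measurable M (\<Pi>\<^sub>M t\<in>I. borel)"
  proof (rule measurableI)
    fix A assume "A \<in> sets (\<Pi>\<^sub>M t\<in>I. (borel :: 'b measure))"
    from in_vimage_algebra[OF this, of ?X "space M"] show "?X -` A \<inter> space M \<in> sets M"
      using assms by (auto simp: process_sigma_def variable_sigma_def)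
  qed (simp add: space_PiM)
  from measurable_compose[OF this measurable_component_singleton[OF t]] t show "X t \<in> borel_measurable M"
    by simp
qed

theorem theorem2p1:
  fixes \<alpha> r :: real and K :: nat and p :: "nat \<Rightarrow> real"
    and M :: "'a measure" and N :: "real \<Rightarrow> 'a \<Rightarrow> nat" and C :: "nat \<Rightarrow> 'a \<Rightarrow> nat"
    and M' :: "'b measure" and P :: "nat \<Rightarrow> real \<Rightarrow> 'b \<Rightarrow> nat"
    and L Y :: "real \<Rightarrow> 'b \<Rightarrow> real"
  assumes "0 < \<alpha>" and "\<alpha> \<le> 1" and "0 < r" and "1 \<le> K"
    and "\<And>i. i \<in> {1..K} \<Longrightarrow> 0 < p i" and "(\<Sum>i=1..K. p i) = 1"
    and "prob_space M"
    and "fractional_poisson_process \<alpha> r M N"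
    and "stochastic_process {1..} (count_space UNIV) M C"
    and "\<And>k i. 1 \<le> k \<Longrightarrow> i \<in> {1..K} \<Longrightarrow> measure M {\<omega> \<in> space M. C k \<omega> = i} = p i"
    and "prob_space.indep_sets M
           (\<lambda>k. if k = 0 then process_sigma {0..} (count_space UNIV) M N
                else variable_sigma (count_space UNIV) M (C k))
           {0..}"
    and "prob_space M'"
    and "\<And>i. i \<in> {1..K} \<Longrightarrow> poisson_process (r powr \<alpha>) M' (P i)"
    and "stable_subordinator \<alpha> M' L"
    and "Y = inverse_process L"
    and "prob_space.indep_sets M'
           (\<lambda>i. if i = 0 then process_sigma {0..} borel M' Y
                else process_sigma {0..} (count_space UNIV) M' (P i))
           {0..K}"
  shows "process_law {0..} (\<Pi>\<^sub>M i\<in>{1..K}. count_space UNIV) M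
           (\<lambda>t \<omega>. \<lambda>i\<in>{1..K}. class_count N C i t \<omega>)
       = process_law {0..} (\<Pi>\<^sub>M i\<in>{1..K}. count_space UNIV) M'
           (\<lambda>t \<omega>. \<lambda>i\<in>{1..K}. P i (p i * Y t \<omega>) \<omega>)"
proof -
  note [simp del] = One_nat_def
  interpret M: prob_space M by fact
  interpret M': prob_space M' by fact
  let ?S = "\<Pi>\<^sub>M i\<in>{1..K}. count_space (UNIV :: nat set)"
  note p = assms(5)
  obtain q where q: "set_pmf q = {1..K}" "\<And>i. i \<in> {1..K} \<Longrightarrow> pmf q i = p i"
    using obtain_pmf_of_weights[of "{1..K}" p] assms(5,6) by auto
  have "process_sigma {0..} borel M' Y \<subseteq> sets M'"
    using assms(16) unfolding M'.indep_sets_def by (auto dest!: bspec[of _ _ 0])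
  then have Y: "stochastic_process {0..} borel M' Y"
    by (rule stochastic_process_borelI)
  interpret subordinated_clock q "{1..K}" r \<alpha> M' L
  proof unfold_locales
    show "inverse_process L t \<in> borel_measurable M'" if "0 \<le> t" for t
      using Y that by (simp add: stochastic_process_def assms(15))
  qed (use assms(1,3,14) q(1) in auto)
  have N: "stochastic_process {0..} (count_space UNIV) M N" "process_law {0..} (count_space UNIV) M N = FPP \<alpha> r"
    using assms(8) by (auto simp: fractional_poisson_process_def)
  have C: "C k \<in> measurable M (count_space UNIV)" if "1 \<le> k" for k
    using assms(9) that by (simp add: stochastic_process_def)
  have Cq: "distr M (count_space UNIV) (C k) = measure_pmf q" if "1 \<le> k" for k
    using that q assms(10)[OF that] by (intro M.distr_eq_measure_pmfI C) auto
  show ?thesis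
  proof (rule process_law_eqI_countable)
    show "prob_space M" "prob_space M'" by fact+
    show "stochastic_process {0..} ?S M (\<lambda>t \<omega>. \<lambda>i\<in>{1..K}. class_count N C i t \<omega>)"
      unfolding stochastic_process_def
      using N(1) by (intro ballI measurable_restrict class_count_measurable C) (auto simp: stochastic_process_def)
    show "stochastic_process {0..} ?S M' (\<lambda>t \<omega>. \<lambda>i\<in>{1..K}. P i (p i * Y t \<omega>) \<omega>)"
      unfolding stochastic_process_def
    proof (intro ballI measurable_restrict time_changed_measurable[OF assms(13)])
      fix t i assume "t \<in> {0::real..}" "i \<in> {1..K}"
      then have [measurable]: "Y t \<in> borel_measurable M'" using Y by (simp add: stochastic_process_def)
      show "(\<lambda>\<omega>. p i * Y t \<omega>) \<in> borel_measurable M'" by measurable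
      show "0 \<le> p i * Y t \<omega>" for \<omega>
        using p[OF \<open>i \<in> {1..K}\<close>] inverse_process_nonneg[of L t \<omega>] by (simp add: assms(15))
    qed
    show "countable (space ?S)"
      by (auto simp: space_PiM intro: countable_PiE)
    show "{x} \<in> sets ?S" if "x \<in> space ?S" for x
    proof -
      have "{x} = (\<Pi>\<^sub>E i\<in>{1..K}. {x i})"
        using that by (auto simp: space_PiM PiE_iff intro!: PiE_singleton[symmetric])
      then show ?thesis by (auto intro!: sets_PiM_I_finite)
    qed
    fix J :: "real set" and \<nu> assume J: "finite J" "J \<subseteq> {0..}" and \<nu>: "\<nu> \<in> J \<rightarrow> space ?S"
    have \<nu>_iff: "(\<forall>s\<in>J. (\<lambda>i\<in>{1..K}. X s i) = \<nu> s) \<longleftrightarrow> (\<forall>s\<in>J. \<forall>i\<in>{1..K}. X s i = \<nu> s i)" for X :: "real \<Rightarrow> nat \<Rightarrow> nat"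
    proof (intro ball_cong refl)
      fix s assume "s \<in> J"
      then have "\<nu> s \<in> extensional {1..K}" using \<nu> by (auto simp: space_PiM PiE_iff)
      then show "(\<lambda>i\<in>{1..K}. X s i) = \<nu> s \<longleftrightarrow> (\<forall>i\<in>{1..K}. X s i = \<nu> s i)"
        by (auto simp: extensional_def fun_eq_iff restrict_def)
    qed
    obtain T m where T: "mono T" "T 0 = 0" "J = (\<lambda>j. T (Suc j)) ` {..<m::nat}"
      using finite_nonneg_enumeration[OF J] by blast
    \<comment> \<open>Index \<open>0\<close> is a starting state added by hand, with clock and
      counts set to zero; \<open>Y 0\<close> need not vanish on every path.\<close>
    define n where "n j = (if j = 0 then \<lambda>_. 0 else \<nu> (T j))" for j
    define y where "y \<omega> j = (if j = 0 then 0 else Y (T j) \<omega>)" for \<omega> j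
    have J_iff: "(\<forall>s\<in>J. \<forall>i\<in>{1..K}. X (Y s \<omega>) i = \<nu> s i) \<longleftrightarrow> (\<forall>j<m. \<forall>i\<in>{1..K}. X (y \<omega> (Suc j)) i = n (Suc j) i)"
      for X :: "real \<Rightarrow> nat \<Rightarrow> nat" and \<omega>
      unfolding T(3) by (auto simp: n_def y_def)
    \<comment> \<open>Only almost surely: on a bounded path \<open>Y\<close> can drop to its default
      value \<open>0\<close>.\<close>
    have y_mono: "AE \<omega> in M'. mono (y \<omega>)"
      using L_unbounded
    proof eventually_elim
      case (elim \<omega>)
      show ?case
      proof (rule monoI)
        fix j k :: nat assume "j \<le> k"
        obtain s where "0 < s" "T k < L s \<omega>" using elim by blast
        then show "y \<omega> j \<le> y \<omega> k"
          using inverse_process_mono[of s "T k" L \<omega> "T j"] monoD[OF T(1) \<open>j \<le> k\<close>] inverse_process_nonneg[of L _ \<omega>] \<open>j \<le> k\<close>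
          by (auto simp: y_def assms(15))
      qed
    qed
    have "emeasure M {\<omega>\<in>space M. \<forall>s\<in>J. (\<lambda>i\<in>{1..K}. class_count N C i s \<omega>) = \<nu> s}
        = emeasure M {\<omega>\<in>space M. \<forall>s\<in>J. \<forall>i\<in>{1..K}. class_count N C i s \<omega> = \<nu> s i}"
      unfolding \<nu>_iff ..
    also have "\<dots> = (\<integral>\<^sup>+c. emeasure (FPP \<alpha> r) {f\<in>space (\<Pi>\<^sub>M t\<in>{0..}. count_space UNIV).
        \<forall>s\<in>J. \<forall>i\<in>{1..K}. card {k. k < f s \<and> c k = i} = \<nu> s i} \<partial>Qs)"
      unfolding N(2)[symmetric]
      by (rule emeasure_class_counts[OF assms(7) N(1) assms(9) Cq assms(11) J finite_atLeastAtMost])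
    also have "\<dots> = (\<integral>\<^sup>+\<omega>. emeasure Z {z\<in>space Z. \<forall>s\<in>J. \<forall>i\<in>{1..K}. card {k. k < renewals (fst z) (Y s \<omega>) \<and> snd z k = i} = \<nu> s i} \<partial>M')"
      unfolding assms(15) by (rule nn_integral_FPP_marks[OF J])
    \<comment> \<open>For a fixed monotone clock both integrands equal the same product of Poisson
      transition probabilities.\<close>
    also have "\<dots> = (\<integral>\<^sup>+\<omega>. emeasure M' {\<omega>'\<in>space M'. \<forall>s\<in>J. \<forall>i\<in>{1..K}. P i (p i * Y s \<omega>) \<omega>' = \<nu> s i} \<partial>M')"
    proof (rule nn_integral_cong_AE, use y_mono in eventually_elim)
      case (elim \<omega>)
      have 0: "y \<omega> 0 = 0" "\<And>i. n 0 i = 0" by (simp_all add: y_def n_def)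
      have "emeasure Z {z\<in>space Z. \<forall>s\<in>J. \<forall>i\<in>{1..K}. card {k. k < renewals (fst z) (Y s \<omega>) \<and> snd z k = i} = \<nu> s i}
          = ennreal (\<Prod>j<m. \<Prod>i\<in>{1..K}. poisson_transition (r powr \<alpha> * pmf q i * (y \<omega> (Suc j) - y \<omega> j)) (n j i) (n (Suc j) i))"
      proof -
        have "(\<forall>s\<in>J. \<forall>i\<in>{1..K}. card {k. k < renewals (fst z) (Y s \<omega>) \<and> snd z k = i} = \<nu> s i) \<longleftrightarrow>
            (\<forall>j<m. \<forall>i\<in>{1..K}. card {k. k < renewals (fst z) (y \<omega> (Suc j)) \<and> snd z k = i} = n (Suc j) i)"
          for z :: "(nat \<Rightarrow> real) \<times> (nat \<Rightarrow> nat)"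
          by (rule J_iff)
        then show ?thesis
          using emeasure_renewals_fidi[where y="y \<omega>" and n=n and m=m, OF elim 0(1) 0(2)] by (simp only:)
      qed
      also have "\<dots> = ennreal (\<Prod>j<m. \<Prod>i\<in>{1..K}. poisson_transition (r powr \<alpha> * p i * (y \<omega> (Suc j) - y \<omega> j)) (n j i) (n (Suc j) i))"
        using q(2) by simp
      also have "\<dots> = emeasure M' {\<omega>'\<in>space M'. \<forall>s\<in>J. \<forall>i\<in>{1..K}. P i (p i * Y s \<omega>) \<omega>' = \<nu> s i}"
      proof -
        have ind: "M'.indep_sets (\<lambda>i. process_sigma {0..} (count_space UNIV) M' (P i)) {1..K}"
          using M'.indep_sets_mono_index[OF _ assms(16), of "{1..K}"]
          by (rule M'.indep_sets_cong[THEN iffD1, rotated 2]) auto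
        have "(\<forall>s\<in>J. \<forall>i\<in>{1..K}. P i (p i * Y s \<omega>) \<omega>' = \<nu> s i) \<longleftrightarrow>
            (\<forall>j<m. \<forall>i\<in>{1..K}. P i (p i * y \<omega> (Suc j)) \<omega>' = n (Suc j) i)" for \<omega>'
          by (rule J_iff)
        then show ?thesis
          using emeasure_poisson_processes_fidi[where y="y \<omega>" and n=n and m=m and P=P and p=p,
              OF assms(12,13) less_imp_le[OF p] \<mu> assms(4) ind elim 0(1) 0(2)]
          by (simp only:)
      qed
      finally show ?case .
    qed
    also have "\<dots> = emeasure M' {\<omega>\<in>space M'. \<forall>s\<in>J. \<forall>i\<in>{1..K}. P i (p i * Y s \<omega>) \<omega> = \<nu> s i}"
      using p by (intro emeasure_time_changed[OF assms(12,13) _ Y _ assms(16) J, symmetric])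
        (auto simp: assms(15) inverse_process_nonneg less_imp_le)
    also have "\<dots> = emeasure M' {\<omega>\<in>space M'. \<forall>s\<in>J. (\<lambda>i\<in>{1..K}. P i (p i * Y s \<omega>) \<omega>) = \<nu> s}"
      unfolding \<nu>_iff ..
    finally show "emeasure M {\<omega>\<in>space M. \<forall>s\<in>J. (\<lambda>i\<in>{1..K}. class_count N C i s \<omega>) = \<nu> s}
      = emeasure M' {\<omega>\<in>space M'. \<forall>s\<in>J. (\<lambda>i\<in>{1..K}. P i (p i * Y s \<omega>) \<omega>) = \<nu> s}" .
  qed
qed

end
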